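(* Let $\mu$ be a $\sigma$-finite measure on $(E,\mathcal E)$, and let $(E_n)_{n\in\mathbb Z_+}$ be sets in $\mathcal E$ with $E=\bigcup_{n\ge1}E_n$, $E_n\subset E_{n+1}$ and $\mu(E_n)\in(0,\infty)$ for each $n$. Define $$M_\alpha^{(k)}(A):=\bigvee_{n\ge1}M_{\alpha,E_n}^{(k)}(A),\qquad A\in\mathcal E^{(k)},\ k\in\mathbb Z_+ .$$ Then the following hold. (1) (LePage representation) In the sense of equality of finite-dimensional distributions, $$\bigl(M_\alpha^{(k)}(A)\bigr)_{A\in\mathcal E^{(k)},\,k\in\mathbb Z_+}\overset{d}{=}\Biggl(\bigvee_{\boldsymbol j\in\mathcal D_k}\Bigl\{\prod_{r=1}^k\Gamma_{j_r}^{-1/\alpha}\psi(T_{j_r})^{1/\alpha}\Bigr\}\mathbf 1_{\{(T_{j_1},\dots,T_{j_k})\in A\}}\Biggr)_{A\in\mathcal E^{(k)},\,k\in\mathbb Z_+}.$$ (2) ($\sigma$-maxitivity) For any $B_j\in\mathcal E^{(k)}$, $j\in\mathbb Z_+$, $M_\alpha^{(k)}\bigl(\bigcup_{i\ge1}B_i\bigr)=\bigvee_{i\ge1}M_\alpha^{(k)}(B_i)$ a.s. (3) If $(F_n)_{n\in\mathbb Z_+}$ is another sequence in $\mathcal E$ with $E=\bigcup_nF_n$, $F_n\subset F_{n+1}$ and $\mu(F_n)\in(0,\infty)$ for each $n$, then for any $A\in\mathcal E^{(k)}$, $$\bigvee_{n=1}^\infty M_{\alpha,E_n}^{(k)}(A)=\bigvee_{n=1}^\infty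 M_{\alpha,F_n}^{(k)}(A)\quad\text{a.s.}$$
   Context: $\mathbb Z_+=\{1,2,\dots\}$, $\alpha\in(0,\infty)$, $\bigvee$ denotes supremum. $(E,\mathcal E)$ is a Borel space: there is a measurable bijection, with measurable inverse, from $E$ onto a Borel subset of $[0,1]$. The measure $\mu$ is nonzero. An (independently scattered) $\alpha$-Fréchet random sup measure $M_\alpha=(M_\alpha(A))_{A\in\mathcal E}$ with control measure $\mu$ is a family of $[0,\infty]$-valued random variables on one probability space such that: (i) $M_\alpha(A_1),\dots,M_\alpha(A_n)$ are independent for disjoint $A_1,\dots,A_n\in\mathcal E$; (ii) $\mathbb P(M_\alpha(A)\le x)=\exp\{-\mu(A)x^{-\alpha}\}$ for $x\in(0,\infty)$ (so $M_\alpha(A)=\infty$ a.s. if $\mu(A)=\infty$); (iii) $M_\alpha(\bigcup_{j\ge1}A_j)=\bigvee_{j\ge1}M_\alpha(A_j)$ a.s. for any $A_j\in\mathcal E$. Fix such an $M_\alpha$. $\mu^k$ is the product measure on $(E^k,\mathcal E^k)$, $D^{(k)}=\{(x_1,\dots,x_k)\in E^k:x_i=x_j\text{ for some }i\ne j\}$, $E^{(k)}=E^k\setminus D^{(k)}$, $\mathcal E^{(k)}=\{A\cap E^{(k)}:A\in\mathcal E^k\}$. Product random sup measure for a finite control measure: if $N_\alpha$ is an $\alpha$-Fréchet random sup measure on $(E,\mathcal E)$ with finite control measure $\nu$, let $N_\alpha^{(k)}(A_1\times\cdots\times A_k)=N_\alpha(A_1)\cdots N_\alpha(A_k)$ for pairwise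 disjoint $A_1,\dots,A_k\in\mathcal E$ (an off-diagonal rectangle); let $N_\alpha^{(k)}(\bigcup_{i=1}^mB_i)=\bigvee_{i=1}^mN_\alpha^{(k)}(B_i)$ for off-diagonal rectangles $B_i$; and for $A\in\mathcal E^{(k)}$ let $N_\alpha^{(k)}(A)$ be the limit in $L^\gamma$, $\gamma\in(0,\alpha)$, of $N_\alpha^{(k)}(A_n)$, where the $A_n$ are finite unions of off-diagonal rectangles with $\nu^k(A_n\Delta A)\to0$ (this limit exists and is a.s. independent of the choices and of $\gamma$). For $G\in\mathcal E$ with $\mu(G)\in(0,\infty)$, $M_{\alpha,G}(\cdot):=M_\alpha(\cdot\cap G)$ is an $\alpha$-Fréchet random sup measure with finite control measure $\mu(\cdot\cap G)$, and $M_{\alpha,G}^{(k)}$ is the associated product random sup measure just described. $\mathcal D_k=\{\boldsymbol j\in\mathbb Z_+^k:j_1,\dots,j_k\text{ all distinct}\}$. $m$ is a probability measure on $(E,\mathcal E)$ equivalent to $\mu$ with $\psi=d\mu/dm\in(0,\infty)$ $m$-a.e.; $(\Gamma_i)_{i\in\mathbb Z_+}$ are the arrival times of a standard Poisson process on $[0,\infty)$; $(T_i)_{i\in\mathbb Z_+}$ are i.i.d. with law $m$, independent of $(\Gamma_i)$. *)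

theory Defs
  imports "HOL-Probability.Probability"
begin

text \<open>
  Conventions. A measure \<open>\<mu>\<close> carries its measurable space \<open>(E, \<E>) = (space \<mu>, sets \<mu>)\<close>.
  Points of \<open>E\<^sup>k\<close> are functions on the index set \<open>{..<k}\<close> that are extensional, as in
  \<open>Pi\<^sub>M {..<k} (\<lambda>_. \<mu>)\<close>. All sequences are indexed by \<open>nat\<close> starting at 0, where the mathematics
  counts from 1. Random variables with values in \<open>[0, \<infinity>]\<close> have type \<open>ennreal\<close>.
\<close>

definition Borel_space :: "'a measure \<Rightarrow> bool" where
  "Borel_space \<mu> \<longleftrightarrow>
     (\<exists>f :: 'a \<Rightarrow> real. \<exists>B \<in> sets borel. B \<subseteq> {0..1} \<and> bij_betw f (space \<mu>) B \<and>
        f \<in> measurable \<mu> (restrict_space borel B) \<and>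
        inv_into (space \<mu>) f \<in> measurable (restrict_space borel B) \<mu>)"

text \<open>
  The distribution function is \<open>exp (- \<mu>(A) x\<^bsup>-\<alpha>\<^esup>)\<close>, with the value 0 if \<open>\<mu>(A) = \<infinity>\<close>; that case is
  separate because \<open>measure \<mu> A = 0\<close> there.
\<close>

definition Frechet_sup_measure ::
  "'w measure \<Rightarrow> real \<Rightarrow> 'a measure \<Rightarrow> ('a set \<Rightarrow> 'w \<Rightarrow> ennreal) \<Rightarrow> bool" where
  "Frechet_sup_measure P \<alpha> \<mu> M \<longleftrightarrow>
     prob_space P \<and>
     (\<forall>A \<in> sets \<mu>. M A \<in> borel_measurable P) \<and>
     (\<forall>(n::nat) A. (\<forall>i<n. A i \<in> sets \<mu>) \<and> disjoint_family_on A {..<n} \<longrightarrow>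
        prob_space.indep_vars P (\<lambda>_. borel) (\<lambda>i. M (A i)) {..<n}) \<and>
     (\<forall>A \<in> sets \<mu>. \<forall>x>0. measure P {\<omega> \<in> space P. M A \<omega> \<le> ennreal x} =
        (if emeasure \<mu> A = \<infinity> then 0 else exp (- (measure \<mu> A * x powr (- \<alpha>))))) \<and>
     (\<forall>A :: nat \<Rightarrow> 'a set. (\<forall>j. A j \<in> sets \<mu>) \<longrightarrow>
        (AE \<omega> in P. M (\<Union>j. A j) \<omega> = (SUP j. M (A j) \<omega>)))"

abbreviation power_measure :: "'a measure \<Rightarrow> nat \<Rightarrow> (nat \<Rightarrow> 'a) measure" where
  "power_measure \<mu> k \<equiv> Pi\<^sub>M {..<k} (\<lambda>_. \<mu>)"

definition off_diag :: "'a measure \<Rightarrow> nat \<Rightarrow> (nat \<Rightarrow> 'a) set" where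
  "off_diag \<mu> k = {x \<in> space (power_measure \<mu> k). \<not> (\<exists>i<k. \<exists>j<k. i \<noteq> j \<and> x i = x j)}"

definition off_diag_sets :: "'a measure \<Rightarrow> nat \<Rightarrow> (nat \<Rightarrow> 'a) set set" where
  "off_diag_sets \<mu> k = {A \<inter> off_diag \<mu> k | A. A \<in> sets (power_measure \<mu> k)}"

text \<open>
  An off-diagonal rectangle is given by its sides \<open>R 0, \<dots>, R (k - 1)\<close>, and a finite union of
  off-diagonal rectangles by a finite set \<open>\<R>\<close> of such families of sides.
\<close>

definition off_diag_rect :: "'a measure \<Rightarrow> nat \<Rightarrow> (nat \<Rightarrow> 'a set) \<Rightarrow> bool" where
  "off_diag_rect \<mu> k R \<longleftrightarrow> (\<forall>i<k. R i \<in> sets \<mu>) \<and> disjoint_family_on R {..<k}"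

definition rect_union :: "nat \<Rightarrow> (nat \<Rightarrow> 'a set) set \<Rightarrow> (nat \<Rightarrow> 'a) set" where
  "rect_union k \<R> = (\<Union>R\<in>\<R>. Pi\<^sub>E {..<k} R)"

text \<open>
  The random variable \<open>\<Or>\<^sub>i N\<^bsup>(k)\<^esup>(B\<^sub>i)\<close>, where \<open>N\<^bsup>(k)\<^esup>(A\<^sub>1 \<times> \<dots> \<times> A\<^sub>k) = N(A\<^sub>1) \<cdots> N(A\<^sub>k)\<close>. It is attached
  to the representation \<open>\<R>\<close> of the union, on which it does not depend up to a null set.
\<close>

definition rect_sup ::
  "('a set \<Rightarrow> 'w \<Rightarrow> ennreal) \<Rightarrow> nat \<Rightarrow> (nat \<Rightarrow> 'a set) set \<Rightarrow> 'w \<Rightarrow> ennreal" where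
  "rect_sup N k \<R> \<omega> = (SUP R\<in>\<R>. \<Prod>i<k. N (R i) \<omega>)"

text \<open>
  \<open>L\<^sup>\<gamma>\<close> for \<open>[0, \<infinity>]\<close>-valued random variables, where \<open>\<gamma> > 0\<close> may be smaller than 1. Finiteness almost
  surely has to be required, because \<open>enn2real\<close> maps \<open>\<infinity>\<close> to 0.
\<close>

definition in_L :: "'w measure \<Rightarrow> real \<Rightarrow> ('w \<Rightarrow> ennreal) \<Rightarrow> bool" where
  "in_L P \<gamma> X \<longleftrightarrow> X \<in> borel_measurable P \<and> (AE \<omega> in P. X \<omega> < \<infinity>) \<and>
     (\<integral>\<^sup>+ \<omega>. ennreal (enn2real (X \<omega>) powr \<gamma>) \<partial>P) < \<infinity>"

definition tendsto_in_L ::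
  "'w measure \<Rightarrow> real \<Rightarrow> (nat \<Rightarrow> 'w \<Rightarrow> ennreal) \<Rightarrow> ('w \<Rightarrow> ennreal) \<Rightarrow> bool" where
  "tendsto_in_L P \<gamma> X Y \<longleftrightarrow> (\<forall>n. in_L P \<gamma> (X n)) \<and> in_L P \<gamma> Y \<and>
     (\<lambda>n. \<integral>\<^sup>+ \<omega>. ennreal (\<bar>enn2real (X n \<omega>) - enn2real (Y \<omega>)\<bar> powr \<gamma>) \<partial>P) \<longlonglongrightarrow> 0"

text \<open>
  The product random sup measure of \<open>N\<close>, for a finite control measure \<open>\<nu>\<close>. The limit determines
  \<open>N\<^bsup>(k)\<^esup>(A)\<close> up to a null set only, and \<open>SOME\<close> selects a version of it.
\<close>

definition product_sup_measure ::
  "'w measure \<Rightarrow> real \<Rightarrow> 'a measure \<Rightarrow> ('a set \<Rightarrow> 'w \<Rightarrow> ennreal) \<Rightarrow>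
   nat \<Rightarrow> (nat \<Rightarrow> 'a) set \<Rightarrow> 'w \<Rightarrow> ennreal" where
  "product_sup_measure P \<alpha> \<nu> N k A =
     (SOME X. \<exists>\<R>. (\<forall>n::nat. finite (\<R> n) \<and> (\<forall>R \<in> \<R> n. off_diag_rect \<nu> k R)) \<and>
        (\<lambda>n. emeasure (power_measure \<nu> k)
               ((rect_union k (\<R> n) - A) \<union> (A - rect_union k (\<R> n)))) \<longlonglongrightarrow> 0 \<and>
        (\<forall>\<gamma>. 0 < \<gamma> \<and> \<gamma> < \<alpha> \<longrightarrow> tendsto_in_L P \<gamma> (\<lambda>n. rect_sup N k (\<R> n)) X))"

text \<open>\<open>M\<^bsub>\<alpha>,G\<^esub>\<^bsup>(k)\<^esup>\<close>; the control measure \<open>density \<mu> (indicator G)\<close> is \<open>\<mu>(\<cdot> \<inter> G)\<close> on all of \<open>(E, \<E>)\<close>.\<close>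

definition local_product ::
  "'w measure \<Rightarrow> real \<Rightarrow> 'a measure \<Rightarrow> ('a set \<Rightarrow> 'w \<Rightarrow> ennreal) \<Rightarrow> 'a set \<Rightarrow>
   nat \<Rightarrow> (nat \<Rightarrow> 'a) set \<Rightarrow> 'w \<Rightarrow> ennreal" where
  "local_product P \<alpha> \<mu> M G =
     product_sup_measure P \<alpha> (density \<mu> (indicator G)) (\<lambda>B. M (B \<inter> G))"

definition exhausts :: "'a measure \<Rightarrow> (nat \<Rightarrow> 'a set) \<Rightarrow> bool" where
  "exhausts \<mu> E \<longleftrightarrow> (\<forall>n. E n \<in> sets \<mu>) \<and> (\<Union>n. E n) = space \<mu> \<and> (\<forall>n. E n \<subseteq> E (Suc n)) \<and>
     (\<forall>n. 0 < emeasure \<mu> (E n) \<and> emeasure \<mu> (E n) < \<infinity>)"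

definition sigma_product ::
  "'w measure \<Rightarrow> real \<Rightarrow> 'a measure \<Rightarrow> ('a set \<Rightarrow> 'w \<Rightarrow> ennreal) \<Rightarrow> (nat \<Rightarrow> 'a set) \<Rightarrow>
   nat \<Rightarrow> (nat \<Rightarrow> 'a) set \<Rightarrow> 'w \<Rightarrow> ennreal" where
  "sigma_product P \<alpha> \<mu> M E k A \<omega> = (SUP n. local_product P \<alpha> \<mu> M (E n) k A \<omega>)"

text \<open>Arrival times of a standard Poisson process; \<open>\<Gamma> 0\<close> is the first one.\<close>

definition Poisson_arrivals :: "'v measure \<Rightarrow> (nat \<Rightarrow> 'v \<Rightarrow> real) \<Rightarrow> bool" where
  "Poisson_arrivals Q \<Gamma> \<longleftrightarrow>
     (let gap = (\<lambda>i \<omega>. case i of 0 \<Rightarrow> \<Gamma> 0 \<omega> | Suc i' \<Rightarrow> \<Gamma> (Suc i') \<omega> - \<Gamma> i' \<omega>)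
      in prob_space.indep_vars Q (\<lambda>_. borel) gap UNIV \<and>
         (\<forall>i. distributed Q lborel (gap i) (exponential_density 1)))"

text \<open>
  The data of the LePage series. A Radon-Nikodym derivative is unique only almost everywhere, so
  \<open>\<psi>\<close> is an arbitrary version of \<open>d\<mu>/dm\<close>. Independence of the two sequences is stated for the
  \<open>\<sigma>\<close>-algebras they generate, because \<open>indep_var\<close> needs both to have the same type.
\<close>

definition LePage_data ::
  "'v measure \<Rightarrow> 'a measure \<Rightarrow> 'a measure \<Rightarrow> ('a \<Rightarrow> ennreal) \<Rightarrow>
   (nat \<Rightarrow> 'v \<Rightarrow> real) \<Rightarrow> (nat \<Rightarrow> 'v \<Rightarrow> 'a) \<Rightarrow> bool" where
  "LePage_data Q \<mu> m \<psi> \<Gamma> T \<longleftrightarrow>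
     prob_space m \<and> sets m = sets \<mu> \<and> absolutely_continuous \<mu> m \<and> absolutely_continuous m \<mu> \<and>
     \<psi> \<in> borel_measurable m \<and> \<mu> = density m \<psi> \<and> (AE x in m. 0 < \<psi> x \<and> \<psi> x < \<infinity>) \<and>
     prob_space Q \<and> Poisson_arrivals Q \<Gamma> \<and>
     prob_space.indep_vars Q (\<lambda>_. m) T UNIV \<and> (\<forall>i. distr Q m (T i) = m) \<and>
     prob_space.indep_set Q
       {(\<lambda>\<omega> i. \<Gamma> i \<omega>) -` S \<inter> space Q | S. S \<in> sets (Pi\<^sub>M UNIV (\<lambda>_. borel))}
       {(\<lambda>\<omega> i. T i \<omega>) -` S \<inter> space Q | S. S \<in> sets (Pi\<^sub>M UNIV (\<lambda>_. m))}"

definition distinct_indices :: "nat \<Rightarrow> (nat \<Rightarrow> nat) set" where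
  "distinct_indices k = {j \<in> {..<k} \<rightarrow>\<^sub>E UNIV. inj_on j {..<k}}"

definition LePage_series ::
  "real \<Rightarrow> ('a \<Rightarrow> ennreal) \<Rightarrow> (nat \<Rightarrow> 'v \<Rightarrow> real) \<Rightarrow> (nat \<Rightarrow> 'v \<Rightarrow> 'a) \<Rightarrow>
   nat \<Rightarrow> (nat \<Rightarrow> 'a) set \<Rightarrow> 'v \<Rightarrow> ennreal" where
  "LePage_series \<alpha> \<psi> \<Gamma> T k A \<omega> =
     (SUP j\<in>distinct_indices k.
        ennreal (\<Prod>r<k. \<Gamma> (j r) \<omega> powr (- 1 / \<alpha>) * enn2real (\<psi> (T (j r) \<omega>)) powr (1 / \<alpha>)) *
        indicator A (\<lambda>r\<in>{..<k}. T (j r) \<omega>))"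

text \<open>
  Equality of finite-dimensional distributions of two families of \<open>[0, \<infinity>]\<close>-valued random variables.
  Measurability is included because \<open>distr\<close> is meaningless without it.
\<close>

definition same_fdd ::
  "'w measure \<Rightarrow> 'v measure \<Rightarrow> 'i set \<Rightarrow> ('i \<Rightarrow> 'w \<Rightarrow> ennreal) \<Rightarrow> ('i \<Rightarrow> 'v \<Rightarrow> ennreal) \<Rightarrow> bool" where
  "same_fdd P Q I X Y \<longleftrightarrow>
     (\<forall>i\<in>I. X i \<in> borel_measurable P \<and> Y i \<in> borel_measurable Q) \<and>
     (\<forall>J. finite J \<and> J \<subseteq> I \<longrightarrow>
        distr P (Pi\<^sub>M J (\<lambda>_. borel)) (\<lambda>\<omega>. \<lambda>i\<in>J. X i \<omega>) =
        distr Q (Pi\<^sub>M J (\<lambda>_. borel)) (\<lambda>\<omega>. \<lambda>i\<in>J. Y i \<omega>))"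

end

theory Submission
  imports Defs
begin

text \<open>
  Everything is compared with one explicit model. Let \<open>\<Gamma>\<close> be the arrival times of a standard Poisson
  process and \<open>T\<close> independent marks with law \<open>m\<close>, and give the point \<open>j\<close> the weight
  \<open>w\<^sub>j = (\<psi>(T\<^sub>j) / \<Gamma>\<^sub>j)\<^bsup>1/\<alpha>\<^esup>\<close>. On the space \<open>canon m\<close> that carries \<open>\<Gamma>\<close> and \<open>T\<close>, the variable \<open>W1 A\<close> is the
  supremum of the weights with marks in \<open>A\<close>, and \<open>W k A\<close> is the supremum of the products of \<open>k\<close> weights
  over tuples of distinct points with marks in \<open>A\<close>, that is, the LePage series. In this model the three
  claims hold for every outcome: \<open>W k\<close> commutes with countable unions (\<open>tuple_sup_UN\<close>), hence
  \<open>W k A\<close> is the supremum of \<open>W k (A \<inter> E\<^sub>n\<^sup>k)\<close> for every exhausting sequence \<open>E\<close>. So it suffices that the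
  variables \<open>M\<^bsub>\<alpha>,G\<^esub>\<^bsup>(k)\<^esup>(A)\<close>, for countably many triples \<open>(G, k, A)\<close> at once, have the joint law of the
  variables \<open>W k (A \<inter> G\<^sup>k)\<close>. This is \<open>product_limits_joint_law\<close>; it has three ingredients.

  First, \<open>W1\<close> and \<open>M\<close> have the same law as processes indexed by the measurable sets. The void
  probabilities of the marked Poisson process (\<open>poisson_void_probability\<close>) give the joint distribution
  function of \<open>W1\<close> on disjoint sets, and such distribution functions together with maxitivity
  determine the law of the whole process (\<open>frechet_family_unique\<close>).

  Secondly, \<open>W k\<close> of an off-diagonal rectangle is the product of the values of \<open>W1\<close> on its sides
  (\<open>tuple_sup_rect\<close>), and if finite unions \<open>A\<^sub>n\<close> of such rectangles approach \<open>A\<close> so fast that the measures of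
  the symmetric differences are summable, then \<open>W k (A\<^sub>n \<inter> G\<^sup>k)\<close> converges to \<open>W k (A \<inter> G\<^sup>k)\<close> almost surely
  (\<open>AE_W_tendsto\<close>): by Borel-Cantelli each tuple leaves the symmetric differences eventually, and only
  finitely many points in \<open>G\<close> have a weight above a given level. Hence \<open>W k (A \<inter> G\<^sup>k)\<close> is almost surely a
  measurable functional of the process \<open>W1\<close>, the upper limit along the rectangles, and the same
  functional of \<open>M\<close> is the limit that defines \<open>M\<^bsub>\<alpha>,G\<^esub>\<^bsup>(k)\<^esup>(A)\<close>.

  Thirdly, this limit has to exist in \<open>L\<^sup>\<gamma>\<close> for every \<open>\<gamma> < \<alpha>\<close>, for which \<open>W k (E\<^bsup>(k)\<^esup> \<inter> G\<^sup>k)\<close> serves as a dominating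
  variable (\<open>W_off_diag_in_L\<close>). The bound by \<open>W1 G ^ k\<close> would only give \<open>k \<gamma> < \<alpha>\<close>. Instead, the law of \<open>W1\<close> on
  \<open>G\<close> is represented with a constant density; then the largest product over distinct points is a
  constant times \<open>\<Prod>\<^bsub>r<k\<^esub> \<Gamma>\<^sub>r\<^bsup>-1/\<alpha>\<^esup>\<close>, which is at most the same product over the independent exponential gaps,
  and an exponential variable has a negative moment of order \<open>\<gamma>/\<alpha> < 1\<close>.
\<close>

section \<open>Void probabilities of a marked Poisson process\<close>

definition exp_law :: "real measure" where
  "exp_law = density lborel (exponential_density 1)"

text \<open>
  A point of this space is a pair of the sequence of gaps between arrivals and the sequence of marks,
  so that all coordinates are independent.
\<close>
definition canon :: "'a measure \<Rightarrow> ((nat \<Rightarrow> real) \<times> (nat \<Rightarrow> 'a)) measure" where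
  "canon m = Pi\<^sub>M UNIV (\<lambda>_. exp_law) \<Otimes>\<^sub>M Pi\<^sub>M UNIV (\<lambda>_. m)"

definition arrival :: "(nat \<Rightarrow> real) \<Rightarrow> nat \<Rightarrow> real" where
  "arrival x i = (\<Sum>l\<le>i. x l)"

lemma sets_exp_law [simp, measurable_cong]: "sets exp_law = sets borel"
  and space_exp_law [simp]: "space exp_law = UNIV"
  by (simp_all add: exp_law_def)

lemma prob_space_exp_law: "prob_space exp_law"
  unfolding exp_law_def by (rule prob_space_erlang_density) simp

lemma prob_space_canon: "prob_space m \<Longrightarrow> prob_space (canon m)"
  unfolding canon_def
  by (intro prob_space_pair prob_space_PiM prob_space_exp_law)

lemma AE_exp_law_pos: "AE y in exp_law. 0 < y"
proof -
  have "AE y in lborel. y \<noteq> (0::real)" by (rule AE_lborel_singleton)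
  then show ?thesis
    unfolding exp_law_def by (subst AE_density) (auto simp: erlang_density_def not_less)
qed

lemma arrival_measurable [measurable]:
  "(\<lambda>x. arrival x i) \<in> borel_measurable (Pi\<^sub>M UNIV (\<lambda>_. borel))"
  unfolding arrival_def by measurable

lemma arrival_canon_measurable [measurable]:
  "(\<lambda>c. arrival (fst c) i) \<in> borel_measurable (canon m)"
  unfolding canon_def by measurable

lemma mark_canon_measurable [measurable]:
  "(\<lambda>c. snd c i) \<in> canon m \<rightarrow>\<^sub>M m"
  unfolding canon_def by measurable

lemma arrival_case_nat [simp]:
  "arrival (case_nat y x) 0 = y"
  "arrival (case_nat y x) (Suc i) = y + arrival x i"
  unfolding arrival_def by (simp_all add: sum.atMost_Suc_shift del: sum.atMost_Suc)

lemma AE_gaps_pos: "AE x in Pi\<^sub>M UNIV (\<lambda>_::nat. exp_law). \<forall>i. 0 < x i"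
  unfolding AE_all_countable
  by (auto intro!: AE_PiM_component prob_space_exp_law AE_exp_law_pos)

lemma AE_canon_gaps_pos:
  assumes "prob_space m"
  shows "AE c in canon m. \<forall>i. 0 < fst c i"
proof -
  interpret S: prob_space "Pi\<^sub>M UNIV (\<lambda>_::nat. m)" by (intro prob_space_PiM assms)
  have fstd: "distr (canon m) (Pi\<^sub>M UNIV (\<lambda>_. exp_law)) fst = Pi\<^sub>M UNIV (\<lambda>_. exp_law)"
    unfolding canon_def by (rule S.distr_pair_fst)
  show ?thesis
    apply (rule AE_distrD[of fst "canon m" "Pi\<^sub>M UNIV (\<lambda>_. exp_law)"])
    subgoal unfolding canon_def by measurable
    subgoal unfolding fstd by (rule AE_gaps_pos)
    done
qed

lemma arrival_pos: "\<forall>i. 0 < x i \<Longrightarrow> 0 < arrival x j"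
  unfolding arrival_def by (intro sum_pos) auto

lemma nn_integral_PiM_iter:
  fixes M :: "'b measure" and f :: "(nat \<Rightarrow> 'b) \<Rightarrow> ennreal"
  assumes "prob_space M" and f[measurable]: "f \<in> borel_measurable (Pi\<^sub>M UNIV (\<lambda>_. M))"
  shows "(\<integral>\<^sup>+x. f x \<partial>Pi\<^sub>M UNIV (\<lambda>_. M)) = (\<integral>\<^sup>+y. \<integral>\<^sup>+x. f (case_nat y x) \<partial>Pi\<^sub>M UNIV (\<lambda>_. M) \<partial>M)"
proof -
  interpret M: prob_space M by fact
  interpret sequence_space M ..
  have "(\<integral>\<^sup>+x. f x \<partial>S) = (\<integral>\<^sup>+x. f x \<partial>distr (M \<Otimes>\<^sub>M S) S (\<lambda>(s, \<omega>). case_nat s \<omega>))"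
    by (simp only: PiM_iter)
  also have "\<dots> = (\<integral>\<^sup>+p. f (case_nat (fst p) (snd p)) \<partial>(M \<Otimes>\<^sub>M S))"
    by (subst nn_integral_distr) (auto simp: case_prod_beta)
  also have "\<dots> = (\<integral>\<^sup>+y. \<integral>\<^sup>+x. f (case_nat y x) \<partial>S \<partial>M)"
    by (subst P.nn_integral_fst[symmetric]) auto
  finally show ?thesis .
qed

text \<open>
  The start \<open>s\<close> of the arrivals is a parameter, because conditioning on the first point moves it.
\<close>
definition void_prob :: "'a measure \<Rightarrow> ('a \<Rightarrow> real) \<Rightarrow> real \<Rightarrow> ennreal" where
  "void_prob m h s = emeasure (canon m) {c \<in> space (canon m). \<forall>j. h (snd c j) \<le> s + arrival (fst c) j}"

text \<open>
  The renewal equation: after the first gap \<open>y\<close> and the first mark, the remaining points form an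
  independent copy of the same process, started at \<open>s + y\<close>.
\<close>
lemma void_prob_step:
  assumes m: "prob_space m" and h[measurable]: "h \<in> borel_measurable m"
  shows "void_prob m h s = (\<integral>\<^sup>+y. emeasure m {a \<in> space m. h a \<le> s + y} * void_prob m h (s + y) \<partial>exp_law)"
proof -
  interpret m: prob_space m by fact
  let ?G = "Pi\<^sub>M UNIV (\<lambda>_::nat. exp_law)" and ?S = "Pi\<^sub>M UNIV (\<lambda>_::nat. m)"
  interpret G: prob_space ?G by (intro prob_space_PiM prob_space_exp_law)
  interpret S: prob_space ?S by (intro prob_space_PiM m)
  interpret E: prob_space exp_law by (rule prob_space_exp_law)
  define V where "V s = {c \<in> space (canon m). \<forall>j. h (snd c j) \<le> s + arrival (fst c) j}" for s
  have "V s \<in> sets (canon m)" for s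
    unfolding V_def by measurable
  then have V[measurable]: "V s \<in> sets (?G \<Otimes>\<^sub>M ?S)" for s
    by (simp add: canon_def)
  have w: "void_prob m h s = (\<integral>\<^sup>+x. \<integral>\<^sup>+t. indicator (V s) (x, t) \<partial>?S \<partial>?G)" for s
  proof -
    have "void_prob m h s = (\<integral>\<^sup>+c. indicator (V s) c \<partial>(?G \<Otimes>\<^sub>M ?S))"
      unfolding void_prob_def V_def[symmetric] by (subst nn_integral_indicator) (auto simp: canon_def)
    also have "\<dots> = (\<integral>\<^sup>+x. \<integral>\<^sup>+t. indicator (V s) (x, t) \<partial>?S \<partial>?G)"
      by (subst S.nn_integral_fst[symmetric]) auto
    finally show ?thesis .
  qed
  have shift: "indicator (V s) (case_nat y x, case_nat a t)
     = (indicator {a \<in> space m. h a \<le> s + y} a * indicator (V (s + y)) (x, t) :: ennreal)"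
    if "x \<in> space ?G" "t \<in> space ?S" "a \<in> space m" for s y x a t
  proof -
    have all_nat: "(\<forall>j. R j) \<longleftrightarrow> R 0 \<and> (\<forall>j. R (Suc j))" for R :: "nat \<Rightarrow> bool"
      by (metis not0_implies_Suc)
    have "(\<forall>j. h (case_nat a t j) \<le> s + arrival (case_nat y x) j) \<longleftrightarrow>
        h a \<le> s + y \<and> (\<forall>j. h (t j) \<le> s + y + arrival x j)"
      by (subst all_nat) (simp add: add.assoc)
    moreover have "(case_nat y x, case_nat a t) \<in> space (canon m)" "(x, t) \<in> space (canon m)"
      using that by (auto simp: canon_def space_pair_measure space_PiM PiE_iff split: nat.splits)
    ultimately have "(case_nat y x, case_nat a t) \<in> V s \<longleftrightarrow>
      a \<in> {a \<in> space m. h a \<le> s + y} \<and> (x, t) \<in> V (s + y)"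
      using that by (auto simp: V_def)
    then show ?thesis by (auto split: split_indicator)
  qed
  have "void_prob m h s = (\<integral>\<^sup>+y. \<integral>\<^sup>+x. \<integral>\<^sup>+t. indicator (V s) (case_nat y x, t) \<partial>?S \<partial>?G \<partial>exp_law)"
    unfolding w by (subst nn_integral_PiM_iter[OF prob_space_exp_law]) (auto)
  also have "\<dots> = (\<integral>\<^sup>+y. \<integral>\<^sup>+x. (\<integral>\<^sup>+a. (\<integral>\<^sup>+t. indicator (V s) (case_nat y x, case_nat a t) \<partial>?S) \<partial>m) \<partial>?G \<partial>exp_law)"
    by (intro nn_integral_cong, subst nn_integral_PiM_iter[OF m]) auto
  also have "\<dots> = (\<integral>\<^sup>+y. \<integral>\<^sup>+x. (\<integral>\<^sup>+a. (\<integral>\<^sup>+t. indicator {a \<in> space m. h a \<le> s + y} a * indicator (V (s + y)) (x, t) \<partial>?S) \<partial>m) \<partial>?G \<partial>exp_law)"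
    by (intro nn_integral_cong shift)
  also have "\<dots> = (\<integral>\<^sup>+y. \<integral>\<^sup>+x. (\<integral>\<^sup>+a. indicator {a \<in> space m. h a \<le> s + y} a * (\<integral>\<^sup>+t. indicator (V (s + y)) (x, t) \<partial>?S) \<partial>m) \<partial>?G \<partial>exp_law)"
    by (intro nn_integral_cong nn_integral_cmult) auto
  also have "\<dots> = (\<integral>\<^sup>+y. \<integral>\<^sup>+x. emeasure m {a \<in> space m. h a \<le> s + y} * (\<integral>\<^sup>+t. indicator (V (s + y)) (x, t) \<partial>?S) \<partial>?G \<partial>exp_law)"
    by (intro nn_integral_cong, subst nn_integral_multc) auto
  also have "\<dots> = (\<integral>\<^sup>+y. emeasure m {a \<in> space m. h a \<le> s + y} * void_prob m h (s + y) \<partial>exp_law)"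
    unfolding w by (intro nn_integral_cong nn_integral_cmult) auto
  finally show ?thesis .
qed

lemma void_prob_finite: "prob_space m \<Longrightarrow> void_prob m h s < \<infinity>"
  unfolding void_prob_def
  by (simp add: finite_measure.emeasure_finite prob_space.finite_measure prob_space_canon less_top[symmetric])

lemma void_prob_mono:
  assumes "prob_space m" "h \<in> borel_measurable m" "s \<le> s'"
  shows "void_prob m h s \<le> void_prob m h s'"
proof -
  note assms(2)[measurable]
  show ?thesis
    unfolding void_prob_def using assms(3)
    by (intro emeasure_mono) (auto intro: order_trans)
qed

text \<open>
  All arrivals after \<open>s \<ge> K\<close> exceed \<open>K\<close>; this is the terminal condition for the renewal equation.
\<close>
lemma void_prob_eq_1:
  assumes m: "prob_space m" and [measurable]: "h \<in> borel_measurable m"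
    and "\<And>a. a \<in> space m \<Longrightarrow> h a \<le> K" "K \<le> s"
  shows "void_prob m h s = 1"
proof -
  interpret C: prob_space "canon m" by (rule prob_space_canon) fact
  have "void_prob m h s = emeasure (canon m) (space (canon m))"
    unfolding void_prob_def
  proof (rule emeasure_eq_AE)
    show "AE c in canon m. (c \<in> {c \<in> space (canon m). \<forall>j. h (snd c j) \<le> s + arrival (fst c) j}) = (c \<in> space (canon m))"
      using AE_canon_gaps_pos[OF m]
    proof eventually_elim
      case (elim c)
      have "h (snd c j) \<le> s + arrival (fst c) j" if "c \<in> space (canon m)" for j
      proof -
        have "h (snd c j) \<le> K" using that assms(3) measurable_space[OF mark_canon_measurable that] by simp
        then show ?thesis using arrival_pos[OF elim, of j] assms(4) by simp
      qed
      then show ?case by auto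
    qed
  qed auto
  then show ?thesis by (simp add: C.emeasure_space_1)
qed

text \<open>
  For bounded \<open>h\<close> the renewal equation is a linear differential equation on \<open>[0, K]\<close>, solved with the
  terminal value at \<open>K\<close>. Its coefficient \<open>g\<close>, the distribution function of \<open>h\<close>, is continuous outside
  the finitely many values of \<open>h\<close>, which is enough to conclude that a function with zero derivative there
  is constant.
\<close>
lemma void_prob_simple:
  fixes h :: "'a \<Rightarrow> real"
  assumes m: "prob_space m" and h[measurable]: "h \<in> borel_measurable m"
    and fin: "finite (h ` space m)" and nonneg: "\<And>a. 0 \<le> h a"
  shows "void_prob m h 0 = ennreal (exp (- (\<integral>a. h a \<partial>m)))"
proof -
  interpret m: prob_space m by fact
  obtain K where K: "K > 0" "\<And>a. a \<in> space m \<Longrightarrow> h a \<le> K"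
  proof -
    obtain K' where "\<forall>v\<in>h ` space m. v \<le> K'"
      using fin by (intro that[of "Max (insert 0 (h ` space m))"]) (auto intro: Max_ge)
    then show thesis by (intro that[of "max 1 K'"]) (auto simp: max_def)
  qed
  define g where "g z = measure m {a \<in> space m. h a \<le> z}" for z
  define w where "w s = enn2real (void_prob m h s)" for s
  define \<phi> where "\<phi> s = exp (- s) * w s" for s
  have w: "void_prob m h s = ennreal (w s)" for s
    unfolding w_def using void_prob_finite[OF m] by simp
  have w_nonneg: "0 \<le> w s" for s by (simp add: w_def)
  have "mono w"
    unfolding w_def by (intro monoI enn2real_mono void_prob_mono m h void_prob_finite[unfolded infinity_ennreal_def])
  then have [measurable]: "w \<in> borel_measurable borel" by (rule borel_measurable_mono)
  have "mono g"
    unfolding g_def by (intro monoI m.finite_measure_mono) auto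
  then have g_meas[measurable]: "g \<in> borel_measurable borel" by (rule borel_measurable_mono)
  have g_nonneg: "0 \<le> g z" for z by (simp add: g_def)
  have [measurable]: "\<phi> \<in> borel_measurable borel" unfolding \<phi>_def by measurable
  have \<phi>_nonneg: "0 \<le> \<phi> s" for s by (simp add: \<phi>_def w_nonneg)
  \<comment> \<open>The factor \<open>exp (- s)\<close> turns the renewal equation into an equation without convolution.\<close>
  have step: "ennreal (\<phi> s) = (\<integral>\<^sup>+z. ennreal (indicator {s..} z * (g z * \<phi> z)) \<partial>lborel)" for s
  proof -
    have "ennreal (\<phi> s) = ennreal (exp (-s)) * void_prob m h s"
      by (simp add: \<phi>_def w ennreal_mult' w_nonneg)
    also have "\<dots> = ennreal (exp (-s)) * (\<integral>\<^sup>+y. ennreal (g (s + y) * w (s + y)) \<partial>exp_law)"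
      by (subst void_prob_step[OF m h])
         (simp add: w g_def m.emeasure_eq_measure ennreal_mult' w_nonneg)
    also have "\<dots> = (\<integral>\<^sup>+y. ennreal (exp (-s)) * (exponential_density 1 y * ennreal (g (s + y) * w (s + y))) \<partial>lborel)"
      unfolding exp_law_def by (subst nn_integral_density) (auto simp: nn_integral_cmult)
    also have "\<dots> = (\<integral>\<^sup>+y. ennreal (indicator {s..} (s + 1 * y) * (g (s + 1 * y) * \<phi> (s + 1 * y))) \<partial>lborel)"
      by (intro nn_integral_cong)
         (auto simp: \<phi>_def erlang_density_def ennreal_mult'[symmetric] g_nonneg w_nonneg exp_diff exp_minus exp_add field_simps split: split_indicator)
    also have "\<dots> = (\<integral>\<^sup>+z. ennreal (indicator {s..} z * (g z * \<phi> z)) \<partial>lborel)"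
      using nn_integral_real_affine[of "\<lambda>z. ennreal (indicator {s..} z * (g z * \<phi> z))" 1 s] by simp
    finally show ?thesis .
  qed
  have int: "((\<lambda>z. g z * \<phi> z) has_integral (\<phi> s - \<phi> K)) {s..K}" if "s \<le> K" for s
  proof -
    let ?I = "\<integral>\<^sup>+z. ennreal (indicator {s..K} z * (g z * \<phi> z)) \<partial>lborel"
    have "ennreal (\<phi> s) = (\<integral>\<^sup>+z. ennreal (indicator {s..K} z * (g z * \<phi> z)) + ennreal (indicator {K..} z * (g z * \<phi> z)) \<partial>lborel)"
      unfolding step using AE_lborel_singleton[of K] that
      by (intro nn_integral_cong_AE) (auto split: split_indicator)
    also have "\<dots> = ?I + ennreal (\<phi> K)"
      by (subst nn_integral_add) (auto simp: step)
    finally have *: "ennreal (\<phi> s) = ?I + ennreal (\<phi> K)" .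
    have "ennreal (\<phi> K) \<le> ennreal (\<phi> s)" unfolding * by simp
    then have "\<phi> K \<le> \<phi> s" by (simp add: ennreal_le_iff \<phi>_nonneg)
    moreover have "?I = ennreal (\<phi> s) - ennreal (\<phi> K)"
      unfolding * by simp
    then have "?I = ennreal (\<phi> s - \<phi> K)"
      by (simp add: ennreal_minus \<phi>_nonneg)
    ultimately have "((\<lambda>z. indicator {s..K} z * (g z * \<phi> z)) has_integral (\<phi> s - \<phi> K)) UNIV"
      by (intro nn_integral_has_integral) (auto simp: g_nonneg \<phi>_nonneg)
    moreover have "(\<lambda>z. indicator {s..K} z * (g z * \<phi> z)) = (\<lambda>z. if z \<in> {s..K} then g z * \<phi> z else 0)"
      by (auto split: split_indicator)
    ultimately show ?thesis by (simp only: has_integral_restrict_UNIV)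
  qed
  have cont_g: "isCont g z" if "z \<notin> h ` space m" for z
  proof -
    have "eventually (\<lambda>y. v \<le> y \<longleftrightarrow> v \<le> z) (nhds z)" if v: "v \<in> h ` space m" for v
    proof -
      have "v \<noteq> z" using v \<open>z \<notin> _\<close> by auto
      then consider "v < z" | "z < v" by linarith
      then show ?thesis
      proof cases
        case 1
        have "eventually (\<lambda>y. v < y) (nhds z)" unfolding eventually_nhds
          by (rule exI[of _ "{v<..}"]) (use 1 in auto)
        then show ?thesis by eventually_elim (use 1 in auto)
      next
        case 2
        have "eventually (\<lambda>y. y < v) (nhds z)" unfolding eventually_nhds
          by (rule exI[of _ "{..<v}"]) (use 2 in auto)
        then show ?thesis by eventually_elim (use 2 in auto)
      qed
    qed
    with fin have "eventually (\<lambda>y. \<forall>v\<in>h ` space m. v \<le> y \<longleftrightarrow> v \<le> z) (nhds z)"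
      by (intro eventually_ball_finite) auto
    then have "eventually (\<lambda>y. g y = g z) (nhds z)"
    proof eventually_elim
      case (elim y)
      then have "{a \<in> space m. h a \<le> y} = {a \<in> space m. h a \<le> z}" by auto
      then show ?case by (simp add: g_def)
    qed
    then have "(g \<longlongrightarrow> g z) (nhds z)" by (rule tendsto_eventually)
    then show ?thesis unfolding isCont_def by (rule filterlim_mono) (auto simp: at_within_le_nhds)
  qed
  \<comment> \<open>Integrating the distribution function over \<open>[0, K]\<close> gives \<open>K\<close> minus the mean, by Fubini.\<close>
  have g_int: "(g has_integral (K - (\<integral>a. h a \<partial>m))) {0..K}"
  proof -
    have int_h: "integrable m h"
      by (rule m.integrable_const_bound[of _ K]) (auto simp: K nonneg intro!: AE_I2)
    interpret pair_sigma_finite m "lborel :: real measure" ..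
    have "(\<integral>\<^sup>+z. ennreal (indicator {0..K} z * g z) \<partial>lborel) = (\<integral>\<^sup>+z. \<integral>\<^sup>+a. indicator {0..K} z * indicator {a \<in> space m. h a \<le> z} a \<partial>m \<partial>lborel)"
      by (intro nn_integral_cong) (auto simp: g_def m.emeasure_eq_measure nn_integral_cmult split: split_indicator)
    also have "\<dots> = (\<integral>\<^sup>+z. \<integral>\<^sup>+a. indicator {h a..K} z \<partial>m \<partial>lborel)"
      by (intro nn_integral_cong) (auto simp: intro: order_trans nonneg split: split_indicator)
    also have "\<dots> = (\<integral>\<^sup>+a. \<integral>\<^sup>+z. indicator {h a..K} z \<partial>lborel \<partial>m)"
    proof (rule Fubini')
      have "(\<lambda>p. indicator {p. h (fst p) \<le> snd p \<and> snd p \<le> K} p :: ennreal) \<in> borel_measurable (m \<Otimes>\<^sub>M lborel)"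
        by measurable
      also have "(\<lambda>p. indicator {p. h (fst p) \<le> snd p \<and> snd p \<le> K} p :: ennreal) = (\<lambda>(a, z). indicator {h a..K} z)"
        by (auto split: split_indicator)
      finally show "(\<lambda>(a, z). indicator {h a..K} z :: ennreal) \<in> borel_measurable (m \<Otimes>\<^sub>M lborel)" .
    qed
    also have "\<dots> = (\<integral>\<^sup>+a. ennreal (K - h a) \<partial>m)"
      by (intro nn_integral_cong) (simp add: K)
    also have "\<dots> = ennreal (\<integral>a. K - h a \<partial>m)"
      by (intro nn_integral_eq_integral) (auto simp: int_h K intro!: AE_I2)
    also have "(\<integral>a. K - h a \<partial>m) = K - (\<integral>a. h a \<partial>m)"
      using int_h by (simp add: m.prob_space)
    finally have *: "(\<integral>\<^sup>+z. ennreal (indicator {0..K} z * g z) \<partial>lborel) = ennreal (K - (\<integral>a. h a \<partial>m))" .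
    have "(\<integral>a. h a \<partial>m) \<le> (\<integral>a. K \<partial>m)"
      using int_h K by (intro integral_mono) auto
    then have "(\<integral>a. h a \<partial>m) \<le> K" by (simp add: m.prob_space)
    then have "((\<lambda>z. indicator {0..K} z * g z) has_integral (K - (\<integral>a. h a \<partial>m))) UNIV"
      using * by (intro nn_integral_has_integral) (auto simp: g_nonneg)
    moreover have "(\<lambda>z. indicator {0..K} z * g z) = (\<lambda>z. if z \<in> {0..K} then g z else 0)"
      by (auto split: split_indicator)
    ultimately show ?thesis by (simp only: has_integral_restrict_UNIV)
  qed
  \<comment> \<open>\<open>\<phi>\<close> satisfies \<open>\<phi>' = - g \<phi>\<close>, so multiplying with the integrating factor gives a constant.\<close>
  define \<theta> where "\<theta> s = \<phi> s * exp (integral {0..s} g)" for s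
  have int_0: "(\<lambda>z. g z * \<phi> z) integrable_on {0..K}" and g_intble: "g integrable_on {0..K}"
    using int[of 0] g_int K(1) by (auto intro: has_integral_integrable)
  have \<phi>_eq: "\<phi> s = \<phi> 0 - integral {0..s} (\<lambda>z. g z * \<phi> z)" if "s \<in> {0..K}" for s
  proof -
    have "0 \<le> s" "s \<le> K" using that by auto
    then have "integral {0..s} (\<lambda>z. g z * \<phi> z) + integral {s..K} (\<lambda>z. g z * \<phi> z) = integral {0..K} (\<lambda>z. g z * \<phi> z)"
      by (rule Henstock_Kurzweil_Integration.integral_combine[OF _ _ int_0])
    moreover have "integral {s..K} (\<lambda>z. g z * \<phi> z) = \<phi> s - \<phi> K"
      using int[OF \<open>s \<le> K\<close>] by (rule integral_unique)
    moreover have "integral {0..K} (\<lambda>z. g z * \<phi> z) = \<phi> 0 - \<phi> K"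
      using int[of 0] K(1) by (intro integral_unique) simp
    ultimately show ?thesis by linarith
  qed
  have \<phi>_cont: "continuous_on {0..K} \<phi>"
  proof (rule continuous_on_eq)
    show "continuous_on {0..K} (\<lambda>s. \<phi> 0 - integral {0..s} (\<lambda>z. g z * \<phi> z))"
      by (rule continuous_on_diff[OF continuous_on_const indefinite_integral_continuous_1[OF int_0]])
  qed (rule \<phi>_eq[symmetric])
  have "\<theta> K = \<theta> 0"
  proof (rule has_derivative_zero_unique_strong_interval[of "h ` space m" 0 K \<theta> "\<theta> 0" K])
    show "continuous_on {0..K} \<theta>"
      unfolding \<theta>_def
      by (rule continuous_on_mult[OF \<phi>_cont continuous_on_exp[OF indefinite_integral_continuous_1[OF g_intble]]])
    fix z assume z: "z \<in> {0..K} - h ` space m"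
    then have cg: "continuous (at z within {0..K}) g"
      using cont_g[of z] continuous_at_imp_continuous_at_within by auto
    have c\<phi>: "continuous (at z within {0..K}) \<phi>"
      using \<phi>_cont z by (auto simp: continuous_on_eq_continuous_within)
    have d1: "((\<lambda>u. integral {0..u} (\<lambda>z. g z * \<phi> z)) has_vector_derivative g z * \<phi> z) (at z within {0..K})"
      using integral_has_vector_derivative_continuous_at[of "\<lambda>z. g z * \<phi> z" 0 K z "{}"] int_0 z continuous_mult[OF cg c\<phi>]
      by simp
    have d2: "((\<lambda>u. integral {0..u} g) has_vector_derivative g z) (at z within {0..K})"
      using integral_has_vector_derivative_continuous_at[of g 0 K z "{}"] g_intble z cg by simp
    have d3: "(\<phi> has_real_derivative (- (g z * \<phi> z))) (at z within {0..K})"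
      unfolding has_real_derivative_iff_has_vector_derivative
    proof (rule has_vector_derivative_transform[of z "{0..K}" _ "\<lambda>s. \<phi> 0 - integral {0..s} (\<lambda>z. g z * \<phi> z)"])
      show "((\<lambda>s. \<phi> 0 - integral {0..s} (\<lambda>z. g z * \<phi> z)) has_vector_derivative (- (g z * \<phi> z))) (at z within {0..K})"
        using has_vector_derivative_diff[OF has_vector_derivative_const[of "\<phi> 0"] d1] by simp
    qed (use z \<phi>_eq in blast)+
    have "(\<theta> has_real_derivative 0) (at z within {0..K})"
      unfolding \<theta>_def
      using DERIV_mult[OF d3 DERIV_chain2[OF DERIV_exp d2[folded has_real_derivative_iff_has_vector_derivative]]]
      by (rule DERIV_cong) (simp add: algebra_simps)
    then show "(\<theta> has_derivative (\<lambda>h. 0)) (at z within {0..K})"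
      by (simp add: has_field_derivative_def mult_commute_abs lambda_zero)
  qed (use fin K(1) in auto)
  moreover have "\<theta> 0 = w 0" by (simp add: \<theta>_def \<phi>_def)
  moreover have "w K = 1"
    unfolding w_def using void_prob_eq_1[OF m h K(2) order_refl] by simp
  ultimately have "w 0 = exp (- K) * exp (K - (\<integral>a. h a \<partial>m))"
    using g_int[THEN integral_unique] by (simp add: \<theta>_def \<phi>_def)
  then show ?thesis by (simp add: w exp_add[symmetric])
qed

text \<open>
  The probability that a Poisson process has no point in a region of intensity \<open>x\<close>; it is 0 for an
  infinite intensity.
\<close>
definition exp_neg :: "ennreal \<Rightarrow> ennreal" where
  "exp_neg x = (if x = \<infinity> then 0 else ennreal (exp (- enn2real x)))"

lemma exp_neg_tendsto:
  assumes "f \<longlonglongrightarrow> x" "\<And>n::nat. f n < \<infinity>"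
  shows "(\<lambda>n. exp_neg (f n)) \<longlonglongrightarrow> exp_neg x"
proof (cases "x = \<infinity>")
  case True
  have "(\<lambda>n. ennreal (enn2real (f n))) \<longlonglongrightarrow> \<infinity>"
    using assms True by simp
  then have "filterlim (\<lambda>n. enn2real (f n)) at_top sequentially"
    by (subst (asm) infinity_ennreal_def, subst (asm) ennreal_tendsto_top_eq_at_top)
  then have "(\<lambda>n. exp (- enn2real (f n))) \<longlonglongrightarrow> 0"
    by (intro filterlim_compose[OF exp_at_bot] filterlim_compose[OF filterlim_uminus_at_bot_at_top])
  then have "(\<lambda>n. ennreal (exp (- enn2real (f n)))) \<longlonglongrightarrow> ennreal 0" by (rule tendsto_ennrealI)
  then show ?thesis using assms(2) True by (simp add: exp_neg_def less_top[symmetric])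
next
  case False
  then have "(\<lambda>n. enn2real (f n)) \<longlonglongrightarrow> enn2real x"
    using assms by (intro tendsto_enn2real) (auto simp: less_top)
  then have "(\<lambda>n. ennreal (exp (- enn2real (f n)))) \<longlonglongrightarrow> ennreal (exp (- enn2real x))"
    by (intro tendsto_ennrealI tendsto_exp tendsto_minus)
  then show ?thesis using assms(2) False by (simp add: exp_neg_def less_top[symmetric])
qed

text \<open>
  The condition says that no point \<open>(\<Gamma>\<^sub>j, T\<^sub>j)\<close> lies strictly below the graph of \<open>h\<close>, and the Poisson
  intensity of that region is \<open>\<integral> h dm\<close>. The case of general \<open>h\<close> follows from simple functions
  increasing to \<open>h\<close>, for which the events decrease.
\<close>
lemma poisson_void_probability:
  assumes m: "prob_space m" and [measurable]: "h \<in> borel_measurable m"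
  shows "emeasure (canon m) {c \<in> space (canon m). \<forall>j. h (snd c j) \<le> ennreal (arrival (fst c) j)}
    = exp_neg (\<integral>\<^sup>+a. h a \<partial>m)"
proof -
  interpret m: prob_space m by fact
  interpret C: prob_space "canon m" by (rule prob_space_canon) fact
  obtain f where f: "\<And>i. simple_function m (f i)" "incseq f" "\<And>i x. f i x < top" "\<And>x. (SUP i. f i x) = h x"
    using borel_measurable_implies_simple_function_sequence'[of h m] assms(2) by metis
  have [measurable]: "f i \<in> borel_measurable m" for i using f(1) by (rule borel_measurable_simple_function)
  define V where "V i = {c \<in> space (canon m). \<forall>j. f i (snd c j) \<le> ennreal (arrival (fst c) j)}" for i
  have fin: "(\<integral>\<^sup>+a. f i a \<partial>m) < \<infinity>" for i
  proof -
    let ?B = "Max (insert 0 (f i ` space m))"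
    have fi: "finite (f i ` space m)" using f(1) by (simp add: simple_function_def)
    have "(\<integral>\<^sup>+a. f i a \<partial>m) \<le> (\<integral>\<^sup>+a. ?B \<partial>m)"
      using fi by (intro nn_integral_mono Max_ge) auto
    also have "\<dots> = ?B" by (simp add: m.emeasure_space_1)
    also have "\<dots> < \<infinity>" using fi f(3) by (subst Max_less_iff) auto
    finally show ?thesis .
  qed
  have V: "emeasure (canon m) (V i) = exp_neg (\<integral>\<^sup>+a. f i a \<partial>m)" for i
  proof -
    have fi: "finite (f i ` space m)" using f(1) by (simp add: simple_function_def)
    have "emeasure (canon m) (V i) = void_prob m (\<lambda>a. enn2real (f i a)) 0"
      unfolding void_prob_def V_def
    proof (rule emeasure_eq_AE)
      show "AE c in canon m. (c \<in> {c \<in> space (canon m). \<forall>j. f i (snd c j) \<le> ennreal (arrival (fst c) j)}) =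
         (c \<in> {c \<in> space (canon m). \<forall>j. enn2real (f i (snd c j)) \<le> 0 + arrival (fst c) j})"
        using AE_canon_gaps_pos[OF m]
      proof eventually_elim
        case (elim c)
        have "f i (snd c j) \<le> ennreal (arrival (fst c) j) \<longleftrightarrow> enn2real (f i (snd c j)) \<le> arrival (fst c) j" for j
          using arrival_pos[OF elim, of j] f(3)
          by (cases "f i (snd c j)") (auto simp: ennreal_le_iff top_unique less_top[symmetric])
        then show ?case by simp
      qed
    qed measurable
    also have "\<dots> = ennreal (exp (- (\<integral>a. enn2real (f i a) \<partial>m)))"
      using fi by (intro void_prob_simple m) (auto simp: image_image[of enn2real "f i", symmetric])
    also have "\<dots> = exp_neg (\<integral>\<^sup>+a. f i a \<partial>m)"
    proof -
      have "(\<integral>\<^sup>+a. f i a \<partial>m) < \<infinity>" by (rule fin)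
      moreover have "(\<integral>a. enn2real (f i a) \<partial>m) = enn2real (\<integral>\<^sup>+a. f i a \<partial>m)"
        using f(3) by (subst integral_eq_nn_integral) auto
      ultimately show ?thesis by (simp add: exp_neg_def)
    qed
    finally show ?thesis .
  qed
  have V_sets[measurable]: "V i \<in> sets (canon m)" for i unfolding V_def by measurable
  have "decseq V"
    unfolding V_def using f(2) by (auto simp: decseq_def incseq_def le_fun_def) (meson order_trans)
  then have "(\<lambda>i. emeasure (canon m) (V i)) \<longlonglongrightarrow> emeasure (canon m) (\<Inter>i. V i)"
    by (intro Lim_emeasure_decseq) auto
  moreover have "(\<Inter>i. V i) = {c \<in> space (canon m). \<forall>j. h (snd c j) \<le> ennreal (arrival (fst c) j)}"
    unfolding V_def f(4)[symmetric] by (auto simp: SUP_le_iff)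
  moreover have "(\<lambda>i. exp_neg (\<integral>\<^sup>+a. f i a \<partial>m)) \<longlonglongrightarrow> exp_neg (\<integral>\<^sup>+a. h a \<partial>m)"
  proof (rule exp_neg_tendsto)
    have "(\<integral>\<^sup>+a. h a \<partial>m) = (SUP i. \<integral>\<^sup>+a. f i a \<partial>m)"
      unfolding f(4)[symmetric] by (intro nn_integral_monotone_convergence_SUP f) auto
    moreover have "incseq (\<lambda>i. \<integral>\<^sup>+a. f i a \<partial>m)"
      using f(2) by (auto simp: incseq_def le_fun_def intro!: nn_integral_mono)
    ultimately show "(\<lambda>i. \<integral>\<^sup>+a. f i a \<partial>m) \<longlonglongrightarrow> (\<integral>\<^sup>+a. h a \<partial>m)" by (metis LIMSEQ_SUP)
  qed (rule fin)
  ultimately show ?thesis using LIMSEQ_unique V by simp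
qed

section \<open>Arrival times: local finiteness, moments, canonical law\<close>

lemma borel_cantelli_AE_suminf:
  assumes [measurable]: "\<And>n. A n \<in> sets M" and fin: "(\<Sum>n. emeasure M (A n)) < \<infinity>"
  shows "AE x in M. eventually (\<lambda>n. x \<notin> A n) sequentially"
proof -
  have "emeasure M (A n) \<le> (\<Sum>n. emeasure M (A n))" for n
    using sum_le_suminf[of "\<lambda>n. emeasure M (A n)" "{n}"] by simp
  then have fin': "emeasure M (A n) < \<infinity>" for n using fin by (rule le_less_trans)
  then have "emeasure M (A n) = ennreal (measure M (A n))" for n
    by (intro emeasure_eq_ennreal_measure) (simp add: less_top)
  then have "summable (\<lambda>n. measure M (A n))"
    using fin by (intro summable_suminf_not_top) (auto simp: less_top)
  from borel_cantelli_AE1[OF assms(1) fin' this] show ?thesis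
    by eventually_elim (auto elim: eventually_mono)
qed

lemma gap_distributed:
  "distr (Pi\<^sub>M UNIV (\<lambda>_::nat. exp_law)) borel (\<lambda>x. x i) = exp_law"
proof -
  have "distr (Pi\<^sub>M UNIV (\<lambda>_::nat. exp_law)) borel (\<lambda>x. x i) = distr (Pi\<^sub>M UNIV (\<lambda>_::nat. exp_law)) exp_law (\<lambda>x. x i)"
    by (intro distr_cong) auto
  also have "\<dots> = exp_law"
    by (rule distr_PiM_component[where M="\<lambda>_. exp_law"]) (auto intro: prob_space_exp_law)
  finally show ?thesis .
qed

text \<open>The arrival time is a sum of \<open>j + 1\<close> independent exponential gaps.\<close>
lemma arrival_distributed:
  "distr (Pi\<^sub>M UNIV (\<lambda>_::nat. exp_law)) borel (\<lambda>x. arrival x j) = density lborel (erlang_density j 1)"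
proof -
  let ?G = "Pi\<^sub>M UNIV (\<lambda>_::nat. exp_law)"
  interpret G: prob_space ?G by (intro prob_space_PiM prob_space_exp_law)
  have meas: "(\<lambda>x. x i) \<in> borel_measurable ?G" for i
    by measurable
  have "G.indep_vars (\<lambda>_. borel) (\<lambda>i x. x i) UNIV"
  proof (subst G.indep_vars_iff_distr_eq_PiM')
    have "distr ?G (Pi\<^sub>M UNIV (\<lambda>_. borel)) (\<lambda>x. \<lambda>i\<in>UNIV. x i) = distr ?G ?G (\<lambda>x. x)"
      by (intro distr_cong sets_PiM_cong) auto
    then show "distr ?G (Pi\<^sub>M UNIV (\<lambda>_. borel)) (\<lambda>x. \<lambda>i\<in>UNIV. x i) = Pi\<^sub>M UNIV (\<lambda>i. distr ?G borel (\<lambda>x. x i))"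
      by (simp add: gap_distributed)
  qed (use meas in auto)
  then have ind: "G.indep_vars (\<lambda>_. borel) (\<lambda>i x. x i) {..j}"
    by (rule G.indep_vars_subset) simp
  have "distributed ?G lborel (\<lambda>x. x i) (exponential_density 1)" for i
  proof -
    have "distr ?G lborel (\<lambda>x. x i) = distr ?G borel (\<lambda>x. x i)" by (rule distr_cong) auto
    then show ?thesis
      unfolding distributed_def using meas[of i] gap_distributed[of i] by (simp add: exp_law_def)
  qed
  from G.exponential_distributed_sum[of "{..j}" 1 "\<lambda>i x. x i", OF _ _ _ this ind]
  have "distributed ?G lborel (\<lambda>x. arrival x j) (erlang_density j 1)"
    by (simp add: arrival_def)
  then have "distr ?G lborel (\<lambda>x. arrival x j) = density lborel (erlang_density j 1)"
    by (rule distributed_distr_eq_density)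
  moreover have "distr ?G lborel (\<lambda>x. arrival x j) = distr ?G borel (\<lambda>x. arrival x j)" by (rule distr_cong) auto
  ultimately show ?thesis by simp
qed

text \<open>The renewal density of a standard Poisson process is 1.\<close>
lemma suminf_erlang_density:
  "(\<Sum>j. ennreal (erlang_density j 1 r)) = indicator {0..} r"
proof (cases "0 \<le> r")
  case True
  have "(\<lambda>j. r ^ j /\<^sub>R fact j * exp (- r)) sums (exp r * exp (- r))"
    by (intro sums_mult2 exp_converges)
  then have "(\<lambda>j. erlang_density j 1 r) sums 1"
    using True by (simp add: erlang_density_def exp_minus field_simps)
  then have "(\<Sum>j. ennreal (erlang_density j 1 r)) = ennreal 1"
    by (intro suminf_ennreal_eq) auto
  then show ?thesis using True by simp
qed (simp add: erlang_density_def)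

lemma nn_integral_canon_component:
  assumes m: "prob_space m" and [measurable]: "(\<lambda>(r, a). f r a) \<in> borel_measurable (borel \<Otimes>\<^sub>M m)"
  shows "(\<integral>\<^sup>+c. f (arrival (fst c) j) (snd c j) \<partial>canon m)
    = (\<integral>\<^sup>+r. ennreal (erlang_density j 1 r) * (\<integral>\<^sup>+a. f r a \<partial>m) \<partial>lborel)"
proof -
  let ?G = "Pi\<^sub>M UNIV (\<lambda>_::nat. exp_law)" and ?S = "Pi\<^sub>M UNIV (\<lambda>_::nat. m)"
  interpret m: prob_space m by fact
  interpret S: prob_space ?S by (intro prob_space_PiM m)
  have "(\<integral>\<^sup>+c. f (arrival (fst c) j) (snd c j) \<partial>canon m) = (\<integral>\<^sup>+x. \<integral>\<^sup>+t. f (arrival x j) (t j) \<partial>?S \<partial>?G)"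
    unfolding canon_def by (subst S.nn_integral_fst[symmetric]) auto
  also have "\<dots> = (\<integral>\<^sup>+x. \<integral>\<^sup>+a. f (arrival x j) a \<partial>m \<partial>?G)"
  proof (intro nn_integral_cong)
    fix x
    have "(\<integral>\<^sup>+a. f (arrival x j) a \<partial>m) = (\<integral>\<^sup>+a. f (arrival x j) a \<partial>distr ?S m (\<lambda>t. t j))"
      using distr_PiM_component[of UNIV "\<lambda>_. m" j] m by simp
    also have "\<dots> = (\<integral>\<^sup>+t. f (arrival x j) (t j) \<partial>?S)"
      by (subst nn_integral_distr) auto
    finally show "(\<integral>\<^sup>+t. f (arrival x j) (t j) \<partial>?S) = (\<integral>\<^sup>+a. f (arrival x j) a \<partial>m)" by simp
  qed
  also have "\<dots> = (\<integral>\<^sup>+r. \<integral>\<^sup>+a. f r a \<partial>m \<partial>distr ?G borel (\<lambda>x. arrival x j))"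
    by (subst nn_integral_distr) auto
  also have "\<dots> = (\<integral>\<^sup>+r. ennreal (erlang_density j 1 r) * (\<integral>\<^sup>+a. f r a \<partial>m) \<partial>lborel)"
    unfolding arrival_distributed by (subst nn_integral_density) auto
  finally show ?thesis .
qed

text \<open>
  The expected number of points below the graph of \<open>h\<close> is \<open>\<integral> h dm\<close>, because the densities of the
  arrival times add up to 1.
\<close>
lemma AE_finitely_many_points:
  assumes m: "prob_space m" and [measurable]: "h \<in> borel_measurable m"
    and fin: "(\<integral>\<^sup>+a. h a \<partial>m) < \<infinity>"
  shows "AE c in canon m. finite {j. ennreal (arrival (fst c) j) < h (snd c j)}"
proof -
  interpret m: prob_space m by fact
  interpret pair_sigma_finite m "lborel :: real measure" ..
  define A where "A j = {c \<in> space (canon m). ennreal (arrival (fst c) j) < h (snd c j)}" for j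
  define f where "f r a = (indicator {a. ennreal r < h a} a :: ennreal)" for r a
  have A[measurable]: "A j \<in> sets (canon m)" for j unfolding A_def by measurable
  have f[measurable]: "(\<lambda>(r, a). f r a) \<in> borel_measurable (borel \<Otimes>\<^sub>M m)"
  proof -
    have "(\<lambda>p. indicator {p. ennreal (fst p) < h (snd p)} p :: ennreal) \<in> borel_measurable (borel \<Otimes>\<^sub>M m)"
      by measurable
    also have "(\<lambda>p. indicator {p. ennreal (fst p) < h (snd p)} p :: ennreal) = (\<lambda>(r, a). f r a)"
      by (auto simp: f_def split: split_indicator)
    finally show ?thesis .
  qed
  have "emeasure (canon m) (A j) = (\<integral>\<^sup>+r. ennreal (erlang_density j 1 r) * (\<integral>\<^sup>+a. f r a \<partial>m) \<partial>lborel)" for j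
  proof -
    have "emeasure (canon m) (A j) = (\<integral>\<^sup>+c. indicator (A j) c \<partial>canon m)" by simp
    also have "\<dots> = (\<integral>\<^sup>+c. f (arrival (fst c) j) (snd c j) \<partial>canon m)"
      by (intro nn_integral_cong) (auto simp: A_def f_def split: split_indicator)
    finally show ?thesis by (simp add: nn_integral_canon_component[OF m f])
  qed
  then have "(\<Sum>j. emeasure (canon m) (A j)) = (\<integral>\<^sup>+r. (\<Sum>j. ennreal (erlang_density j 1 r) * (\<integral>\<^sup>+a. f r a \<partial>m)) \<partial>lborel)"
    by (subst nn_integral_suminf) auto
  also have "\<dots> = (\<integral>\<^sup>+r. \<integral>\<^sup>+a. indicator {0..} r * f r a \<partial>m \<partial>lborel)"
    by (intro nn_integral_cong) (simp add: suminf_erlang_density nn_integral_cmult)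
  also have "\<dots> = (\<integral>\<^sup>+a. \<integral>\<^sup>+r. indicator {0..} r * f r a \<partial>lborel \<partial>m)"
    by (intro Fubini') measurable
  also have "\<dots> \<le> (\<integral>\<^sup>+a. h a \<partial>m)"
  proof (intro nn_integral_mono)
    fix a
    show "(\<integral>\<^sup>+r. indicator {0..} r * f r a \<partial>lborel) \<le> h a"
    proof (cases "h a")
      case (real b)
      have "(\<integral>\<^sup>+r. indicator {0..} r * f r a \<partial>lborel) \<le> (\<integral>\<^sup>+r. indicator {0..b} r \<partial>lborel)"
        using real by (intro nn_integral_mono) (auto simp: f_def ennreal_less_iff split: split_indicator)
      also have "\<dots> = h a" using real by simp
      finally show ?thesis .
    qed simp
  qed
  finally have "(\<Sum>j. emeasure (canon m) (A j)) < \<infinity>" using fin by (rule le_less_trans)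
  from borel_cantelli_AE_suminf[OF A this] AE_space[of "canon m"] show ?thesis
  proof eventually_elim
    case (elim c)
    from elim(1) obtain N where N: "\<And>n. n \<ge> N \<Longrightarrow> c \<notin> A n" unfolding eventually_sequentially by auto
    have "{j. ennreal (arrival (fst c) j) < h (snd c j)} \<subseteq> {..<N}"
      using N elim(2) by (force simp: A_def not_less[symmetric])
    then show ?case by (rule finite_subset) simp
  qed
qed

lemma nn_integral_prod_gaps:
  fixes f :: "real \<Rightarrow> ennreal"
  assumes [measurable]: "f \<in> borel_measurable borel"
  shows "(\<integral>\<^sup>+x. (\<Prod>r<k. f (x r)) \<partial>Pi\<^sub>M UNIV (\<lambda>_::nat. exp_law)) = (\<integral>\<^sup>+y. f y \<partial>exp_law) ^ k"
proof (induction k)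
  case 0
  interpret G: prob_space "Pi\<^sub>M UNIV (\<lambda>_::nat. exp_law)" by (intro prob_space_PiM prob_space_exp_law)
  show ?case by (simp add: G.emeasure_space_1)
next
  case (Suc k)
  have "(\<integral>\<^sup>+x. (\<Prod>r<Suc k. f (x r)) \<partial>Pi\<^sub>M UNIV (\<lambda>_::nat. exp_law)) =
    (\<integral>\<^sup>+y. \<integral>\<^sup>+x. f y * (\<Prod>r<k. f (x r)) \<partial>Pi\<^sub>M UNIV (\<lambda>_::nat. exp_law) \<partial>exp_law)"
    by (subst nn_integral_PiM_iter[OF prob_space_exp_law])
       (auto simp: prod.lessThan_Suc_shift simp del: prod.lessThan_Suc)
  also have "\<dots> = (\<integral>\<^sup>+y. f y \<partial>exp_law) ^ Suc k"
    by (simp add: nn_integral_cmult nn_integral_multc Suc)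
  finally show ?case .
qed

text \<open>The moment is \<open>Gamma (1 - p)\<close>.\<close>
lemma exp_law_negative_moment:
  assumes "0 < p" "p < 1"
  shows "(\<integral>\<^sup>+y. ennreal (y powr (- p)) \<partial>exp_law) < \<infinity>"
proof -
  have "((\<lambda>t. t powr (1 - p - 1) / exp t) has_integral Gamma (1 - p)) {0..}"
    using assms by (intro Gamma_integral_real) simp
  then have "((\<lambda>t. if t \<in> {0..} then t powr (- p) / exp t else 0) has_integral Gamma (1 - p)) UNIV"
    by (subst has_integral_restrict_UNIV) simp
  then have "(\<integral>\<^sup>+t. ennreal (if t \<in> {0..} then t powr (- p) / exp t else 0) \<partial>lborel) = ennreal (Gamma (1 - p))"
    by (intro nn_integral_has_integral_lborel) auto
  moreover have "(\<integral>\<^sup>+y. ennreal (y powr (- p)) \<partial>exp_law) = (\<integral>\<^sup>+t. ennreal (if t \<in> {0..} then t powr (- p) / exp t else 0) \<partial>lborel)"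
    unfolding exp_law_def
    by (subst nn_integral_density)
       (auto intro!: nn_integral_cong simp: erlang_density_def ennreal_mult'[symmetric] exp_minus field_simps)
  ultimately show ?thesis by simp
qed

definition gap :: "(nat \<Rightarrow> 'v \<Rightarrow> real) \<Rightarrow> nat \<Rightarrow> 'v \<Rightarrow> real" where
  "gap \<Gamma> i \<omega> = (case i of 0 \<Rightarrow> \<Gamma> 0 \<omega> | Suc i' \<Rightarrow> \<Gamma> (Suc i') \<omega> - \<Gamma> i' \<omega>)"

lemma arrival_gap: "arrival (\<lambda>i. gap \<Gamma> i \<omega>) j = \<Gamma> j \<omega>"
  unfolding arrival_def by (induction j) (auto simp: gap_def)

text \<open>
  LePage data on an arbitrary space have the law of the canonical model, so the distribution of any
  expression in \<open>\<Gamma>\<close> and \<open>T\<close> can be computed there.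
\<close>
lemma LePage_data_canonical:
  assumes "LePage_data Q \<mu> m \<psi> \<Gamma> T"
  shows "(\<lambda>\<omega>. (\<lambda>i. gap \<Gamma> i \<omega>, \<lambda>i. T i \<omega>)) \<in> Q \<rightarrow>\<^sub>M canon m" (is "?f \<in> _")
    and "distr Q (canon m) (\<lambda>\<omega>. (\<lambda>i. gap \<Gamma> i \<omega>, \<lambda>i. T i \<omega>)) = canon m"
proof -
  let ?G = "Pi\<^sub>M UNIV (\<lambda>_::nat. exp_law)" and ?S = "Pi\<^sub>M UNIV (\<lambda>_::nat. m)"
  from assms have m: "prob_space m" and Q: "prob_space Q"
    and P: "Poisson_arrivals Q \<Gamma>" and T: "prob_space.indep_vars Q (\<lambda>_. m) T UNIV" "\<And>i. distr Q m (T i) = m"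
    and ind: "prob_space.indep_set Q
       {(\<lambda>\<omega> i. \<Gamma> i \<omega>) -` S \<inter> space Q | S. S \<in> sets (Pi\<^sub>M UNIV (\<lambda>_. borel))}
       {(\<lambda>\<omega> i. T i \<omega>) -` S \<inter> space Q | S. S \<in> sets (Pi\<^sub>M UNIV (\<lambda>_. m))}"
    by (auto simp: LePage_data_def)
  interpret Q: prob_space Q by fact
  interpret m: prob_space m by fact
  have gap_eq: "(\<lambda>i \<omega>. case i of 0 \<Rightarrow> \<Gamma> 0 \<omega> | Suc i' \<Rightarrow> \<Gamma> (Suc i') \<omega> - \<Gamma> i' \<omega>) = gap \<Gamma>"
    by (simp add: gap_def fun_eq_iff)
  have G: "Q.indep_vars (\<lambda>_. borel) (gap \<Gamma>) UNIV" "\<And>i. distributed Q lborel (gap \<Gamma> i) (exponential_density 1)"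
    using P unfolding Poisson_arrivals_def Let_def gap_eq by auto
  have gm[measurable]: "gap \<Gamma> i \<in> borel_measurable Q" for i
    using G(1) by (auto simp: Q.indep_vars_def)
  have Tm[measurable]: "T i \<in> Q \<rightarrow>\<^sub>M m" for i
    using T(1) by (auto simp: Q.indep_vars_def)
  have fG[measurable]: "(\<lambda>\<omega> i. gap \<Gamma> i \<omega>) \<in> Q \<rightarrow>\<^sub>M ?G"
    by (intro measurable_PiM_single') (auto simp: space_PiM)
  have fT[measurable]: "(\<lambda>\<omega> i. T i \<omega>) \<in> Q \<rightarrow>\<^sub>M ?S"
    by (intro measurable_PiM_single') (auto simp: space_PiM PiE_iff dest: measurable_space[OF Tm])
  show f: "?f \<in> Q \<rightarrow>\<^sub>M canon m"
    unfolding canon_def by measurable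
  have dG: "distr Q ?G (\<lambda>\<omega> i. gap \<Gamma> i \<omega>) = ?G"
  proof -
    have "distr Q borel (gap \<Gamma> i) = exp_law" for i
      using distributed_distr_eq_density[OF G(2), of i]
      by (simp add: exp_law_def cong: distr_cong)
    moreover have "distr Q (Pi\<^sub>M UNIV (\<lambda>_. borel)) (\<lambda>x. \<lambda>i\<in>UNIV. gap \<Gamma> i x) = Pi\<^sub>M UNIV (\<lambda>i. distr Q borel (gap \<Gamma> i))"
      using G(1) by (subst (asm) Q.indep_vars_iff_distr_eq_PiM') auto
    moreover have "distr Q (Pi\<^sub>M UNIV (\<lambda>_. borel)) (\<lambda>x. \<lambda>i\<in>UNIV. gap \<Gamma> i x) = distr Q ?G (\<lambda>\<omega> i. gap \<Gamma> i \<omega>)"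
      by (intro distr_cong sets_PiM_cong) auto
    ultimately show ?thesis by simp
  qed
  have dT: "distr Q ?S (\<lambda>\<omega> i. T i \<omega>) = ?S"
  proof -
    have "distr Q ?S (\<lambda>x. \<lambda>i\<in>UNIV. T i x) = Pi\<^sub>M UNIV (\<lambda>i. distr Q m (T i))"
      using T(1) by (subst (asm) Q.indep_vars_iff_distr_eq_PiM') auto
    then show ?thesis by (simp add: T(2) restrict_def)
  qed
  interpret G': prob_space ?G by (intro prob_space_PiM prob_space_exp_law)
  interpret S': prob_space ?S by (intro prob_space_PiM m)
  have "?G \<Otimes>\<^sub>M ?S = distr Q (canon m) ?f"
  proof (rule pair_measure_eqI)
    show "sets (?G \<Otimes>\<^sub>M ?S) = sets (distr Q (canon m) ?f)" by (simp add: canon_def)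
    fix A B assume A[measurable]: "A \<in> sets ?G" and B[measurable]: "B \<in> sets ?S"
    \<comment> \<open>Independence is given for the arrival times; \<open>d\<close> expresses the gaps through them.\<close>
    define d where "d = (\<lambda>(g :: nat \<Rightarrow> real) i. case i of 0 \<Rightarrow> g 0 | Suc i' \<Rightarrow> g (Suc i') - g i')"
    have d: "d \<in> Pi\<^sub>M UNIV (\<lambda>_. borel) \<rightarrow>\<^sub>M ?G"
    proof (rule measurable_PiM_single')
      show "(\<lambda>g. d g i) \<in> Pi\<^sub>M UNIV (\<lambda>_. borel) \<rightarrow>\<^sub>M exp_law" for i
        unfolding d_def by (cases i) auto
    qed (auto simp: space_PiM)
    have eA: "(\<lambda>\<omega> i. gap \<Gamma> i \<omega>) -` A \<inter> space Q = (\<lambda>\<omega> i. \<Gamma> i \<omega>) -` (d -` A \<inter> space (Pi\<^sub>M UNIV (\<lambda>_. borel))) \<inter> space Q"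
      by (auto simp: d_def gap_def space_PiM)
    have "Q.prob (((\<lambda>\<omega> i. gap \<Gamma> i \<omega>) -` A \<inter> space Q) \<inter> ((\<lambda>\<omega> i. T i \<omega>) -` B \<inter> space Q)) =
        Q.prob ((\<lambda>\<omega> i. gap \<Gamma> i \<omega>) -` A \<inter> space Q) * Q.prob ((\<lambda>\<omega> i. T i \<omega>) -` B \<inter> space Q)"
      using measurable_sets[OF d A] B unfolding eA by (intro Q.indep_setD[OF ind]) blast+
    then have "emeasure Q (((\<lambda>\<omega> i. gap \<Gamma> i \<omega>) -` A \<inter> space Q) \<inter> ((\<lambda>\<omega> i. T i \<omega>) -` B \<inter> space Q)) =
        emeasure Q ((\<lambda>\<omega> i. gap \<Gamma> i \<omega>) -` A \<inter> space Q) * emeasure Q ((\<lambda>\<omega> i. T i \<omega>) -` B \<inter> space Q)"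
      by (simp add: Q.emeasure_eq_measure ennreal_mult')
    also have "emeasure Q ((\<lambda>\<omega> i. gap \<Gamma> i \<omega>) -` A \<inter> space Q) = emeasure ?G A"
      by (subst dG[symmetric], subst emeasure_distr[OF fG A]) simp
    also have "emeasure Q ((\<lambda>\<omega> i. T i \<omega>) -` B \<inter> space Q) = emeasure ?S B"
      by (subst dT[symmetric], subst emeasure_distr[OF fT B]) simp
    also have "emeasure Q (((\<lambda>\<omega> i. gap \<Gamma> i \<omega>) -` A \<inter> space Q) \<inter> ((\<lambda>\<omega> i. T i \<omega>) -` B \<inter> space Q)) = emeasure (distr Q (canon m) ?f) (A \<times> B)"
      using A B by (subst emeasure_distr[OF f]) (auto simp: canon_def intro!: arg_cong[where f="emeasure Q"])
    finally show "emeasure ?G A * emeasure ?S B = emeasure (distr Q (canon m) ?f) (A \<times> B)" by simp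
  qed (unfold_locales)
  then show "distr Q (canon m) ?f = canon m" by (simp add: canon_def)
qed

section \<open>Independently scattered Frechet families and their law\<close>

text \<open>
  The properties of a random sup measure that determine its law. Independence and the marginal laws
  are condensed into the joint distribution function on disjoint sets, the form in which the void
  probabilities deliver them.
\<close>
definition frechet_family ::
  "'w measure \<Rightarrow> real \<Rightarrow> 'a measure \<Rightarrow> ('a set \<Rightarrow> 'w \<Rightarrow> ennreal) \<Rightarrow> bool" where
  "frechet_family P \<alpha> \<mu> N \<longleftrightarrow>
     prob_space P \<and>
     (\<forall>A \<in> sets \<mu>. N A \<in> borel_measurable P) \<and>
     (\<forall>A :: nat \<Rightarrow> 'a set. (\<forall>j. A j \<in> sets \<mu>) \<longrightarrow>
        (AE \<omega> in P. N (\<Union>j. A j) \<omega> = (SUP j. N (A j) \<omega>))) \<and>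
     (\<forall>(n::nat) A x. (\<forall>i<n. A i \<in> sets \<mu>) \<longrightarrow> disjoint_family_on A {..<n} \<longrightarrow> (\<forall>i<n. 0 < x i) \<longrightarrow>
        emeasure P {\<omega> \<in> space P. \<forall>i<n. N (A i) \<omega> \<le> ennreal (x i)} =
        (\<Prod>i<n. exp_neg (emeasure \<mu> (A i) * ennreal (x i powr (- \<alpha>)))))"

lemma Frechet_sup_measure_family:
  assumes "Frechet_sup_measure P \<alpha> \<mu> M"
  shows "frechet_family P \<alpha> \<mu> M"
proof -
  interpret prob_space P using assms by (simp add: Frechet_sup_measure_def)
  have meas: "\<And>A. A \<in> sets \<mu> \<Longrightarrow> M A \<in> borel_measurable P"
    and indep: "\<And>(n::nat) A. (\<forall>i<n. A i \<in> sets \<mu>) \<Longrightarrow> disjoint_family_on A {..<n} \<Longrightarrow> indep_vars (\<lambda>_. borel) (\<lambda>i. M (A i)) {..<n}"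
    and cdf: "\<And>A x. A \<in> sets \<mu> \<Longrightarrow> 0 < x \<Longrightarrow> prob {\<omega> \<in> space P. M A \<omega> \<le> ennreal x} =
        (if emeasure \<mu> A = \<infinity> then 0 else exp (- (measure \<mu> A * x powr (- \<alpha>))))"
    using assms by (auto simp: Frechet_sup_measure_def)
  have cdf': "ennreal (prob (M A -` {..ennreal x} \<inter> space P)) = exp_neg (emeasure \<mu> A * ennreal (x powr (- \<alpha>)))"
    if "A \<in> sets \<mu>" "0 < x" for A x
  proof -
    have "M A -` {..ennreal x} \<inter> space P = {\<omega> \<in> space P. M A \<omega> \<le> ennreal x}" by auto
    moreover have "emeasure \<mu> A * ennreal (x powr (- \<alpha>)) = (if emeasure \<mu> A = \<infinity> then \<infinity> else ennreal (measure \<mu> A * x powr (- \<alpha>)))"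
      using that by (auto simp: emeasure_eq_ennreal_measure ennreal_mult' ennreal_top_mult)
    ultimately show ?thesis using cdf[OF that] by (auto simp: exp_neg_def)
  qed
  have "emeasure P {\<omega> \<in> space P. \<forall>i<n. M (A i) \<omega> \<le> ennreal (x i)} =
        (\<Prod>i<n. exp_neg (emeasure \<mu> (A i) * ennreal (x i powr (- \<alpha>))))"
    if A: "\<forall>i<n. A i \<in> sets \<mu>" "disjoint_family_on A {..<n}" "\<forall>i<n. 0 < x i" for n :: nat and A x
  proof (cases "n = 0")
    case False
    have "{\<omega> \<in> space P. \<forall>i<n. M (A i) \<omega> \<le> ennreal (x i)} = (\<Inter>i\<in>{..<n}. M (A i) -` {..ennreal (x i)} \<inter> space P)"
      using False by auto
    then have "emeasure P {\<omega> \<in> space P. \<forall>i<n. M (A i) \<omega> \<le> ennreal (x i)} = ennreal (prob (\<Inter>i\<in>{..<n}. M (A i) -` {..ennreal (x i)} \<inter> space P))"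
      by (simp add: emeasure_eq_measure)
    also have "prob (\<Inter>i\<in>{..<n}. M (A i) -` {..ennreal (x i)} \<inter> space P) = (\<Prod>i<n. prob (M (A i) -` {..ennreal (x i)} \<inter> space P))"
      using indep[OF A(1,2)] False by (intro indep_varsD) auto
    also have "ennreal \<dots> = (\<Prod>i<n. exp_neg (emeasure \<mu> (A i) * ennreal (x i powr (- \<alpha>))))"
      using A by (subst prod_ennreal[symmetric]) (auto intro!: prod.cong cdf')
    finally show ?thesis .
  qed (simp add: emeasure_space_1)
  then show ?thesis
    using assms by (auto simp: frechet_family_def Frechet_sup_measure_def)
qed

context
  fixes P :: "'w measure" and \<alpha> :: real and \<mu> :: "'a measure" and N
  assumes N: "frechet_family P \<alpha> \<mu> N"
begin

lemma frechet_family_measurable: "A \<in> sets \<mu> \<Longrightarrow> N A \<in> borel_measurable P"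
  and frechet_family_prob_space: "prob_space P"
  and frechet_family_Union: "(\<And>j::nat. B j \<in> sets \<mu>) \<Longrightarrow> AE \<omega> in P. N (\<Union>j. B j) \<omega> = (SUP j. N (B j) \<omega>)"
  using N by (auto simp: frechet_family_def)

lemma frechet_family_mono:
  assumes "A \<in> sets \<mu>" "B \<in> sets \<mu>" "A \<subseteq> B"
  shows "AE \<omega> in P. N A \<omega> \<le> N B \<omega>"
proof -
  define C where "C j = (if j = 0 then A else B)" for j :: nat
  have "(\<Union>j. C j) = B" using assms(3) by (auto simp: C_def split: if_splits)
  moreover have "AE \<omega> in P. N (\<Union>j. C j) \<omega> = (SUP j. N (C j) \<omega>)"
    using assms by (intro frechet_family_Union) (simp add: C_def)
  ultimately have "AE \<omega> in P. N B \<omega> = (SUP j. N (C j) \<omega>)" by simp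
  then show ?thesis
  proof eventually_elim
    case (elim \<omega>)
    have "N (C 0) \<omega> \<le> (SUP j. N (C j) \<omega>)" by (rule SUP_upper) simp
    then show ?case using elim by (simp add: C_def)
  qed
qed

lemma frechet_family_finite_cover:
  fixes L :: "nat set"
  assumes A: "A \<in> sets \<mu>" and D: "\<And>l. l \<in> L \<Longrightarrow> D l \<in> sets \<mu>" and i: "i \<in> L"
    and sub: "A \<subseteq> (\<Union>l\<in>L. D l)"
  shows "AE \<omega> in P. N A \<omega> \<le> (SUP l\<in>L. N (D l) \<omega>)"
proof -
  define C where "C j = A \<inter> D (if j \<in> L then j else i)" for j
  have C: "C j \<in> sets \<mu>" for j using A D i by (auto simp: C_def)
  have "A \<subseteq> (\<Union>j. C j)"
  proof
    fix t assume "t \<in> A"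
    moreover obtain l where "l \<in> L" "t \<in> D l" using sub \<open>t \<in> A\<close> by blast
    ultimately have "t \<in> C l" by (simp add: C_def)
    then show "t \<in> (\<Union>j. C j)" by blast
  qed
  then have "(\<Union>j. C j) = A" by (auto simp: C_def)
  then have "AE \<omega> in P. N A \<omega> = (SUP j. N (C j) \<omega>)"
    using frechet_family_Union[of C, OF C] by simp
  moreover have "AE \<omega> in P. \<forall>j. N (C j) \<omega> \<le> N (D (if j \<in> L then j else i)) \<omega>"
    unfolding AE_all_countable
  proof
    fix j show "AE \<omega> in P. N (C j) \<omega> \<le> N (D (if j \<in> L then j else i)) \<omega>"
      by (rule frechet_family_mono[OF C]) (use D i in \<open>auto simp: C_def\<close>)
  qed
  ultimately show ?thesis
  proof eventually_elim
    case (elim \<omega>)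
    have "N (C j) \<omega> \<le> (SUP l\<in>L. N (D l) \<omega>)" for j
    proof -
      have "N (C j) \<omega> \<le> N (D (if j \<in> L then j else i)) \<omega>" using elim(2) by blast
      also have "\<dots> \<le> (SUP l\<in>L. N (D l) \<omega>)" using i by (intro SUP_upper) auto
      finally show ?thesis .
    qed
    then show ?case unfolding elim(1) by (intro SUP_least)
  qed
qed

text \<open>
  For overlapping sets, let \<open>D i\<close> consist of the points of \<open>A i\<close> that lie in no \<open>A l\<close> with a smaller
  bound, where ties between bounds are broken by the index. The \<open>D i\<close> are disjoint, and the bounds for
  the \<open>A i\<close> are equivalent to the same bounds for the \<open>D i\<close>: every point of \<open>A i\<close> lies in some \<open>D l\<close> whose
  bound is at most that of \<open>A i\<close>.
\<close>
lemma frechet_family_joint_cdf: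
  fixes A :: "nat \<Rightarrow> 'a set" and x :: "nat \<Rightarrow> real"
  assumes A: "\<forall>i<n. A i \<in> sets \<mu>" and x: "\<forall>i<n. 0 < x i"
  defines "D \<equiv> \<lambda>i. A i - (\<Union>l\<in>{l. l < n \<and> \<not> (x i < x l \<or> x i = x l \<and> i \<le> l)}. A l)"
  shows "emeasure P {\<omega> \<in> space P. \<forall>i<n. N (A i) \<omega> \<le> ennreal (x i)} =
        (\<Prod>i<n. exp_neg (emeasure \<mu> (D i) * ennreal (x i powr (- \<alpha>))))"
proof -
  have D: "D i \<in> sets \<mu>" if "i < n" for i
    unfolding D_def using A that by (intro sets.Diff sets.finite_UN) auto
  have disj: "disjoint_family_on D {..<n}"
    unfolding disjoint_family_on_def
  proof (intro ballI impI)
    fix i k assume ik: "i \<in> {..<n}" "k \<in> {..<n}" "i \<noteq> k"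
    { fix t assume t: "t \<in> D i" "t \<in> D k"
      then have "x i < x k \<or> x i = x k \<and> i \<le> k" using ik unfolding D_def by blast
      moreover have "x k < x i \<or> x k = x i \<and> k \<le> i" using t ik unfolding D_def by blast
      ultimately have False using ik(3) by auto }
    then show "D i \<inter> D k = {}" by blast
  qed
  have cover: "A i \<subseteq> (\<Union>l\<in>{l. l < n \<and> x l \<le> x i}. D l)" if "i < n" for i
  proof
    fix t assume t: "t \<in> A i"
    define S where "S = {l. l < n \<and> t \<in> A l}"
    have S: "finite S" "i \<in> S" using that t by (auto simp: S_def)
    \<comment> \<open>The point \<open>t\<close> lies in \<open>D l\<close> for the index \<open>l\<close> with \<open>t \<in> A l\<close> at which the pair \<open>(x l, l)\<close> is
      lexicographically least.\<close>
    define v where "v = Min (x ` S)"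
    have "v \<in> x ` S" unfolding v_def using S by (intro Min_in) auto
    then have ne: "{l \<in> S. x l = v} \<noteq> {}" by auto
    define l where "l = Min {l \<in> S. x l = v}"
    have l: "l \<in> {l \<in> S. x l = v}" unfolding l_def using S ne by (intro Min_in) auto
    have min_v: "v \<le> x k" if "k \<in> S" for k unfolding v_def using S that by (intro Min_le) auto
    have min_l: "l \<le> k" if "k \<in> S" "x k = v" for k unfolding l_def using S that by (intro Min_le) auto
    have "t \<in> D l"
      unfolding D_def
    proof (intro DiffI notI)
      show "t \<in> A l" using l by (simp add: S_def)
      assume "t \<in> \<Union> (A ` {k. k < n \<and> \<not> (x l < x k \<or> x l = x k \<and> l \<le> k)})"
      then obtain k where k: "k \<in> S" "\<not> (x l < x k \<or> x l = x k \<and> l \<le> k)" by (auto simp: S_def)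
      have "v \<le> x k" "x l = v" using min_v k l by auto
      then show False using min_l[OF k(1)] k(2) by auto
    qed
    moreover have "l < n" "x l \<le> x i" using l min_v[OF S(2)] by (auto simp: S_def)
    ultimately show "t \<in> (\<Union>l\<in>{l. l < n \<and> x l \<le> x i}. D l)" by auto
  qed
  note frechet_family_measurable[measurable]
  have "AE \<omega> in P. \<forall>i\<in>{..<n}. N (A i) \<omega> \<le> (SUP l\<in>{l. l < n \<and> x l \<le> x i}. N (D l) \<omega>)"
  proof (rule AE_finite_allI)
    fix i assume i: "i \<in> {..<n}"
    show "AE \<omega> in P. N (A i) \<omega> \<le> (SUP l\<in>{l. l < n \<and> x l \<le> x i}. N (D l) \<omega>)"
      by (rule frechet_family_finite_cover[where i=i]) (use i A D cover[of i] in simp_all)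
  qed simp
  moreover have "AE \<omega> in P. \<forall>i\<in>{..<n}. N (D i) \<omega> \<le> N (A i) \<omega>"
  proof (rule AE_finite_allI)
    fix i assume i: "i \<in> {..<n}"
    have "D i \<subseteq> A i" unfolding D_def by blast
    then show "AE \<omega> in P. N (D i) \<omega> \<le> N (A i) \<omega>"
      by (intro frechet_family_mono) (use i A D[of i] in simp_all)
  qed simp
  ultimately have iff: "AE \<omega> in P. (\<forall>i<n. N (A i) \<omega> \<le> ennreal (x i)) \<longleftrightarrow> (\<forall>i<n. N (D i) \<omega> \<le> ennreal (x i))"
  proof eventually_elim
    case (elim \<omega>)
    show ?case
    proof
      assume "\<forall>i<n. N (A i) \<omega> \<le> ennreal (x i)"
      then show "\<forall>i<n. N (D i) \<omega> \<le> ennreal (x i)" 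
      proof (intro allI impI)
        fix i assume "i < n"
        then have "N (D i) \<omega> \<le> N (A i) \<omega>" "N (A i) \<omega> \<le> ennreal (x i)"
          using bspec[OF elim(2), of i] \<open>\<forall>i<n. N (A i) \<omega> \<le> ennreal (x i)\<close> by simp_all
        then show "N (D i) \<omega> \<le> ennreal (x i)" by (rule order_trans)
      qed
    next
      assume *: "\<forall>i<n. N (D i) \<omega> \<le> ennreal (x i)"
      show "\<forall>i<n. N (A i) \<omega> \<le> ennreal (x i)"
      proof (intro allI impI)
        fix i assume "i < n"
        then have "N (A i) \<omega> \<le> (SUP l\<in>{l. l < n \<and> x l \<le> x i}. N (D l) \<omega>)" using bspec[OF elim(1), of i] by simp
        also have "\<dots> \<le> ennreal (x i)"
          using * by (intro SUP_least) (auto intro: order_trans ennreal_leI)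
        finally show "N (A i) \<omega> \<le> ennreal (x i)" .
      qed
    qed
  qed
  have "emeasure P {\<omega> \<in> space P. \<forall>i<n. N (A i) \<omega> \<le> ennreal (x i)} =
      emeasure P {\<omega> \<in> space P. \<forall>i<n. N (D i) \<omega> \<le> ennreal (x i)}"
  proof (intro emeasure_eq_AE)
    have meas: "{\<omega> \<in> space P. \<forall>i<n. N (B i) \<omega> \<le> ennreal (x i)} \<in> sets P" if "\<And>i. i < n \<Longrightarrow> B i \<in> sets \<mu>" for B
    proof -
      have "{\<omega> \<in> space P. \<forall>i\<in>{..<n}. N (B i) \<omega> \<le> ennreal (x i)} \<in> sets P"
        using that by (intro sets.sets_Collect_finite_All) auto
      also have "{\<omega> \<in> space P. \<forall>i\<in>{..<n}. N (B i) \<omega> \<le> ennreal (x i)} = {\<omega> \<in> space P. \<forall>i<n. N (B i) \<omega> \<le> ennreal (x i)}"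
        by auto
      finally show ?thesis .
    qed
    show "{\<omega> \<in> space P. \<forall>i<n. N (A i) \<omega> \<le> ennreal (x i)} \<in> sets P"
       "{\<omega> \<in> space P. \<forall>i<n. N (D i) \<omega> \<le> ennreal (x i)} \<in> sets P"
      by (rule meas, use A in blast, rule meas, rule D)
    show "AE \<omega> in P. (\<omega> \<in> {\<omega> \<in> space P. \<forall>i<n. N (A i) \<omega> \<le> ennreal (x i)}) =
        (\<omega> \<in> {\<omega> \<in> space P. \<forall>i<n. N (D i) \<omega> \<le> ennreal (x i)})"
      using iff by eventually_elim blast
  qed
  also have "\<dots> = (\<Prod>i<n. exp_neg (emeasure \<mu> (D i) * ennreal (x i powr (- \<alpha>))))"
    using N[unfolded frechet_family_def, THEN conjunct2, THEN conjunct2, THEN conjunct2, rule_format, of n D x]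
      D disj x by blast
  finally show ?thesis .
qed

lemma frechet_family_process_measurable:
  "(\<lambda>\<omega>. \<lambda>A\<in>sets \<mu>. N A \<omega>) \<in> P \<rightarrow>\<^sub>M Pi\<^sub>M (sets \<mu>) (\<lambda>_. borel)"
  by (intro measurable_restrict frechet_family_measurable)

end

text \<open>
  The joint distribution functions with positive finite bounds determine the law, because the
  corresponding cylinders are stable under intersection and generate the product \<open>\<sigma>\<close>-algebra.
\<close>
theorem frechet_family_unique:
  assumes N: "frechet_family P \<alpha> \<mu> N" and N': "frechet_family P' \<alpha> \<mu> N'"
  shows "distr P (Pi\<^sub>M (sets \<mu>) (\<lambda>_. borel)) (\<lambda>\<omega>. \<lambda>A\<in>sets \<mu>. N A \<omega>) =
         distr P' (Pi\<^sub>M (sets \<mu>) (\<lambda>_. borel)) (\<lambda>\<omega>. \<lambda>A\<in>sets \<mu>. N' A \<omega>)"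
    (is "?D = ?D'")
proof -
  let ?M = "Pi\<^sub>M (sets \<mu>) (\<lambda>_. borel :: ennreal measure)"
  define \<Omega> where "\<Omega> = (sets \<mu> \<rightarrow>\<^sub>E (UNIV :: ennreal set))"
  define cyl where "cyl n A x = {f \<in> \<Omega>. \<forall>i<n. f (A i) \<le> ennreal (x i)}" for n :: nat and A x
  define \<G> where "\<G> = {cyl n A x | n A x. (\<forall>i<n. A i \<in> sets \<mu>) \<and> (\<forall>i<n. 0 < x i)}"
  have \<Omega>: "space ?M = \<Omega>" by (simp add: space_PiM \<Omega>_def)
  have cyl_in: "cyl n A x \<in> \<G>" if "\<forall>i<n. A i \<in> sets \<mu>" "\<forall>i<n. 0 < x i" for n A x
    using that unfolding \<G>_def by blast
  have \<Omega>_in: "\<Omega> \<in> \<G>" using cyl_in[of 0] by (simp add: cyl_def)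
  have \<G>_sets: "\<G> \<subseteq> sets ?M"
  proof
    fix X assume "X \<in> \<G>"
    then obtain n A x where X: "X = cyl n A x" "\<forall>i<n. A i \<in> sets \<mu>" by (auto simp: \<G>_def)
    have "{f \<in> space ?M. \<forall>i\<in>{..<n}. f (A i) \<le> ennreal (x i)} \<in> sets ?M"
      using X(2) by (intro sets.sets_Collect_finite_All) auto
    also have "{f \<in> space ?M. \<forall>i\<in>{..<n}. f (A i) \<le> ennreal (x i)} = X"
      unfolding X(1) cyl_def \<Omega> by auto
    finally show "X \<in> sets ?M" .
  qed
  have \<G>_Pow: "\<G> \<subseteq> Pow \<Omega>"
    by (rule subset_trans[OF \<G>_sets sets.space_closed, unfolded \<Omega>])
  have gen: "sets ?M = sigma_sets \<Omega> \<G>"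
  proof
    show "sigma_sets \<Omega> \<G> \<subseteq> sets ?M"
      by (rule sets.sigma_sets_subset[OF \<G>_sets, unfolded \<Omega>])
    define S where "S = sigma \<Omega> \<G>"
    have sp: "space S = \<Omega>" and st: "sets S = sigma_sets \<Omega> \<G>"
      using \<G>_Pow by (simp_all add: S_def space_measure_of_conv)
    have "sets ?M \<subseteq> sets S"
    proof (rule sets_PiM_in_sets)
      show "space S = (\<Pi>\<^sub>E i\<in>sets \<mu>. space (borel :: ennreal measure))" by (simp add: sp \<Omega>_def)
      fix A and B :: "ennreal set" assume A: "A \<in> sets \<mu>" and B: "B \<in> sets borel"
      have "(\<lambda>f. f A) \<in> borel_measurable S"
      proof (rule borel_measurableI_le)
        have pos: "{f \<in> \<Omega>. f A \<le> ennreal x} \<in> sets S" if "0 < x" for x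
        proof -
          have "cyl 1 (\<lambda>_. A) (\<lambda>_. x) \<in> sets S"
            unfolding st by (rule sigma_sets.Basic, rule cyl_in) (use A that in auto)
          moreover have "cyl 1 (\<lambda>_. A) (\<lambda>_. x) = {f \<in> \<Omega>. f A \<le> ennreal x}"
            by (simp add: cyl_def)
          ultimately show ?thesis by simp
        qed
        fix y :: ennreal
        show "{f \<in> space S. f A \<le> y} \<in> sets S"
        proof (cases y)
          case (real r)
          show ?thesis
          proof (cases "r = 0")
            case True
            have "v \<le> y \<longleftrightarrow> (\<forall>n. v \<le> ennreal (1 / real (Suc n)))" for v
            proof
              assume "\<forall>n. v \<le> ennreal (1 / real (Suc n))"
              moreover have "(\<lambda>n. ennreal (1 / real (Suc n))) \<longlonglongrightarrow> ennreal 0"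
                using LIMSEQ_inverse_real_of_nat by (intro tendsto_ennrealI) (simp add: inverse_eq_divide)
              ultimately have "v \<le> ennreal 0" by (intro LIMSEQ_le_const[OF _ exI[of _ 0]]) blast+
              then show "v \<le> y" using True real by simp
            qed (use True real in simp)
            then have "{f \<in> \<Omega>. f A \<le> y} = (\<Inter>n. {f \<in> \<Omega>. f A \<le> ennreal (1 / real (Suc n))})"
              by blast
            moreover have "\<dots> \<in> sets S"
              by (intro sets.countable_INT' image_subsetI pos) auto
            ultimately show ?thesis by (simp add: sp)
          next
            case False
            then show ?thesis using pos[of r] real by (simp add: sp)
          qed
        next
          case top
          then show ?thesis using sets.top[of S] by (simp add: sp)
        qed
      qed
      from measurable_sets[OF this B]
      have "(\<lambda>f. f A) -` B \<inter> space S \<in> sets S" .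
      also have "(\<lambda>f. f A) -` B \<inter> space S = {f \<in> space S. f A \<in> B}" by blast
      finally show "{f \<in> space S. f A \<in> B} \<in> sets S" .
    qed
    then show "sets ?M \<subseteq> sigma_sets \<Omega> \<G>" by (simp only: st)
  qed
  interpret P: prob_space P by (rule frechet_family_prob_space[OF N])
  have em: "emeasure (distr R ?M (\<lambda>\<omega>. \<lambda>A\<in>sets \<mu>. K A \<omega>)) (cyl n A x) = emeasure R {\<omega> \<in> space R. \<forall>i<n. K (A i) \<omega> \<le> ennreal (x i)}"
    if K: "frechet_family R \<alpha> \<mu> K" and A: "\<forall>i<n. A i \<in> sets \<mu>" "\<forall>i<n. 0 < x i"
    for R :: "'z measure" and K n A x
  proof -
    have "cyl n A x \<in> sets ?M" by (rule subsetD[OF \<G>_sets cyl_in[OF A]])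
    moreover have "(\<lambda>\<omega>. \<lambda>A\<in>sets \<mu>. K A \<omega>) -` cyl n A x \<inter> space R = {\<omega> \<in> space R. \<forall>i<n. K (A i) \<omega> \<le> ennreal (x i)}"
      using A(1) by (auto simp: cyl_def \<Omega>_def)
    ultimately show ?thesis
      by (simp add: emeasure_distr[OF frechet_family_process_measurable[OF K]])
  qed
  show ?thesis
  proof (rule measure_eqI_generator_eq[where E=\<G> and \<Omega>=\<Omega> and A="\<lambda>_. \<Omega>"])
    show "Int_stable \<G>"
    proof (rule Int_stableI)
      fix X Y assume "X \<in> \<G>" "Y \<in> \<G>"
      then obtain n A x k B y where X: "X = cyl n A x" "\<forall>i<n. A i \<in> sets \<mu>" "\<forall>i<n. 0 < x i"
        and Y: "Y = cyl k B y" "\<forall>i<k. B i \<in> sets \<mu>" "\<forall>i<k. 0 < y i"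
        unfolding \<G>_def by blast
      define C where "C i = (if i < n then A i else B (i - n))" for i
      define z where "z i = (if i < n then x i else y (i - n))" for i
      have "X \<inter> Y = cyl (n + k) C z"
      proof -
        have split: "(\<forall>i<n+k. R i) \<longleftrightarrow> (\<forall>i<n. R i) \<and> (\<forall>i<k. R (n + i))" for R :: "nat \<Rightarrow> bool"
        proof (intro iffI conjI allI impI)
          fix i assume *: "(\<forall>i<n. R i) \<and> (\<forall>i<k. R (n + i))" and i: "i < n + k"
          show "R i"
          proof (cases "i < n")
            case False
            then have "i - n < k" "n + (i - n) = i" using i by auto
            then show ?thesis using * by metis
          qed (use * in simp)
        qed auto
        have "(\<forall>i<n+k. f (C i) \<le> ennreal (z i)) \<longleftrightarrow> (\<forall>i<n. f (A i) \<le> ennreal (x i)) \<and> (\<forall>i<k. f (B i) \<le> ennreal (y i))" for f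
          unfolding split by (simp add: C_def z_def)
        then show ?thesis unfolding X(1) Y(1) cyl_def by blast
      qed
      also have "\<dots> \<in> \<G>" using X Y by (intro cyl_in) (auto simp: C_def z_def)
      finally show "X \<inter> Y \<in> \<G>" .
    qed
    show "\<G> \<subseteq> Pow \<Omega>" by (rule \<G>_Pow)
    fix X assume "X \<in> \<G>"
    then obtain n A x where X: "X = cyl n A x" "\<forall>i<n. A i \<in> sets \<mu>" "\<forall>i<n. 0 < x i" unfolding \<G>_def by blast
    show "emeasure ?D X = emeasure ?D' X"
      unfolding X(1) em[OF N X(2,3)] em[OF N' X(2,3)]
      unfolding frechet_family_joint_cdf[OF N X(2,3)] frechet_family_joint_cdf[OF N' X(2,3)] ..
  next
    show "emeasure ?D \<Omega> \<noteq> \<infinity>"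
      by (simp add: prob_space.emeasure_le_1[OF P.prob_space_distr[OF frechet_family_process_measurable[OF N]]] neq_top_trans[OF ennreal_one_neq_top])
  qed (use gen \<Omega>_in in auto)
qed

section \<open>Approximation by off-diagonal rectangles\<close>

lemma rect_union_insert: "rect_union k (insert R \<R>) = Pi\<^sub>E {..<k} R \<union> rect_union k \<R>"
  by (auto simp: rect_union_def)

lemma rect_union_sets:
  assumes "finite \<R>" "\<forall>R\<in>\<R>. \<forall>i<k. R i \<in> sets \<nu>"
  shows "rect_union k \<R> \<in> sets (power_measure \<nu> k)"
  unfolding rect_union_def using assms by (intro sets.finite_UN sets_PiM_I_finite) auto

lemma finite_measure_power:
  assumes "finite_measure \<nu>"
  shows "finite_measure (power_measure \<nu> k)"
proof
  interpret finite_measure \<nu> by fact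
  interpret product_sigma_finite "\<lambda>_::nat. \<nu>" ..
  have "emeasure (power_measure \<nu> k) (space (power_measure \<nu> k)) = emeasure \<nu> (space \<nu>) ^ k"
    by (simp add: space_PiM emeasure_PiM)
  also have "\<dots> \<noteq> \<infinity>" by (simp add: power_eq_top_ennreal)
  finally show "emeasure (power_measure \<nu> k) (space (power_measure \<nu> k)) \<noteq> \<infinity>" .
qed

lemma Borel_space_separating_function:
  assumes "Borel_space \<mu>"
  obtains f :: "'a \<Rightarrow> real" where "f \<in> borel_measurable \<mu>" "inj_on f (space \<mu>)"
  using assms unfolding Borel_space_def by (auto simp: measurable_restrict_space2_iff bij_betw_def)

text \<open>
  A Borel space has an injective measurable real function \<open>f\<close>. Pairwise distinct points get pairwise
  distinct values \<open>\<lfloor>n * f x\<rfloor>\<close> once \<open>n\<close> is large, so the products of \<open>k\<close> different level sets of these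
  functions cover the off-diagonal part.
\<close>
lemma off_diag_cover:
  assumes "Borel_space \<mu>"
  obtains \<Q> where "countable \<Q>" "\<And>R. R \<in> \<Q> \<Longrightarrow> off_diag_rect \<mu> k R"
    "off_diag \<mu> k = (\<Union>R\<in>\<Q>. Pi\<^sub>E {..<k} R)"
proof -
  obtain f :: "'a \<Rightarrow> real" where f[measurable]: "f \<in> borel_measurable \<mu>" and inj: "inj_on f (space \<mu>)"
    using assms by (rule Borel_space_separating_function)
  define cell where "cell n z = {x \<in> space \<mu>. \<lfloor>real n * f x\<rfloor> = z}" for n :: nat and z :: int
  define I where "I = (UNIV :: nat set) \<times> {a \<in> {..<k} \<rightarrow>\<^sub>E (UNIV :: int set). inj_on a {..<k}}"
  define \<Q> where "\<Q> = (\<lambda>(n, a) i. cell n (a i)) ` I"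
  have "countable {a \<in> {..<k} \<rightarrow>\<^sub>E (UNIV :: int set). inj_on a {..<k}}"
    by (rule countable_subset[OF _ countable_PiE[of "{..<k}" "\<lambda>_. UNIV :: int set"]]) auto
  then have "countable \<Q>" unfolding \<Q>_def I_def by (intro countable_image countable_SIGMA) auto
  moreover have "off_diag_rect \<mu> k R" if R: "R \<in> \<Q>" for R
  proof -
    obtain n a where R: "R = (\<lambda>i. cell n (a i))" and a: "inj_on a {..<k}"
      using R by (auto simp: \<Q>_def I_def)
    have "cell n z \<in> sets \<mu>" for z unfolding cell_def by measurable
    moreover have "disjoint_family_on R {..<k}"
      using a unfolding R disjoint_family_on_def by (auto simp: cell_def dest: inj_onD)
    ultimately show ?thesis by (simp add: off_diag_rect_def R)
  qed
  moreover have "off_diag \<mu> k = (\<Union>R\<in>\<Q>. Pi\<^sub>E {..<k} R)"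
  proof (intro set_eqI iffI)
    fix x assume x: "x \<in> off_diag \<mu> k"
    then have xE: "x \<in> {..<k} \<rightarrow>\<^sub>E space \<mu>" by (simp add: off_diag_def space_PiM)
    have ev: "eventually (\<lambda>n. \<lfloor>real n * f (x i)\<rfloor> \<noteq> \<lfloor>real n * f (x j)\<rfloor>) sequentially"
      if ij: "i < k" "j < k" "i \<noteq> j" for i j
    proof -
      have "x i \<noteq> x j" using x ij by (auto simp: off_diag_def)
      then have "f (x i) \<noteq> f (x j)" using inj xE ij by (auto dest!: inj_onD)
      then have d: "\<bar>f (x i) - f (x j)\<bar> > 0" by simp
      obtain N :: nat where N: "1 / \<bar>f (x i) - f (x j)\<bar> < real N" using reals_Archimedean2 by blast
      have "\<lfloor>real n * f (x i)\<rfloor> \<noteq> \<lfloor>real n * f (x j)\<rfloor>" if "n \<ge> N" for n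
      proof
        assume eq: "\<lfloor>real n * f (x i)\<rfloor> = \<lfloor>real n * f (x j)\<rfloor>"
        have "1 < real N * \<bar>f (x i) - f (x j)\<bar>" using N d by (simp add: field_simps)
        also have "\<dots> \<le> real n * \<bar>f (x i) - f (x j)\<bar>" using that by (intro mult_right_mono) auto
        also have "\<dots> = \<bar>real n * f (x i) - real n * f (x j)\<bar>" by (simp add: abs_mult right_diff_distrib[symmetric])
        finally have "1 < \<bar>real n * f (x i) - real n * f (x j)\<bar>" .
        then show False using eq by linarith
      qed
      then show ?thesis by (auto simp: eventually_sequentially)
    qed
    have "eventually (\<lambda>n. \<forall>i\<in>{..<k}. \<forall>j\<in>{..<k}. i \<noteq> j \<longrightarrow> \<lfloor>real n * f (x i)\<rfloor> \<noteq> \<lfloor>real n * f (x j)\<rfloor>) sequentially"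
    proof (intro eventually_ball_finite ballI)
      fix i j assume "i \<in> {..<k}" "j \<in> {..<k}"
      then show "eventually (\<lambda>n. i \<noteq> j \<longrightarrow> \<lfloor>real n * f (x i)\<rfloor> \<noteq> \<lfloor>real n * f (x j)\<rfloor>) sequentially"
        using ev[of i j] by (cases "i = j") auto
    qed auto
    then obtain n where n: "\<forall>i\<in>{..<k}. \<forall>j\<in>{..<k}. i \<noteq> j \<longrightarrow> \<lfloor>real n * f (x i)\<rfloor> \<noteq> \<lfloor>real n * f (x j)\<rfloor>"
      by (auto simp: eventually_sequentially)
    define a where "a = (\<lambda>i\<in>{..<k}. \<lfloor>real n * f (x i)\<rfloor>)"
    have "(n, a) \<in> I" using n unfolding I_def a_def by (auto simp: inj_on_def)
    moreover have "x \<in> Pi\<^sub>E {..<k} (\<lambda>i. cell n (a i))"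
      using xE by (auto simp: a_def cell_def PiE_iff)
    ultimately show "x \<in> (\<Union>R\<in>\<Q>. Pi\<^sub>E {..<k} R)"
      unfolding \<Q>_def by (intro UN_I[OF imageI, of "(n, a)"]) simp_all
  next
    fix x assume "x \<in> (\<Union>R\<in>\<Q>. Pi\<^sub>E {..<k} R)"
    then obtain n a where a: "inj_on a {..<k}" and x: "x \<in> Pi\<^sub>E {..<k} (\<lambda>i. cell n (a i))"
      by (auto simp: \<Q>_def I_def)
    have "x i \<noteq> x j" if "i < k" "j < k" "i \<noteq> j" for i j
    proof -
      have "a i \<noteq> a j" using a that by (auto dest: inj_onD)
      moreover have "x i \<in> cell n (a i)" "x j \<in> cell n (a j)" using x that by auto
      ultimately show ?thesis by (auto simp: cell_def)
    qed
    then show "x \<in> off_diag \<mu> k"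
      using x by (auto simp: off_diag_def space_PiM PiE_iff cell_def)
  qed
  ultimately show thesis by (rule that)
qed

lemma off_diag_in_sets:
  assumes "Borel_space \<mu>"
  shows "off_diag \<mu> k \<in> sets (power_measure \<mu> k)"
proof -
  obtain \<Q> where "countable \<Q>" "\<And>R. R \<in> \<Q> \<Longrightarrow> off_diag_rect \<mu> k R"
    "off_diag \<mu> k = (\<Union>R\<in>\<Q>. Pi\<^sub>E {..<k} R)" using off_diag_cover[OF assms, of k] by metis
  then show ?thesis by (auto intro!: sets.countable_UN' sets_PiM_I_finite simp: off_diag_rect_def)
qed

lemma off_diag_setsD:
  assumes "Borel_space \<mu>" "A \<in> off_diag_sets \<mu> k"
  shows "A \<in> sets (power_measure \<mu> k)" "A \<subseteq> off_diag \<mu> k"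
  using assms off_diag_in_sets[OF assms(1)] by (auto simp: off_diag_sets_def)

text \<open>
  \<open>\<K>\<close> is the class of rectangles that may be used. It is a parameter because complements are available
  only inside a fixed rectangle.
\<close>
definition approximable :: "'a measure \<Rightarrow> nat \<Rightarrow> (nat \<Rightarrow> 'a set) set \<Rightarrow> (nat \<Rightarrow> 'a) set \<Rightarrow> bool" where
  "approximable \<nu> k \<K> A \<longleftrightarrow> A \<in> sets (power_measure \<nu> k) \<and>
     (\<forall>\<epsilon>>0. \<exists>\<R>. finite \<R> \<and> \<R> \<subseteq> \<K> \<and>
        measure (power_measure \<nu> k) ((rect_union k \<R> - A) \<union> (A - rect_union k \<R>)) < \<epsilon>)"

lemma approximable_UN:
  assumes \<nu>: "finite_measure \<nu>" and \<K>: "\<forall>R\<in>\<K>. \<forall>i<k. R i \<in> sets \<nu>"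
    and A: "\<And>i::nat. approximable \<nu> k \<K> (A i)"
  shows "approximable \<nu> k \<K> (\<Union>i. A i)"
  unfolding approximable_def
proof (intro conjI allI impI)
  let ?L = "power_measure \<nu> k"
  interpret L: finite_measure ?L by (rule finite_measure_power[OF \<nu>])
  have As: "A i \<in> sets ?L" for i using A[of i] by (simp add: approximable_def)
  then show "(\<Union>i. A i) \<in> sets ?L" by auto
  fix \<epsilon> :: real assume "0 < \<epsilon>"
  define C where "C n = (\<Union>i<n. A i)" for n
  have C: "range C \<subseteq> sets ?L" using As by (auto simp: C_def)
  have "incseq C" unfolding incseq_def C_def by (intro allI impI UN_mono) auto
  from L.finite_Lim_measure_incseq[OF C this]
  have "(\<lambda>n. measure ?L (C n)) \<longlonglongrightarrow> measure ?L (\<Union>n. C n)" .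
  also have "(\<Union>n. C n) = (\<Union>i. A i)" unfolding C_def by blast
  finally have "(\<lambda>n. measure ?L (C n)) \<longlonglongrightarrow> measure ?L (\<Union>i. A i)" .
  then have "eventually (\<lambda>n. measure ?L (C n) > measure ?L (\<Union>i. A i) - \<epsilon> / 2) sequentially"
    by (rule order_tendstoD(1)) (use \<open>0 < \<epsilon>\<close> in simp)
  then have "\<exists>N. measure ?L (\<Union>i. A i) - \<epsilon> / 2 < measure ?L (\<Union>i<N. A i)"
    unfolding C_def eventually_sequentially by blast
  then obtain N where N: "measure ?L (\<Union>i. A i) - \<epsilon> / 2 < measure ?L (\<Union>i<N. A i)" ..
  define \<delta> where "\<delta> = \<epsilon> / (2 * real (Suc N))"
  have "\<delta> > 0" using \<open>0 < \<epsilon>\<close> by (simp add: \<delta>_def)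
  then have "\<forall>i. \<exists>\<R>. finite \<R> \<and> \<R> \<subseteq> \<K> \<and> measure ?L ((rect_union k \<R> - A i) \<union> (A i - rect_union k \<R>)) < \<delta>"
    using A by (simp add: approximable_def)
  from choice[OF this] obtain \<R> where \<R>: "\<And>i. finite (\<R> i)" "\<And>i. \<R> i \<subseteq> \<K>"
    "\<And>i. measure ?L ((rect_union k (\<R> i) - A i) \<union> (A i - rect_union k (\<R> i))) < \<delta>" by blast
  define S where "S i = (rect_union k (\<R> i) - A i) \<union> (A i - rect_union k (\<R> i))" for i
  have ru: "rect_union k (\<R> i) \<in> sets ?L" for i using \<R> \<K> by (intro rect_union_sets) blast+
  have S: "S i \<in> sets ?L" for i unfolding S_def using As ru by auto
  let ?U = "\<Union>i<N. \<R> i"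
  have U: "rect_union k ?U = (\<Union>i<N. rect_union k (\<R> i))" by (auto simp: rect_union_def)
  let ?B = "\<Union>i. A i"
  have rest: "measure ?L (?B - (\<Union>i<N. A i)) = measure ?L ?B - measure ?L (\<Union>i<N. A i)"
    using As by (intro L.finite_measure_Diff) auto
  have Ss: "measure ?L (\<Union>i<N. S i) \<le> (\<Sum>i<N. measure ?L (S i))"
    using S by (intro L.finite_measure_subadditive_finite) auto
  also have "\<dots> \<le> (\<Sum>i<N. \<delta>)" using \<R>(3) by (intro sum_mono) (simp add: S_def less_imp_le)
  also have "\<dots> \<le> \<epsilon> / 2" using \<open>0 < \<epsilon>\<close> by (simp add: \<delta>_def field_simps)
  finally have Ss: "measure ?L (\<Union>i<N. S i) \<le> \<epsilon> / 2" .
  have "measure ?L ((rect_union k ?U - ?B) \<union> (?B - rect_union k ?U))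
      \<le> measure ?L ((\<Union>i<N. S i) \<union> (?B - (\<Union>i<N. A i)))"
    using As S by (intro L.finite_measure_mono) (auto simp: U S_def)
  also have "\<dots> \<le> measure ?L (\<Union>i<N. S i) + measure ?L (?B - (\<Union>i<N. A i))"
    using As S by (intro measure_Un_le) auto
  also have "\<dots> < \<epsilon>" using Ss rest N by linarith
  finally show "\<exists>\<R>. finite \<R> \<and> \<R> \<subseteq> \<K> \<and> measure ?L ((rect_union k \<R> - ?B) \<union> (?B - rect_union k \<R>)) < \<epsilon>"
    using \<R> by (intro exI[of _ ?U]) auto
qed

text \<open>
  A point of the rectangle \<open>D\<close> misses the rectangle \<open>R\<close> iff one of its coordinates does, so the complement
  of \<open>R\<close> in \<open>D\<close> is the union of the \<open>k\<close> rectangles in which one side is replaced by its part outside \<open>R\<close>.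
\<close>
lemma rect_union_complement:
  assumes "finite \<R>" "\<R> \<subseteq> {R. \<forall>i<k. R i \<in> sets \<nu> \<and> R i \<subseteq> D i}" "\<forall>i<k. D i \<in> sets \<nu>"
  shows "\<exists>\<R>'. finite \<R>' \<and> \<R>' \<subseteq> {R. \<forall>i<k. R i \<in> sets \<nu> \<and> R i \<subseteq> D i} \<and>
     rect_union k \<R>' = Pi\<^sub>E {..<k} D - rect_union k \<R>"
  using assms
proof (induction \<R>)
  case empty
  then show ?case by (intro exI[of _ "{D}"]) (auto simp: rect_union_def)
next
  case (insert R \<R>)
  then obtain \<R>' where R': "finite \<R>'" "\<R>' \<subseteq> {R. \<forall>i<k. R i \<in> sets \<nu> \<and> R i \<subseteq> D i}"
    "rect_union k \<R>' = Pi\<^sub>E {..<k} D - rect_union k \<R>" by auto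
  define \<R>'' where "\<R>'' = (\<lambda>(l, R') i. if i = l then R' i - R i else R' i) ` ({..<k} \<times> \<R>')"
  have "rect_union k \<R>'' = rect_union k \<R>' - Pi\<^sub>E {..<k} R"
  proof (intro set_eqI iffI)
    fix x assume "x \<in> rect_union k \<R>''"
    then obtain l R' where l: "l < k" "R' \<in> \<R>'" "x \<in> Pi\<^sub>E {..<k} (\<lambda>i. if i = l then R' i - R i else R' i)"
      by (auto simp: rect_union_def \<R>''_def)
    have "x i \<in> R' i" if "i < k" for i
      using l(3) that by (auto simp: PiE_iff split: if_splits)
    moreover have "x l \<notin> R l" using PiE_mem[OF l(3), of l] l(1) by simp
    ultimately show "x \<in> rect_union k \<R>' - Pi\<^sub>E {..<k} R"
      using l by (auto simp: rect_union_def PiE_iff)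
  next
    fix x assume x: "x \<in> rect_union k \<R>' - Pi\<^sub>E {..<k} R"
    then obtain R' where R': "R' \<in> \<R>'" "x \<in> Pi\<^sub>E {..<k} R'" by (auto simp: rect_union_def)
    then obtain l where "l < k" "x l \<notin> R l" using x by (auto simp: PiE_iff)
    then have "x \<in> Pi\<^sub>E {..<k} (\<lambda>i. if i = l then R' i - R i else R' i)"
      using R'(2) by (simp add: PiE_iff)
    moreover have "(\<lambda>i. if i = l then R' i - R i else R' i) \<in> \<R>''"
      unfolding \<R>''_def using \<open>l < k\<close> R'(1) by (intro image_eqI[of _ _ "(l, R')"]) auto
    ultimately show "x \<in> rect_union k \<R>''" unfolding rect_union_def by blast
  qed
  moreover have "finite \<R>''" using R' by (simp add: \<R>''_def)
  moreover have "\<R>'' \<subseteq> {R. \<forall>i<k. R i \<in> sets \<nu> \<and> R i \<subseteq> D i}"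
  proof
    fix Y assume "Y \<in> \<R>''"
    then obtain l R' where Y: "Y = (\<lambda>i. if i = l then R' i - R i else R' i)" "R' \<in> \<R>'"
      unfolding \<R>''_def by auto
    have "R' i \<in> sets \<nu> \<and> R' i \<subseteq> D i" if "i < k" for i using Y(2) R'(2) that by blast
    moreover have "R i \<in> sets \<nu>" if "i < k" for i using insert.prems(1) that by blast
    ultimately show "Y \<in> {R. \<forall>i<k. R i \<in> sets \<nu> \<and> R i \<subseteq> D i}"
      unfolding Y(1) by (simp add: Diff_subset_conv le_supI2 sets.Diff)
  qed
  ultimately show ?case
    unfolding rect_union_insert R'(3) by (intro exI[of _ \<R>'']) blast
qed

text \<open>
  Inside one off-diagonal rectangle all subrectangles are off-diagonal. There the finite unions of
  rectangles are closed under complement, so the approximable sets form a \<open>\<sigma>\<close>-algebra.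
\<close>
lemma approximable_in_rect:
  assumes \<nu>: "finite_measure \<nu>" and D: "\<forall>i<k. D i \<in> sets \<nu>" and A: "A \<in> sets (power_measure \<nu> k)"
  shows "approximable \<nu> k {R. \<forall>i<k. R i \<in> sets \<nu> \<and> R i \<subseteq> D i} (A \<inter> Pi\<^sub>E {..<k} D)"
    (is "approximable \<nu> k ?K _")
proof -
  let ?L = "power_measure \<nu> k" and ?D = "Pi\<^sub>E {..<k} D"
  have Ds: "?D \<in> sets ?L" using D by (intro sets_PiM_I_finite) auto
  have A': "A \<in> sigma_sets (space ?L) (prod_algebra {..<k} (\<lambda>_. \<nu>))"
    using A by (simp add: sets_PiM space_PiM)
  have in_sets: "X \<in> sets ?L" if "X \<in> sigma_sets (space ?L) (prod_algebra {..<k} (\<lambda>_. \<nu>))" for X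
    using that by (simp add: sets_PiM space_PiM)
  from A' show ?thesis
  proof (induction rule: sigma_sets.induct)
    case (Basic X)
    then obtain Y where Y: "X = Pi\<^sub>E {..<k} Y" "\<forall>i<k. Y i \<in> sets \<nu>"
      by (auto simp: prod_algebra_eq_finite)
    have "X \<inter> ?D = rect_union k {\<lambda>i. Y i \<inter> D i}"
      by (auto simp: Y(1) rect_union_def PiE_Int)
    moreover have "X \<inter> ?D \<in> sets ?L" using Ds Y by (auto intro!: sets.Int sets_PiM_I_finite)
    ultimately show ?case
      unfolding approximable_def using Y D
      by (intro conjI allI impI exI[of _ "{\<lambda>i. Y i \<inter> D i}"]) auto
  next
    case Empty
    show ?case unfolding approximable_def
      by (intro conjI allI impI exI[of _ "{}"]) (auto simp: rect_union_def)
  next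
    case (Compl X)
    show ?case unfolding approximable_def
    proof (intro conjI allI impI)
      show "(space ?L - X) \<inter> ?D \<in> sets ?L" using in_sets[OF Compl.hyps] Ds by auto
      fix \<epsilon> :: real assume "0 < \<epsilon>"
      then obtain \<R> where R: "finite \<R>" "\<R> \<subseteq> ?K"
        "measure ?L ((rect_union k \<R> - X \<inter> ?D) \<union> (X \<inter> ?D - rect_union k \<R>)) < \<epsilon>"
        using Compl.IH unfolding approximable_def by blast
      obtain \<R>' where R': "finite \<R>'" "\<R>' \<subseteq> ?K" "rect_union k \<R>' = ?D - rect_union k \<R>"
        using rect_union_complement[OF R(1,2) D] by blast
      have "rect_union k \<R> \<subseteq> ?D"
        unfolding rect_union_def by (intro UN_least PiE_mono) (use R(2) in blast)
      moreover have "?D \<subseteq> space ?L" using Ds by (rule sets.sets_into_space)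
      ultimately have "(rect_union k \<R>' - (space ?L - X) \<inter> ?D) \<union> ((space ?L - X) \<inter> ?D - rect_union k \<R>') =
         (rect_union k \<R> - X \<inter> ?D) \<union> (X \<inter> ?D - rect_union k \<R>)"
        unfolding R'(3) by blast
      then show "\<exists>\<R>. finite \<R> \<and> \<R> \<subseteq> ?K \<and>
          measure ?L ((rect_union k \<R> - (space ?L - X) \<inter> ?D) \<union> ((space ?L - X) \<inter> ?D - rect_union k \<R>)) < \<epsilon>"
        using R' R(3) by (intro exI[of _ \<R>']) simp
    qed
  next
    case (Union X)
    have "approximable \<nu> k ?K (\<Union>i. X i \<inter> ?D)"
      by (rule approximable_UN[OF \<nu>]) (use Union.IH in auto)
    then show ?case by (simp add: Int_UN_distrib2)
  qed
qed

lemma off_diag_approximation: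
  assumes \<nu>: "finite_measure \<nu>" and B: "Borel_space \<nu>" and A: "A \<in> off_diag_sets \<nu> k"
  obtains \<R> where "\<And>n::nat. finite (\<R> n)" "\<And>n R. R \<in> \<R> n \<Longrightarrow> off_diag_rect \<nu> k R"
    "\<And>n. emeasure (power_measure \<nu> k) ((rect_union k (\<R> n) - A) \<union> (A - rect_union k (\<R> n))) \<le> ennreal ((1/2) ^ n)"
proof -
  let ?L = "power_measure \<nu> k"
  interpret L: finite_measure ?L by (rule finite_measure_power[OF \<nu>])
  let ?K = "Collect (off_diag_rect \<nu> k)"
  obtain \<Q> where Q: "countable \<Q>" "\<And>R. R \<in> \<Q> \<Longrightarrow> off_diag_rect \<nu> k R"
    "off_diag \<nu> k = (\<Union>R\<in>\<Q>. Pi\<^sub>E {..<k} R)" using off_diag_cover[OF B, of k] by metis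
  note AD = off_diag_setsD[OF B A]
  have "approximable \<nu> k ?K A"
  proof (cases "\<Q> = {}")
    case True
    then have "A = {}" using AD Q by auto
    then show ?thesis unfolding approximable_def
      by (intro conjI allI impI exI[of _ "{}"]) (auto simp: rect_union_def)
  next
    case False
    define D where "D i = from_nat_into \<Q> i" for i
    have "range D = \<Q>" unfolding D_def using range_from_nat_into[OF False Q(1)] by simp
    then have "off_diag \<nu> k = (\<Union>i. Pi\<^sub>E {..<k} (D i))" unfolding Q(3) by blast
    then have "A = (\<Union>i. A \<inter> Pi\<^sub>E {..<k} (D i))" using AD(2) by blast
    moreover have "approximable \<nu> k ?K (\<Union>i. A \<inter> Pi\<^sub>E {..<k} (D i))"
    proof (rule approximable_UN[OF \<nu>])
      fix i
      have D: "off_diag_rect \<nu> k (D i)" using Q(2) \<open>range D = \<Q>\<close> by blast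
      have "{R. \<forall>l<k. R l \<in> sets \<nu> \<and> R l \<subseteq> D i l} \<subseteq> ?K"
      proof (intro subsetI CollectI)
        fix R assume "R \<in> {R. \<forall>l<k. R l \<in> sets \<nu> \<and> R l \<subseteq> D i l}"
        then have R: "R l \<in> sets \<nu>" "R l \<subseteq> D i l" if "l < k" for l using that by auto
        have "R l \<inter> R l' = {}" if "l < k" "l' < k" "l \<noteq> l'" for l l'
        proof -
          have "D i l \<inter> D i l' = {}"
            using D that by (simp add: off_diag_rect_def disjoint_family_on_def)
          then show ?thesis using R(2)[OF that(1)] R(2)[OF that(2)] by blast
        qed
        then show "off_diag_rect \<nu> k R"
          using R(1) by (simp add: off_diag_rect_def disjoint_family_on_def)
      qed
      moreover have "approximable \<nu> k {R. \<forall>l<k. R l \<in> sets \<nu> \<and> R l \<subseteq> D i l} (A \<inter> Pi\<^sub>E {..<k} (D i))"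
        using D AD(1) by (intro approximable_in_rect[OF \<nu>]) (auto simp: off_diag_rect_def)
      ultimately show "approximable \<nu> k ?K (A \<inter> Pi\<^sub>E {..<k} (D i))"
        unfolding approximable_def by (meson subset_trans)
    qed (auto simp: off_diag_rect_def)
    ultimately show ?thesis by simp
  qed
  then have "\<forall>n. \<exists>\<R>. finite \<R> \<and> \<R> \<subseteq> ?K \<and> measure ?L ((rect_union k \<R> - A) \<union> (A - rect_union k \<R>)) < (1/2) ^ n"
    unfolding approximable_def by auto
  from choice[OF this] obtain \<R> where R: "\<And>n. finite (\<R> n)" "\<And>n. \<R> n \<subseteq> ?K"
    "\<And>n. measure ?L ((rect_union k (\<R> n) - A) \<union> (A - rect_union k (\<R> n))) < (1/2) ^ n" by blast
  show thesis
  proof (rule that[of \<R>])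
    show "emeasure ?L ((rect_union k (\<R> n) - A) \<union> (A - rect_union k (\<R> n))) \<le> ennreal ((1/2) ^ n)" for n
      unfolding L.emeasure_eq_measure using R(3)[of n] by (intro ennreal_leI) simp
  qed (use R in auto)
qed

section \<open>Suprema over points and over tuples of distinct points\<close>

text \<open>
  The next two suprema are functions of a fixed sequence of weights \<open>w\<close> and marks \<open>t\<close>; all statements of
  this section hold for every such pair of sequences.
\<close>
definition point_sup :: "(nat \<Rightarrow> ennreal) \<Rightarrow> (nat \<Rightarrow> 'a) \<Rightarrow> 'a set \<Rightarrow> ennreal" where
  "point_sup w t B = (SUP j. w j * indicator B (t j))"

definition tuple_sup :: "(nat \<Rightarrow> ennreal) \<Rightarrow> (nat \<Rightarrow> 'a) \<Rightarrow> nat \<Rightarrow> (nat \<Rightarrow> 'a) set \<Rightarrow> ennreal" where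
  "tuple_sup w t k A =
     (SUP j\<in>distinct_indices k. (\<Prod>r<k. w (j r)) * indicator A (\<lambda>r\<in>{..<k}. t (j r)))"

lemma countable_distinct_indices: "countable (distinct_indices k)"
  unfolding distinct_indices_def
  by (rule countable_subset[OF _ countable_PiE[of "{..<k}" "\<lambda>_. UNIV :: nat set"]]) auto

lemma prod_SUP_le_SUP_prod:
  fixes u :: "nat \<Rightarrow> nat \<Rightarrow> ennreal"
  shows "(\<Prod>r<k. SUP i. u r i) \<le> (SUP j\<in>{..<k} \<rightarrow>\<^sub>E UNIV. \<Prod>r<k. u r (j r))"
proof (induction k)
  case (Suc k)
  have "(\<Prod>r<Suc k. SUP i. u r i) \<le> (SUP j\<in>{..<k} \<rightarrow>\<^sub>E UNIV. \<Prod>r<k. u r (j r)) * (SUP i. u k i)"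
    using mult_right_mono[OF Suc, of "SUP i. u k i"] by (simp add: mult.commute)
  also have "\<dots> = (SUP j\<in>{..<k} \<rightarrow>\<^sub>E UNIV. SUP i. (\<Prod>r<k. u r (j r)) * u k i)"
    by (subst SUP_mult_right_ennreal, subst SUP_mult_left_ennreal) (rule refl)
  also have "\<dots> \<le> (SUP j\<in>{..<Suc k} \<rightarrow>\<^sub>E UNIV. \<Prod>r<Suc k. u r (j r))"
  proof (intro SUP_least)
    fix j :: "nat \<Rightarrow> nat" and i assume j: "j \<in> {..<k} \<rightarrow>\<^sub>E UNIV"
    have "(\<Prod>r<k. u r (j r)) * u k i = (\<Prod>r<Suc k. u r ((j(k := i)) r))"
      by (simp add: mult.commute)
    also have "\<dots> \<le> (SUP j\<in>{..<Suc k} \<rightarrow>\<^sub>E UNIV. \<Prod>r<Suc k. u r (j r))"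
      using j by (intro SUP_upper) (auto simp: PiE_iff extensional_def)
    finally show "(\<Prod>r<k. u r (j r)) * u k i \<le> (SUP j\<in>{..<Suc k} \<rightarrow>\<^sub>E UNIV. \<Prod>r<Suc k. u r (j r))" .
  qed
  finally show ?case .
qed simp

lemma indicator_PiE_marks:
  fixes k :: nat
  shows "indicator (Pi\<^sub>E {..<k} R) (\<lambda>r\<in>{..<k}. t (j r)) = (\<Prod>r<k. indicator (R r) (t (j r)) :: ennreal)"
proof (cases "(\<lambda>r\<in>{..<k}. t (j r)) \<in> Pi\<^sub>E {..<k} R")
  case True
  then have "t (j r) \<in> R r" if "r < k" for r using PiE_mem[OF True, of r] that by simp
  then show ?thesis using True by simp
next
  case False
  then obtain r where r: "r < k" "t (j r) \<notin> R r" by (auto simp: PiE_iff)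
  then have "(\<Prod>r<k. indicator (R r) (t (j r)) :: ennreal) = 0"
    by (intro prod_zero bexI[of _ r]) simp_all
  then show ?thesis using False by simp
qed

text \<open>
  A product of suprema is the supremum over all tuples of indices, and tuples with a repeated index
  contribute nothing because the sides are disjoint.
\<close>
lemma tuple_sup_rect:
  assumes "disjoint_family_on R {..<k}"
  shows "tuple_sup w t k (Pi\<^sub>E {..<k} R) = (\<Prod>r<k. point_sup w t (R r))"
proof (rule antisym)
  have eq: "(\<Prod>r<k. w (j r)) * indicator (Pi\<^sub>E {..<k} R) (\<lambda>r\<in>{..<k}. t (j r)) = (\<Prod>r<k. w (j r) * indicator (R r) (t (j r)))" for j
    by (simp only: indicator_PiE_marks prod.distrib)
  show "tuple_sup w t k (Pi\<^sub>E {..<k} R) \<le> (\<Prod>r<k. point_sup w t (R r))"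
    unfolding tuple_sup_def eq point_sup_def
    by (intro SUP_least prod_mono_ennreal SUP_upper) auto
  have "(\<Prod>r<k. point_sup w t (R r)) \<le> (SUP j\<in>{..<k} \<rightarrow>\<^sub>E UNIV. \<Prod>r<k. w (j r) * indicator (R r) (t (j r)))"
    unfolding point_sup_def by (rule prod_SUP_le_SUP_prod)
  also have "\<dots> \<le> tuple_sup w t k (Pi\<^sub>E {..<k} R)"
  proof (rule SUP_least)
    fix j :: "nat \<Rightarrow> nat" assume j: "j \<in> {..<k} \<rightarrow>\<^sub>E UNIV"
    show "(\<Prod>r<k. w (j r) * indicator (R r) (t (j r))) \<le> tuple_sup w t k (Pi\<^sub>E {..<k} R)"
    proof (cases "inj_on j {..<k}")
      case True
      then have "j \<in> distinct_indices k" using j by (simp add: distinct_indices_def)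
      then show ?thesis unfolding tuple_sup_def eq by (rule SUP_upper)
    next
      case False
      then obtain r s where rs: "r < k" "s < k" "r \<noteq> s" "j r = j s" by (auto simp: inj_on_def)
      then have "R r \<inter> R s = {}" using assms by (simp add: disjoint_family_on_def)
      then have "t (j r) \<notin> R r \<or> t (j s) \<notin> R s" using rs(4) by auto
      then obtain q where "q < k" "t (j q) \<notin> R q" using rs(1,2) by blast
      then have z: "(\<Prod>r<k. w (j r) * indicator (R r) (t (j r))) = 0"
        by (intro prod_zero bexI[of _ q]) simp_all
      show ?thesis unfolding z by simp
    qed
  qed
  finally show "(\<Prod>r<k. point_sup w t (R r)) \<le> tuple_sup w t k (Pi\<^sub>E {..<k} R)" .
qed

lemma tuple_sup_mono: "A \<subseteq> B \<Longrightarrow> tuple_sup w t k A \<le> tuple_sup w t k B"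
  unfolding tuple_sup_def
  by (intro SUP_mono' mult_left_mono) (auto split: split_indicator)

lemma tuple_sup_UN: "tuple_sup w t k (\<Union>i\<in>I. B i) = (SUP i\<in>I. tuple_sup w t k (B i))"
proof (rule antisym)
  show "(SUP i\<in>I. tuple_sup w t k (B i)) \<le> tuple_sup w t k (\<Union>i\<in>I. B i)"
    by (intro SUP_least tuple_sup_mono) auto
  show "tuple_sup w t k (\<Union>i\<in>I. B i) \<le> (SUP i\<in>I. tuple_sup w t k (B i))"
    unfolding tuple_sup_def[of w t k "\<Union>i\<in>I. B i"]
  proof (rule SUP_least)
    fix j assume j: "j \<in> distinct_indices k"
    let ?T = "\<lambda>r\<in>{..<k}. t (j r)"
    show "(\<Prod>r<k. w (j r)) * indicator (\<Union>i\<in>I. B i) ?T \<le> (SUP i\<in>I. tuple_sup w t k (B i))"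
    proof (cases "\<exists>i\<in>I. ?T \<in> B i")
      case True
      then obtain i where i: "i \<in> I" "?T \<in> B i" by blast
      have "(\<Prod>r<k. w (j r)) * indicator (\<Union>i\<in>I. B i) ?T = (\<Prod>r<k. w (j r)) * indicator (B i) ?T"
        using i by (auto split: split_indicator)
      also have "\<dots> \<le> tuple_sup w t k (B i)" unfolding tuple_sup_def using j by (intro SUP_upper)
      also have "\<dots> \<le> (SUP i\<in>I. tuple_sup w t k (B i))" using i(1) by (rule SUP_upper)
      finally show ?thesis .
    next
      case False
      then have "indicator (\<Union>i\<in>I. B i) ?T = (0 :: ennreal)" by (simp add: indicator_def)
      then show ?thesis by simp
    qed
  qed
qed

lemma tuple_sup_Un: "tuple_sup w t k (A \<union> B) = max (tuple_sup w t k A) (tuple_sup w t k B)"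
  using tuple_sup_UN[of w t k id "{A, B}"] by (simp add: sup_max)

lemma point_sup_UN: "point_sup w t (\<Union>i\<in>I. B i) = (SUP i\<in>I. point_sup w t (B i))"
proof (rule antisym)
  have mono: "point_sup w t A \<le> point_sup w t A'" if "A \<subseteq> A'" for A A'
    unfolding point_sup_def using that by (intro SUP_mono' mult_left_mono) (auto split: split_indicator)
  show "(SUP i\<in>I. point_sup w t (B i)) \<le> point_sup w t (\<Union>i\<in>I. B i)"
    by (intro SUP_least mono) auto
  show "point_sup w t (\<Union>i\<in>I. B i) \<le> (SUP i\<in>I. point_sup w t (B i))"
    unfolding point_sup_def[of w t "\<Union>i\<in>I. B i"]
  proof (rule SUP_least)
    fix j
    show "w j * indicator (\<Union>i\<in>I. B i) (t j) \<le> (SUP i\<in>I. point_sup w t (B i))"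
    proof (cases "\<exists>i\<in>I. t j \<in> B i")
      case True
      then obtain i where i: "i \<in> I" "t j \<in> B i" by blast
      have "w j * indicator (\<Union>i\<in>I. B i) (t j) = w j * indicator (B i) (t j)"
        using i by (auto split: split_indicator)
      also have "\<dots> \<le> point_sup w t (B i)" unfolding point_sup_def by (intro SUP_upper) simp
      also have "\<dots> \<le> (SUP i\<in>I. point_sup w t (B i))" using i(1) by (rule SUP_upper)
      finally show ?thesis .
    next
      case False
      then have "indicator (\<Union>i\<in>I. B i) (t j) = (0 :: ennreal)" by (simp add: indicator_def)
      then show ?thesis by simp
    qed
  qed
qed

abbreviation cube :: "'a set \<Rightarrow> nat \<Rightarrow> (nat \<Rightarrow> 'a) set" where
  "cube G k \<equiv> Pi\<^sub>E {..<k} (\<lambda>_. G)"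

lemma disjoint_family_on_Int: "disjoint_family_on R I \<Longrightarrow> disjoint_family_on (\<lambda>i. R i \<inter> G) I"
  by (auto simp: disjoint_family_on_def)

lemma rect_sup_point_sup:
  assumes "\<forall>R\<in>\<R>. disjoint_family_on R {..<k}"
  shows "(SUP R\<in>\<R>. \<Prod>i<k. point_sup w t (R i \<inter> G)) = tuple_sup w t k (rect_union k \<R> \<inter> cube G k)"
proof -
  have "rect_union k \<R> \<inter> cube G k = (\<Union>R\<in>\<R>. Pi\<^sub>E {..<k} (\<lambda>i. R i \<inter> G))"
  proof -
    have "rect_union k \<R> \<inter> cube G k = (\<Union>R\<in>\<R>. Pi\<^sub>E {..<k} R \<inter> cube G k)"
      unfolding rect_union_def by blast
    then show ?thesis by (simp only: PiE_Int)
  qed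
  then have "tuple_sup w t k (rect_union k \<R> \<inter> cube G k) = (SUP R\<in>\<R>. tuple_sup w t k (Pi\<^sub>E {..<k} (\<lambda>i. R i \<inter> G)))"
    by (simp add: tuple_sup_UN)
  also have "\<dots> = (SUP R\<in>\<R>. \<Prod>i<k. point_sup w t (R i \<inter> G))"
  proof (rule SUP_cong[OF refl])
    fix R assume "R \<in> \<R>"
    then have dR: "disjoint_family_on R {..<k}" using assms by blast
    from disjoint_family_on_Int[OF this, of G]
    have "disjoint_family_on (\<lambda>i. R i \<inter> G) {..<k}" .
    then show "tuple_sup w t k (Pi\<^sub>E {..<k} (\<lambda>i. R i \<inter> G)) = (\<Prod>i<k. point_sup w t (R i \<inter> G))"
      by (rule tuple_sup_rect)
  qed
  finally show ?thesis by simp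
qed

text \<open>
  In a tuple from \<open>G\<close> whose product of weights exceeds \<open>\<epsilon>\<close>, no weight can be below \<open>\<epsilon> / K ^ k\<close>, where \<open>K\<close> bounds
  the weights in \<open>G\<close>. Only finitely many tuples qualify, and each of them eventually leaves \<open>B n\<close> or
  has product 0.
\<close>
lemma tuple_sup_tendsto_0:
  assumes fin: "\<And>\<epsilon>. 0 < \<epsilon> \<Longrightarrow> finite {j. ennreal \<epsilon> < w j \<and> t j \<in> G}"
    and w: "\<And>j. w j < \<infinity>"
    and ev: "\<And>j. j \<in> distinct_indices k \<Longrightarrow>
      eventually (\<lambda>n. (\<lambda>r\<in>{..<k}. t (j r)) \<notin> B n) sequentially \<or> (\<exists>r<k. t (j r) \<notin> G \<or> w (j r) = 0)"
  shows "(\<lambda>n. tuple_sup w t k (B n \<inter> cube G k)) \<longlonglongrightarrow> 0"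
proof (rule tendsto_zero_ennreal)
  fix e :: real assume e: "0 < e"
  obtain K where K: "1 \<le> K" "\<And>j. t j \<in> G \<Longrightarrow> w j \<le> ennreal K"
  proof -
    let ?J = "{j. ennreal 1 < w j \<and> t j \<in> G}"
    let ?K = "1 + (\<Sum>j\<in>?J. enn2real (w j))"
    have fJ: "finite ?J" by (rule fin) simp
    have "w j \<le> ennreal ?K" if "t j \<in> G" for j
    proof (cases "ennreal 1 < w j")
      case True
      then have "enn2real (w j) \<le> (\<Sum>j\<in>?J. enn2real (w j))"
        using fJ that by (intro member_le_sum) auto
      then have "ennreal (enn2real (w j)) \<le> ennreal ?K" by (intro ennreal_leI) simp
      then show ?thesis using w[of j] by simp
    next
      case False
      then have "w j \<le> ennreal 1" by simp
      also have "\<dots> \<le> ennreal ?K" by (intro ennreal_leI) (simp add: sum_nonneg)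
      finally show ?thesis .
    qed
    then show thesis by (intro that[of ?K]) (simp_all add: sum_nonneg)
  qed
  \<comment> \<open>The bound by \<open>\<epsilon>\<close> below is not strict, the one by \<open>e\<close> has to be.\<close>
  define \<epsilon> where "\<epsilon> = e / 2"
  have \<epsilon>: "0 < \<epsilon>" using e by (simp add: \<epsilon>_def)
  define \<delta> where "\<delta> = \<epsilon> / K ^ k"
  have \<delta>: "0 < \<delta>" using \<epsilon> K(1) by (simp add: \<delta>_def)
  define J where "J = {j. ennreal \<delta> < w j \<and> t j \<in> G}"
  have J: "finite J" unfolding J_def by (rule fin[OF \<delta>])
  define \<Theta> where "\<Theta> = {j \<in> distinct_indices k. \<forall>r<k. j r \<in> J}"
  have "\<Theta> \<subseteq> {..<k} \<rightarrow>\<^sub>E J" unfolding \<Theta>_def distinct_indices_def PiE_def by blast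
  then have "finite \<Theta>" by (rule finite_subset) (simp add: J finite_PiE)
  then have "eventually (\<lambda>n. \<forall>j\<in>\<Theta>. (\<lambda>r\<in>{..<k}. t (j r)) \<notin> B n \<or> (\<exists>r<k. t (j r) \<notin> G \<or> w (j r) = 0)) sequentially"
  proof (intro eventually_ball_finite ballI)
    fix j assume "j \<in> \<Theta>"
    then have "j \<in> distinct_indices k" by (simp add: \<Theta>_def)
    from ev[OF this] show "eventually (\<lambda>n. (\<lambda>r\<in>{..<k}. t (j r)) \<notin> B n \<or> (\<exists>r<k. t (j r) \<notin> G \<or> w (j r) = 0)) sequentially"
    proof
      assume "eventually (\<lambda>n. (\<lambda>r\<in>{..<k}. t (j r)) \<notin> B n) sequentially"
      then show ?thesis by (rule eventually_mono) blast
    next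
      assume "\<exists>r<k. t (j r) \<notin> G \<or> w (j r) = 0"
      then show ?thesis by (intro always_eventually allI disjI2)
    qed
  qed
  then show "eventually (\<lambda>n. tuple_sup w t k (B n \<inter> cube G k) < ennreal e) sequentially"
  proof eventually_elim
    case (elim n)
    have "tuple_sup w t k (B n \<inter> cube G k) \<le> ennreal \<epsilon>"
      unfolding tuple_sup_def
    proof (rule SUP_least)
      fix j assume j: "j \<in> distinct_indices k"
      let ?T = "\<lambda>r\<in>{..<k}. t (j r)"
      show "(\<Prod>r<k. w (j r)) * indicator (B n \<inter> cube G k) ?T \<le> ennreal \<epsilon>"
      proof (cases "?T \<in> B n \<inter> cube G k")
        case True
        then have G: "t (j r) \<in> G" if "r < k" for r using that by (auto dest!: PiE_mem[of _ _ _ r])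
        have le: "w (j r) \<le> ennreal K" if "r < k" for r using K(2) G that by blast
        have "(\<Prod>r<k. w (j r)) \<le> ennreal \<epsilon>"
        proof (cases "j \<in> \<Theta>")
          case True
          then obtain r where "r < k" "w (j r) = 0" using bspec[OF elim True] \<open>?T \<in> _\<close> G by blast
          then have z: "(\<Prod>r<k. w (j r)) = 0" by (intro prod_zero bexI[of _ r]) simp_all
          show ?thesis unfolding z by simp
        next
          case False
          then obtain r where r: "r < k" "j r \<notin> J" using j by (auto simp: \<Theta>_def)
          then have "w (j r) \<le> ennreal \<delta>" using G[of r] by (auto simp: J_def not_less)
          moreover have "(\<Prod>s\<in>{..<k} - {r}. w (j s)) \<le> (\<Prod>s\<in>{..<k} - {r}. ennreal K)"
            using le by (intro prod_mono_ennreal) auto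
          ultimately have "w (j r) * (\<Prod>s\<in>{..<k} - {r}. w (j s)) \<le> ennreal \<delta> * (\<Prod>s\<in>{..<k} - {r}. ennreal K)"
            by (intro mult_mono) auto
          also have "\<dots> = ennreal (\<delta> * K ^ (k - 1))"
            using r(1) K(1) \<delta> by (simp add: ennreal_mult' ennreal_power)
          also have "\<dots> \<le> ennreal (\<delta> * K ^ k)"
            using K(1) \<delta> by (intro ennreal_leI mult_left_mono power_increasing) auto
          also have "\<delta> * K ^ k = \<epsilon>" using K(1) by (simp add: \<delta>_def)
          finally show ?thesis using r(1) by (subst prod.remove[of _ r]) auto
        qed
        then show ?thesis using True by simp
      qed simp
    qed
    also have "\<dots> < ennreal e" using e by (simp add: \<epsilon>_def ennreal_less_iff)
    finally show ?case .
  qed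
qed

lemma tendsto_ennreal_max_squeeze:
  fixes X :: "nat \<Rightarrow> ennreal"
  assumes d: "d \<longlonglongrightarrow> 0" and "\<And>n. X n \<le> max x (d n)" "\<And>n. x \<le> max (X n) (d n)"
  shows "X \<longlonglongrightarrow> x"
proof (cases "x = 0")
  case True
  then have "X n \<le> d n" for n using assms(2)[of n] by (simp add: max_def split: if_splits)
  then have "X \<longlonglongrightarrow> 0" by (intro tendsto_sandwich[OF _ _ tendsto_const d]) auto
  then show ?thesis using True by simp
next
  case False
  then have "0 < x" by (simp add: zero_less_iff_neq_zero)
  from order_tendstoD(2)[OF d this] have "eventually (\<lambda>n. X n = x) sequentially"
  proof eventually_elim
    case (elim n)
    show ?case using assms(2,3)[of n] elim by (auto simp: max_def split: if_splits)
  qed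
  then show ?thesis by (rule tendsto_eventually)
qed

text \<open>
  A supremum over \<open>A n\<close> exceeds the supremum over \<open>A'\<close> only if it is attained in the symmetric difference,
  and conversely; so the two agree eventually, unless both tend to 0.
\<close>
lemma tuple_sup_tendsto:
  assumes "(\<lambda>n. tuple_sup w t k (((A n - A') \<union> (A' - A n)) \<inter> U)) \<longlonglongrightarrow> 0"
  shows "(\<lambda>n. tuple_sup w t k (A n \<inter> U)) \<longlonglongrightarrow> tuple_sup w t k (A' \<inter> U)"
proof (rule tendsto_ennreal_max_squeeze[OF assms])
  fix n
  have *: "tuple_sup w t k C \<le> max (tuple_sup w t k D) (tuple_sup w t k F)" if "C \<subseteq> D \<union> F" for C D F
    using tuple_sup_mono[OF that] by (simp add: tuple_sup_Un)
  show "tuple_sup w t k (A n \<inter> U) \<le> max (tuple_sup w t k (A' \<inter> U)) (tuple_sup w t k (((A n - A') \<union> (A' - A n)) \<inter> U))"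
    by (rule *) auto
  show "tuple_sup w t k (A' \<inter> U) \<le> max (tuple_sup w t k (A n \<inter> U)) (tuple_sup w t k (((A n - A') \<union> (A' - A n)) \<inter> U))"
    by (rule *) auto
qed

text \<open>
  The \<open>r\<close>-th smallest element of \<open>J\<close> is at least \<open>r\<close>; the induction removes the largest element.
\<close>
lemma prod_le_prod_initial:
  fixes q :: "nat \<Rightarrow> ennreal"
  assumes q: "antimono q" and "finite J" "card J = k"
  shows "prod q J \<le> (\<Prod>i<k. q i)"
  using assms(2,3)
proof (induction k arbitrary: J)
  case (Suc k)
  have ne: "J \<noteq> {}" using Suc.prems(2) by auto
  define M where "M = Max J"
  have M: "M \<in> J" unfolding M_def using Suc.prems ne by (intro Max_in) auto
  have "J \<subseteq> {..M}" unfolding M_def using Suc.prems by auto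
  then have "Suc k \<le> Suc M" using card_mono[of "{..M}" J] Suc.prems by simp
  then have "q M \<le> q k" using q by (auto simp: antimono_def)
  moreover have "prod q (J - {M}) \<le> (\<Prod>i<k. q i)" using Suc.prems M by (intro Suc.IH) auto
  ultimately have "q M * prod q (J - {M}) \<le> q k * (\<Prod>i<k. q i)" by (intro mult_mono) auto
  then show ?case using M Suc.prems by (simp add: prod.remove mult.commute)
qed simp

lemma tuple_sup_le_prod_initial:
  assumes "antimono w"
  shows "tuple_sup w t k A \<le> (\<Prod>i<k. w i)"
  unfolding tuple_sup_def
proof (rule SUP_least)
  fix j assume j: "j \<in> distinct_indices k"
  then have inj: "inj_on j {..<k}" by (simp add: distinct_indices_def)
  have "(\<Prod>r<k. w (j r)) * indicator A (\<lambda>r\<in>{..<k}. t (j r)) \<le> (\<Prod>r<k. w (j r)) * 1"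
    by (intro mult_left_mono) (auto split: split_indicator)
  also have "\<dots> = prod w (j ` {..<k})" using inj by (simp add: prod.reindex)
  also have "\<dots> \<le> (\<Prod>i<k. w i)"
    using inj by (intro prod_le_prod_initial[OF assms]) (auto simp: card_image)
  finally show "(\<Prod>r<k. w (j r)) * indicator A (\<lambda>r\<in>{..<k}. t (j r)) \<le> (\<Prod>i<k. w i)" .
qed

section \<open>The LePage series on the canonical space\<close>

definition weight :: "real \<Rightarrow> ('a \<Rightarrow> ennreal) \<Rightarrow> (nat \<Rightarrow> real) \<times> (nat \<Rightarrow> 'a) \<Rightarrow> nat \<Rightarrow> ennreal" where
  "weight \<alpha> \<psi> c j =
     ennreal (arrival (fst c) j powr (- 1 / \<alpha>) * enn2real (\<psi> (snd c j)) powr (1 / \<alpha>))"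

text \<open>
  The LePage series of arbitrary data is the canonical one, evaluated at the gaps and marks of the data.
\<close>
lemma LePage_series_eq_tuple_sup:
  "LePage_series \<alpha> \<psi> \<Gamma> T k A \<omega> =
     tuple_sup (weight \<alpha> \<psi> (\<lambda>i. gap \<Gamma> i \<omega>, \<lambda>i. T i \<omega>)) (\<lambda>i. T i \<omega>) k A"
  unfolding LePage_series_def tuple_sup_def weight_def
  by (simp add: arrival_gap prod_ennreal)

lemma canon_snd:
  assumes "prob_space m"
  shows "distr (canon m) (Pi\<^sub>M UNIV (\<lambda>_. m)) snd = Pi\<^sub>M UNIV (\<lambda>_. m)"
proof (rule measure_eqI)
  interpret G: prob_space "Pi\<^sub>M UNIV (\<lambda>_::nat. exp_law)" by (intro prob_space_PiM prob_space_exp_law)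
  interpret S: prob_space "Pi\<^sub>M UNIV (\<lambda>_::nat. m)" by (intro prob_space_PiM assms)
  fix A assume "A \<in> sets (distr (canon m) (Pi\<^sub>M UNIV (\<lambda>_. m)) snd)"
  then have A: "A \<in> sets (Pi\<^sub>M UNIV (\<lambda>_::nat. m))" by simp
  have "snd -` A \<inter> space (canon m) = space (Pi\<^sub>M UNIV (\<lambda>_::nat. exp_law)) \<times> A"
    using sets.sets_into_space[OF A] by (auto simp: canon_def space_pair_measure)
  then have "emeasure (distr (canon m) (Pi\<^sub>M UNIV (\<lambda>_. m)) snd) A = emeasure (canon m) (space (Pi\<^sub>M UNIV (\<lambda>_::nat. exp_law)) \<times> A)"
    using A by (subst emeasure_distr) (auto simp: canon_def)
  also have "\<dots> = emeasure (Pi\<^sub>M UNIV (\<lambda>_::nat. m)) A"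
    unfolding canon_def using A by (subst S.emeasure_pair_measure_Times) (auto simp: G.emeasure_space_1)
  finally show "emeasure (distr (canon m) (Pi\<^sub>M UNIV (\<lambda>_. m)) snd) A = emeasure (Pi\<^sub>M UNIV (\<lambda>_. m)) A" .
qed simp

lemma canon_tuple_measurable [measurable]:
  "(\<lambda>c. \<lambda>r\<in>{..<k}. snd c (j r)) \<in> canon m \<rightarrow>\<^sub>M power_measure m k"
  by (intro measurable_restrict) measurable

lemma canon_tuple_distr:
  assumes m: "prob_space m" and j: "inj_on j {..<k}"
  shows "distr (canon m) (power_measure m k) (\<lambda>c. \<lambda>r\<in>{..<k}. snd c (j r)) = power_measure m k"
proof -
  have "power_measure m k = distr (Pi\<^sub>M UNIV (\<lambda>_::nat. m)) (power_measure m k) (\<lambda>t. \<lambda>r\<in>{..<k}. t (j r))"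
    using distr_PiM_reindex[of UNIV "\<lambda>_. m" j "{..<k}"] m j by simp
  also have "\<dots> = distr (distr (canon m) (Pi\<^sub>M UNIV (\<lambda>_::nat. m)) snd) (power_measure m k) (\<lambda>t. \<lambda>r\<in>{..<k}. t (j r))"
    by (simp only: canon_snd[OF m])
  also have "\<dots> = distr (canon m) (power_measure m k) (\<lambda>c. \<lambda>r\<in>{..<k}. snd c (j r))"
    by (subst distr_distr) (auto simp: canon_def comp_def)
  finally show ?thesis by simp
qed

lemma AE_canon_marks:
  assumes m: "prob_space m" and ae: "AE x in m. R x"
  shows "AE c in canon m. \<forall>j. R (snd c j)"
proof -
  have "AE t in Pi\<^sub>M UNIV (\<lambda>_::nat. m). \<forall>j. R (t j)"
    unfolding AE_all_countable by (intro allI AE_PiM_component m ae) simp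
  then have "AE t in distr (canon m) (Pi\<^sub>M UNIV (\<lambda>_. m)) snd. \<forall>j. R (t j)"
    by (simp only: canon_snd[OF m])
  then show ?thesis by (rule AE_distrD[rotated]) (simp add: canon_def)
qed

lemma power_measure_density:
  assumes m: "prob_space m" and [measurable]: "f \<in> borel_measurable m"
    and fin: "finite_measure (density m f)"
  shows "power_measure (density m f) k = density (power_measure m k) (\<lambda>x. \<Prod>r<k. f (x r))"
proof -
  interpret m: prob_space m by fact
  interpret d: finite_measure "density m f" by fact
  interpret pm: product_sigma_finite "\<lambda>_::nat. m" ..
  interpret pd: product_sigma_finite "\<lambda>_::nat. density m f" ..
  have "density (power_measure m k) (\<lambda>x. \<Prod>r<k. f (x r)) = power_measure (density m f) k"
  proof (rule pd.PiM_eqI)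
    show "sets (density (power_measure m k) (\<lambda>x. \<Prod>r<k. f (x r))) = sets (power_measure (density m f) k)"
      by (simp cong: sets_PiM_cong)
    fix A assume "\<And>i. i \<in> {..<k} \<Longrightarrow> A i \<in> sets (density m f)"
    then have A: "\<And>i. i < k \<Longrightarrow> A i \<in> sets m" by simp
    then have "Pi\<^sub>E {..<k} A \<in> sets (power_measure m k)" by (intro sets_PiM_I_finite) auto
    then have "emeasure (density (power_measure m k) (\<lambda>x. \<Prod>r<k. f (x r))) (Pi\<^sub>E {..<k} A) =
        (\<integral>\<^sup>+x. (\<Prod>r<k. f (x r)) * indicator (Pi\<^sub>E {..<k} A) x \<partial>power_measure m k)"
      by (subst emeasure_density) auto
    also have "\<dots> = (\<integral>\<^sup>+x. (\<Prod>r<k. f (x r) * indicator (A r) (x r)) \<partial>power_measure m k)"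
    proof (intro nn_integral_cong)
      fix x assume "x \<in> space (power_measure m k)"
      then have "x = (\<lambda>r\<in>{..<k}. x (id r))" by (auto simp: space_PiM PiE_iff extensional_def)
      then have "indicator (Pi\<^sub>E {..<k} A) x = (\<Prod>r<k. indicator (A r) (x r) :: ennreal)"
        using indicator_PiE_marks[of k A x id] by simp
      then show "(\<Prod>r<k. f (x r)) * indicator (Pi\<^sub>E {..<k} A) x = (\<Prod>r<k. f (x r) * indicator (A r) (x r))"
        by (simp add: prod.distrib)
    qed
    also have "\<dots> = (\<Prod>r<k. \<integral>\<^sup>+y. f y * indicator (A r) y \<partial>m)"
      using A by (intro pm.product_nn_integral_prod) auto
    also have "\<dots> = (\<Prod>r<k. emeasure (density m f) (A r))"
      using A by (intro prod.cong refl) (simp add: emeasure_density)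
    finally show "emeasure (density (power_measure m k) (\<lambda>x. \<Prod>r<k. f (x r))) (Pi\<^sub>E {..<k} A) = (\<Prod>r<k. emeasure (density m f) (A r))" .
  qed simp
  then show ?thesis by simp
qed

lemma exp_neg_0 [simp]: "exp_neg 0 = 1"
  by (simp add: exp_neg_def)

lemma exp_neg_add: "exp_neg (a + b) = exp_neg a * exp_neg b"
  by (cases a; cases b) (auto simp: exp_neg_def ennreal_mult'[symmetric] exp_add[symmetric] ennreal_plus[symmetric] simp del: ennreal_plus)

lemma exp_neg_sum: "exp_neg (\<Sum>i\<in>I. f i) = (\<Prod>i\<in>I. exp_neg (f i))"
  by (induction I rule: infinite_finite_induct) (simp_all add: exp_neg_add)

text \<open>
  A weight is at most \<open>x\<close> iff the point does not lie below the graph of \<open>\<psi> x\<^bsup>-\<alpha>\<^esup>\<close>. With this, bounds on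
  suprema of weights become void events of the Poisson process.
\<close>
lemma weight_le_iff:
  fixes g p x \<alpha> :: real
  assumes "0 < \<alpha>" "0 < g" "0 \<le> p" "0 < x"
  shows "g powr (- 1 / \<alpha>) * p powr (1 / \<alpha>) \<le> x \<longleftrightarrow> p * x powr (- \<alpha>) \<le> g"
proof -
  have "g powr (- 1 / \<alpha>) * p powr (1 / \<alpha>) = (p / g) powr (1 / \<alpha>)"
    using assms by (simp add: powr_divide powr_minus_divide)
  moreover have "x = (x powr \<alpha>) powr (1 / \<alpha>)" using assms by (simp add: powr_powr)
  moreover have "(p / g) powr (1 / \<alpha>) \<le> (x powr \<alpha>) powr (1 / \<alpha>) \<longleftrightarrow> p / g \<le> x powr \<alpha>"
  proof
    assume *: "(p / g) powr (1 / \<alpha>) \<le> (x powr \<alpha>) powr (1 / \<alpha>)"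
    show "p / g \<le> x powr \<alpha>"
    proof (rule ccontr)
      assume "\<not> p / g \<le> x powr \<alpha>"
      then have "(x powr \<alpha>) powr (1 / \<alpha>) < (p / g) powr (1 / \<alpha>)"
        using assms by (intro powr_less_mono2) auto
      then show False using * by simp
    qed
  next
    assume "p / g \<le> x powr \<alpha>"
    then show "(p / g) powr (1 / \<alpha>) \<le> (x powr \<alpha>) powr (1 / \<alpha>)"
      using assms by (intro powr_mono2) auto
  qed
  moreover have "p / g \<le> x powr \<alpha> \<longleftrightarrow> p * x powr (- \<alpha>) \<le> g"
    using assms by (simp add: powr_minus_divide field_simps)
  ultimately show ?thesis by metis
qed

text \<open>The density \<open>\<psi>\<close> may vanish; points with \<open>\<psi>(T\<^sub>j) = 0\<close> have weight 0.\<close>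
locale lepage =
  fixes \<alpha> :: real and \<mu> m :: "'a measure" and \<psi> :: "'a \<Rightarrow> ennreal"
  assumes alpha: "0 < \<alpha>" and m: "prob_space m"
    and psi [measurable]: "\<psi> \<in> borel_measurable m" and mu: "\<mu> = density m \<psi>"
    and psi_finite: "AE x in m. \<psi> x < \<infinity>"
begin

lemma sets_mu [simp]: "sets \<mu> = sets m"
  by (simp add: mu)

lemma emeasure_mu: "A \<in> sets m \<Longrightarrow> emeasure \<mu> A = (\<integral>\<^sup>+x. \<psi> x * indicator A x \<partial>m)"
  by (simp add: mu emeasure_density)

abbreviation W1 :: "'a set \<Rightarrow> (nat \<Rightarrow> real) \<times> (nat \<Rightarrow> 'a) \<Rightarrow> ennreal" where
  "W1 A c \<equiv> point_sup (weight \<alpha> \<psi> c) (snd c) A"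

abbreviation W :: "nat \<Rightarrow> (nat \<Rightarrow> 'a) set \<Rightarrow> (nat \<Rightarrow> real) \<times> (nat \<Rightarrow> 'a) \<Rightarrow> ennreal" where
  "W k A c \<equiv> tuple_sup (weight \<alpha> \<psi> c) (snd c) k A"

lemma weight_measurable [measurable]: "(\<lambda>c. weight \<alpha> \<psi> c j) \<in> borel_measurable (canon m)"
  unfolding weight_def by measurable

lemma W1_measurable [measurable]:
  assumes A: "A \<in> sets m"
  shows "W1 A \<in> borel_measurable (canon m)"
  unfolding point_sup_def
proof (intro borel_measurable_SUP borel_measurable_times_ennreal weight_measurable)
  fix j
  show "(\<lambda>c. indicator A (snd c j) :: ennreal) \<in> borel_measurable (canon m)"
    using measurable_compose[OF mark_canon_measurable borel_measurable_indicator[OF A]] .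
qed simp

lemma W_measurable [measurable]:
  assumes A: "A \<in> sets (power_measure m k)"
  shows "W k A \<in> borel_measurable (canon m)"
  unfolding tuple_sup_def
proof (intro borel_measurable_SUP countable_distinct_indices borel_measurable_times_ennreal borel_measurable_prod_ennreal weight_measurable)
  fix j
  show "(\<lambda>c. indicator A (\<lambda>r\<in>{..<k}. snd c (j r)) :: ennreal) \<in> borel_measurable (canon m)"
    using measurable_compose[OF canon_tuple_measurable borel_measurable_indicator[OF A]] .
qed

lemma AE_weight_le_iff:
  "AE c in canon m. \<forall>j x. 0 < x \<longrightarrow>
     (weight \<alpha> \<psi> c j \<le> ennreal x \<longleftrightarrow> \<psi> (snd c j) * ennreal (x powr (- \<alpha>)) \<le> ennreal (arrival (fst c) j))"
  using AE_canon_gaps_pos[OF m] AE_canon_marks[OF m psi_finite]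
proof eventually_elim
  case (elim c)
  show ?case
  proof (intro allI impI)
    fix j and x :: real assume x: "0 < x"
    have g: "0 < arrival (fst c) j" using elim(1) by (rule arrival_pos)
    define p where "p = enn2real (\<psi> (snd c j))"
    have p: "\<psi> (snd c j) = ennreal p" "0 \<le> p" using elim(2) by (auto simp: p_def)
    have "weight \<alpha> \<psi> c j \<le> ennreal x \<longleftrightarrow> arrival (fst c) j powr (- 1 / \<alpha>) * p powr (1 / \<alpha>) \<le> x"
      unfolding weight_def p_def[symmetric] using x by (simp add: ennreal_le_iff)
    also have "\<dots> \<longleftrightarrow> p * x powr (- \<alpha>) \<le> arrival (fst c) j"
      using alpha g p(2) x by (rule weight_le_iff)
    also have "\<dots> \<longleftrightarrow> \<psi> (snd c j) * ennreal (x powr (- \<alpha>)) \<le> ennreal (arrival (fst c) j)"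
      using g p by (simp add: ennreal_mult'[symmetric] ennreal_le_iff)
    finally show "weight \<alpha> \<psi> c j \<le> ennreal x \<longleftrightarrow> \<psi> (snd c j) * ennreal (x powr (- \<alpha>)) \<le> ennreal (arrival (fst c) j)" .
  qed
qed

text \<open>
  The bounds on the disjoint sets \<open>A i\<close> say that no point lies below the graph of the function \<open>h\<close> that
  equals \<open>\<psi> x\<^sub>i\<^bsup>-\<alpha>\<^esup>\<close> on \<open>A i\<close> and 0 elsewhere.
\<close>
lemma W1_joint_cdf:
  fixes A :: "nat \<Rightarrow> 'a set" and x :: "nat \<Rightarrow> real"
  assumes A: "\<forall>i<n. A i \<in> sets m" and disj: "disjoint_family_on A {..<n}" and x: "\<forall>i<n. 0 < x i"
  shows "emeasure (canon m) {c \<in> space (canon m). \<forall>i<n. W1 (A i) c \<le> ennreal (x i)} =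
    (\<Prod>i<n. exp_neg (emeasure \<mu> (A i) * ennreal (x i powr (- \<alpha>))))"
proof -
  define h where "h a = (\<Sum>i<n. \<psi> a * indicator (A i) a * ennreal (x i powr (- \<alpha>)))" for a
  have h[measurable]: "h \<in> borel_measurable m"
    unfolding h_def using A by (intro borel_measurable_sum) auto
  have h_in: "h a = \<psi> a * ennreal (x i powr (- \<alpha>))" if "i < n" "a \<in> A i" for i a
  proof -
    have "h a = (\<Sum>l<n. if l = i then \<psi> a * ennreal (x i powr (- \<alpha>)) else 0)"
      unfolding h_def
    proof (intro sum.cong refl)
      fix l assume l: "l \<in> {..<n}"
      show "\<psi> a * indicator (A l) a * ennreal (x l powr (- \<alpha>)) = (if l = i then \<psi> a * ennreal (x i powr (- \<alpha>)) else 0)"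
      proof (cases "l = i")
        case False
        then have "A l \<inter> A i = {}" using disjoint_family_onD[OF disj l] that(1) by simp
        then have "a \<notin> A l" using that(2) by blast
        then show ?thesis using False by simp
      qed (use that in simp)
    qed
    also have "\<dots> = \<psi> a * ennreal (x i powr (- \<alpha>))" using that(1) by simp
    finally show ?thesis .
  qed
  have h_out: "h a = 0" if "\<And>i. i < n \<Longrightarrow> a \<notin> A i" for a
    unfolding h_def using that by (intro sum.neutral) simp
  have "emeasure (canon m) {c \<in> space (canon m). \<forall>i<n. W1 (A i) c \<le> ennreal (x i)} =
      emeasure (canon m) {c \<in> space (canon m). \<forall>j. h (snd c j) \<le> ennreal (arrival (fst c) j)}"
  proof (rule emeasure_eq_AE)
    show "AE c in canon m. (c \<in> {c \<in> space (canon m). \<forall>i<n. W1 (A i) c \<le> ennreal (x i)}) =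
       (c \<in> {c \<in> space (canon m). \<forall>j. h (snd c j) \<le> ennreal (arrival (fst c) j)})"
      using AE_weight_le_iff
    proof eventually_elim
      case (elim c)
      have "(\<forall>i<n. W1 (A i) c \<le> ennreal (x i)) \<longleftrightarrow> (\<forall>j. \<forall>i<n. snd c j \<in> A i \<longrightarrow> weight \<alpha> \<psi> c j \<le> ennreal (x i))"
        unfolding point_sup_def SUP_le_iff by (auto split: split_indicator)
      also have "\<dots> \<longleftrightarrow> (\<forall>j. \<forall>i<n. snd c j \<in> A i \<longrightarrow> \<psi> (snd c j) * ennreal (x i powr (- \<alpha>)) \<le> ennreal (arrival (fst c) j))"
        using elim x by blast
      also have "\<dots> \<longleftrightarrow> (\<forall>j. h (snd c j) \<le> ennreal (arrival (fst c) j))"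
      proof (intro iff_allI)
        fix j
        show "(\<forall>i<n. snd c j \<in> A i \<longrightarrow> \<psi> (snd c j) * ennreal (x i powr (- \<alpha>)) \<le> ennreal (arrival (fst c) j)) \<longleftrightarrow>
          h (snd c j) \<le> ennreal (arrival (fst c) j)"
        proof (cases "\<exists>i<n. snd c j \<in> A i")
          case True
          then obtain i where i: "i < n" "snd c j \<in> A i" by blast
          have uniq: "l = i" if "l < n" "snd c j \<in> A l" for l
          proof (rule ccontr)
            assume "l \<noteq> i"
            then have "A l \<inter> A i = {}" using disjoint_family_onD[OF disj] that(1) i(1) by simp
            then show False using that(2) i(2) by blast
          qed
          show ?thesis
            unfolding h_in[OF i]
          proof
            assume "\<forall>i<n. snd c j \<in> A i \<longrightarrow> \<psi> (snd c j) * ennreal (x i powr (- \<alpha>)) \<le> ennreal (arrival (fst c) j)"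
            then show "\<psi> (snd c j) * ennreal (x i powr (- \<alpha>)) \<le> ennreal (arrival (fst c) j)" using i by blast
          next
            assume le: "\<psi> (snd c j) * ennreal (x i powr (- \<alpha>)) \<le> ennreal (arrival (fst c) j)"
            show "\<forall>i<n. snd c j \<in> A i \<longrightarrow> \<psi> (snd c j) * ennreal (x i powr (- \<alpha>)) \<le> ennreal (arrival (fst c) j)"
            proof (intro allI impI)
              fix l assume "l < n" "snd c j \<in> A l"
              then have "l = i" by (rule uniq)
              then show "\<psi> (snd c j) * ennreal (x l powr (- \<alpha>)) \<le> ennreal (arrival (fst c) j)" using le by simp
            qed
          qed
        next
          case False
          then show ?thesis using h_out[of "snd c j"] by auto
        qed
      qed
      finally show ?case by simp
    qed
    have "{c \<in> space (canon m). \<forall>i\<in>{..<n}. W1 (A i) c \<le> ennreal (x i)} \<in> sets (canon m)"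
      using A by (intro sets.sets_Collect_finite_All) auto
    also have "{c \<in> space (canon m). \<forall>i\<in>{..<n}. W1 (A i) c \<le> ennreal (x i)} = {c \<in> space (canon m). \<forall>i<n. W1 (A i) c \<le> ennreal (x i)}"
      by auto
    finally show "{c \<in> space (canon m). \<forall>i<n. W1 (A i) c \<le> ennreal (x i)} \<in> sets (canon m)" .
    show "{c \<in> space (canon m). \<forall>j. h (snd c j) \<le> ennreal (arrival (fst c) j)} \<in> sets (canon m)"
      by measurable
  qed
  also have "\<dots> = exp_neg (\<integral>\<^sup>+a. h a \<partial>m)"
    by (rule poisson_void_probability[OF m h])
  also have "(\<integral>\<^sup>+a. h a \<partial>m) = (\<Sum>i<n. emeasure \<mu> (A i) * ennreal (x i powr (- \<alpha>)))"
  proof -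
    have "(\<integral>\<^sup>+a. h a \<partial>m) = (\<Sum>i<n. \<integral>\<^sup>+a. \<psi> a * indicator (A i) a * ennreal (x i powr (- \<alpha>)) \<partial>m)"
      unfolding h_def using A by (intro nn_integral_sum) auto
    also have "\<dots> = (\<Sum>i<n. emeasure \<mu> (A i) * ennreal (x i powr (- \<alpha>)))"
    proof (intro sum.cong refl)
      fix i assume "i \<in> {..<n}"
      then have Ai[measurable]: "A i \<in> sets m" using A by simp
      have "(\<integral>\<^sup>+a. \<psi> a * indicator (A i) a * ennreal (x i powr (- \<alpha>)) \<partial>m) = (\<integral>\<^sup>+a. \<psi> a * indicator (A i) a \<partial>m) * ennreal (x i powr (- \<alpha>))"
        by (rule nn_integral_multc) measurable
      then show "(\<integral>\<^sup>+a. \<psi> a * indicator (A i) a * ennreal (x i powr (- \<alpha>)) \<partial>m) = emeasure \<mu> (A i) * ennreal (x i powr (- \<alpha>))"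
        by (simp only: emeasure_mu[OF Ai])
    qed
    finally show ?thesis .
  qed
  also have "exp_neg \<dots> = (\<Prod>i<n. exp_neg (emeasure \<mu> (A i) * ennreal (x i powr (- \<alpha>))))"
    by (rule exp_neg_sum)
  finally show ?thesis .
qed

lemma W1_frechet_family: "frechet_family (canon m) \<alpha> \<mu> W1"
  unfolding frechet_family_def sets_mu
  by (intro conjI allI impI ballI prob_space_canon m W1_measurable W1_joint_cdf)
     (simp_all add: point_sup_UN)

lemma AE_weight_finite:
  assumes G: "G \<in> sets m" and fin: "emeasure \<mu> G < \<infinity>"
  shows "AE c in canon m. \<forall>\<epsilon>>0. finite {j. ennreal \<epsilon> < weight \<alpha> \<psi> c j \<and> snd c j \<in> G}"
proof -
  have "AE c in canon m. finite {j. ennreal (1 / real (Suc n)) < weight \<alpha> \<psi> c j \<and> snd c j \<in> G}" for n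
  proof -
    define x where "x = 1 / real (Suc n)"
    have x: "0 < x" by (simp add: x_def)
    define h where "h a = \<psi> a * indicator G a * ennreal (x powr (- \<alpha>))" for a
    have h[measurable]: "h \<in> borel_measurable m" unfolding h_def using G by measurable
    have "(\<integral>\<^sup>+a. h a \<partial>m) = emeasure \<mu> G * ennreal (x powr (- \<alpha>))"
      unfolding h_def emeasure_mu[OF G] by (rule nn_integral_multc) (use G in measurable)
    also have "\<dots> < \<infinity>" using fin by (simp add: ennreal_mult_less_top)
    finally have "AE c in canon m. finite {j. ennreal (arrival (fst c) j) < h (snd c j)}"
      by (intro AE_finitely_many_points m h)
    then show ?thesis
      using AE_weight_le_iff
    proof eventually_elim
      case (elim c)
      have "{j. ennreal x < weight \<alpha> \<psi> c j \<and> snd c j \<in> G} \<subseteq> {j. ennreal (arrival (fst c) j) < h (snd c j)}"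
        using elim(2) x by (auto simp: h_def not_le[symmetric])
      then show ?case using elim(1) unfolding x_def by (rule finite_subset)
    qed
  qed
  then have "AE c in canon m. \<forall>n. finite {j. ennreal (1 / real (Suc n)) < weight \<alpha> \<psi> c j \<and> snd c j \<in> G}"
    unfolding AE_all_countable by blast
  then show ?thesis
  proof eventually_elim
    case (elim c)
    show ?case
    proof (intro allI impI)
      fix \<epsilon> :: real assume "0 < \<epsilon>"
      then obtain n where "1 / real (Suc n) < \<epsilon>" by (metis nat_approx_posE)
      then have "ennreal (1 / real (Suc n)) \<le> ennreal \<epsilon>" by (intro ennreal_leI) simp
      then have "{j. ennreal \<epsilon> < weight \<alpha> \<psi> c j \<and> snd c j \<in> G} \<subseteq> {j. ennreal (1 / real (Suc n)) < weight \<alpha> \<psi> c j \<and> snd c j \<in> G}"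
        by (auto intro: le_less_trans)
      then show "finite {j. ennreal \<epsilon> < weight \<alpha> \<psi> c j \<and> snd c j \<in> G}"
        using elim by (blast intro: finite_subset)
    qed
  qed
qed

text \<open>
  The marks of a tuple of distinct points have law \<open>m\<^sup>k\<close>, while the sets \<open>B n\<close> are small for the power of
  \<open>\<mu>\<close> restricted to \<open>G\<close>. The latter has the density \<open>\<Prod>\<^bsub>r<k\<^esub> \<psi>(x\<^sub>r) 1\<^sub>G(x\<^sub>r)\<close> with respect to \<open>m\<^sup>k\<close>, so Borel-Cantelli
  applies to all tuples except those at which the density is 0, and these have a mark outside \<open>G\<close> or
  a weight 0.
\<close>
lemma AE_tuples_eventually_outside:
  assumes G: "G \<in> sets m" and fin: "emeasure \<mu> G < \<infinity>"
    and B: "\<And>n. B n \<in> sets (power_measure m k)"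
    and sum: "(\<Sum>n. emeasure (power_measure (density \<mu> (indicator G)) k) (B n)) < \<infinity>"
  shows "AE c in canon m. \<forall>j\<in>distinct_indices k.
     eventually (\<lambda>n. (\<lambda>r\<in>{..<k}. snd c (j r)) \<notin> B n) sequentially \<or> (\<exists>r<k. snd c (j r) \<notin> G \<or> weight \<alpha> \<psi> c (j r) = 0)"
proof -
  define f where "f a = \<psi> a * indicator G a" for a
  have f[measurable]: "f \<in> borel_measurable m" unfolding f_def using G by measurable
  have \<nu>: "density \<mu> (indicator G) = density m f"
    unfolding mu f_def using G by (subst density_density_eq) auto
  have "emeasure (density m f) (space (density m f)) = emeasure \<mu> G"
    using G by (subst emeasure_density) (auto simp: f_def emeasure_mu intro!: nn_integral_cong)
  then have "finite_measure (density m f)" using fin by (intro finite_measureI) simp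
  then have pd: "power_measure (density m f) k = density (power_measure m k) (\<lambda>x. \<Prod>r<k. f (x r))"
    by (intro power_measure_density m f)
  have "AE x in power_measure (density m f) k. eventually (\<lambda>n. x \<notin> B n) sequentially"
    using sum B by (intro borel_cantelli_AE_suminf) (auto simp: \<nu> cong: sets_PiM_cong)
  then have aem: "AE x in power_measure m k. 0 < (\<Prod>r<k. f (x r)) \<longrightarrow> eventually (\<lambda>n. x \<notin> B n) sequentially"
    unfolding pd by (subst (asm) AE_density) auto
  have ae: "AE c in canon m. 0 < (\<Prod>r<k. f ((\<lambda>r\<in>{..<k}. snd c (j r)) r)) \<longrightarrow>
      eventually (\<lambda>n. (\<lambda>r\<in>{..<k}. snd c (j r)) \<notin> B n) sequentially" if "j \<in> distinct_indices k" for j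
  proof -
    have inj: "inj_on j {..<k}" using that by (simp add: distinct_indices_def)
    have "AE x in distr (canon m) (power_measure m k) (\<lambda>c. \<lambda>r\<in>{..<k}. snd c (j r)).
        0 < (\<Prod>r<k. f (x r)) \<longrightarrow> eventually (\<lambda>n. x \<notin> B n) sequentially"
      using aem by (simp only: canon_tuple_distr[OF m inj])
    then show ?thesis by (rule AE_distrD[OF canon_tuple_measurable])
  qed
  have "AE c in canon m. \<forall>j\<in>distinct_indices k. 0 < (\<Prod>r<k. f ((\<lambda>r\<in>{..<k}. snd c (j r)) r)) \<longrightarrow>
      eventually (\<lambda>n. (\<lambda>r\<in>{..<k}. snd c (j r)) \<notin> B n) sequentially"
    using ae by (simp add: AE_ball_countable[OF countable_distinct_indices])
  then show ?thesis
  proof eventually_elim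
    case (elim c)
    show ?case
    proof
      fix j assume j: "j \<in> distinct_indices k"
      show "eventually (\<lambda>n. (\<lambda>r\<in>{..<k}. snd c (j r)) \<notin> B n) sequentially \<or> (\<exists>r<k. snd c (j r) \<notin> G \<or> weight \<alpha> \<psi> c (j r) = 0)"
      proof (cases "0 < (\<Prod>r<k. f ((\<lambda>r\<in>{..<k}. snd c (j r)) r))")
        case True
        then show ?thesis using elim j by blast
      next
        case False
        then obtain r where "r < k" "f (snd c (j r)) = 0" by (auto simp: zero_less_iff_neq_zero)
        then have "snd c (j r) \<notin> G \<or> \<psi> (snd c (j r)) = 0" by (auto simp: f_def split: split_indicator_asm)
        then have "snd c (j r) \<notin> G \<or> weight \<alpha> \<psi> c (j r) = 0" by (auto simp: weight_def)
        then show ?thesis using \<open>r < k\<close> by blast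
      qed
    qed
  qed
qed

theorem AE_W_tendsto:
  assumes G: "G \<in> sets m" and fin: "emeasure \<mu> G < \<infinity>"
    and A: "\<And>n. A n \<in> sets (power_measure m k)" and A': "A' \<in> sets (power_measure m k)"
    and sum: "(\<Sum>n. emeasure (power_measure (density \<mu> (indicator G)) k) ((A n - A') \<union> (A' - A n))) < \<infinity>"
  shows "AE c in canon m. (\<lambda>n. W k (A n \<inter> cube G k) c) \<longlonglongrightarrow> W k (A' \<inter> cube G k) c"
proof -
  have "AE c in canon m. \<forall>j\<in>distinct_indices k.
     eventually (\<lambda>n. (\<lambda>r\<in>{..<k}. snd c (j r)) \<notin> (A n - A') \<union> (A' - A n)) sequentially \<or> (\<exists>r<k. snd c (j r) \<notin> G \<or> weight \<alpha> \<psi> c (j r) = 0)"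
    using A A' by (intro AE_tuples_eventually_outside G fin sum) auto
  with AE_weight_finite[OF G fin] show ?thesis
  proof eventually_elim
    case (elim c)
    show ?case
    proof (intro tuple_sup_tendsto tuple_sup_tendsto_0)
      show "weight \<alpha> \<psi> c j < \<infinity>" for j by (simp add: weight_def)
    qed (use elim in blast)+
  qed
qed

end

section \<open>Transfer of convergence in mean between Frechet families\<close>

text \<open>The path of a set-indexed family, as a point of the product space over all measurable sets.\<close>
abbreviation (input) process :: "'a measure \<Rightarrow> ('a set \<Rightarrow> 'w \<Rightarrow> ennreal) \<Rightarrow> 'w \<Rightarrow> 'a set \<Rightarrow> ennreal" where
  "process \<mu> N \<omega> \<equiv> (\<lambda>A\<in>sets \<mu>. N A \<omega>)"

abbreviation process_space :: "'a measure \<Rightarrow> ('a set \<Rightarrow> ennreal) measure" where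
  "process_space \<mu> \<equiv> Pi\<^sub>M (sets \<mu>) (\<lambda>_. borel)"

lemma Borel_space_density: "Borel_space \<mu> \<Longrightarrow> Borel_space (density \<mu> f)"
  unfolding Borel_space_def by (simp add: measurable_density_eq1 measurable_density_eq2)

lemma off_diag_sets_density [simp]: "off_diag_sets (density \<mu> f) k = off_diag_sets \<mu> k"
proof -
  have s: "sets (power_measure (density \<mu> f) k) = sets (power_measure \<mu> k)" by (intro sets_PiM_cong) auto
  show ?thesis
    unfolding off_diag_sets_def off_diag_def s by (simp add: space_PiM)
qed

lemma off_diag_rect_density [simp]: "off_diag_rect (density \<mu> f) k R = off_diag_rect \<mu> k R"
  by (simp add: off_diag_rect_def)

lemma off_diag_rect_subset:
  assumes "off_diag_rect \<mu> k R"
  shows "Pi\<^sub>E {..<k} R \<subseteq> off_diag \<mu> k"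
proof
  fix x assume x: "x \<in> Pi\<^sub>E {..<k} R"
  have R: "R i \<in> sets \<mu>" if "i < k" for i using assms that by (simp add: off_diag_rect_def)
  have "x \<in> {..<k} \<rightarrow>\<^sub>E space \<mu>"
    using x PiE_mono[of "{..<k}" R "\<lambda>_. space \<mu>"] sets.sets_into_space[OF R] by blast
  moreover have "x i \<noteq> x j" if "i < k" "j < k" "i \<noteq> j" for i j
  proof -
    have "R i \<inter> R j = {}" using assms that by (simp add: off_diag_rect_def disjoint_family_on_def)
    moreover have "x i \<in> R i" "x j \<in> R j" using x that by (auto dest: PiE_mem)
    ultimately show ?thesis by auto
  qed
  ultimately show "x \<in> off_diag \<mu> k" by (auto simp: off_diag_def space_PiM)
qed

lemma emeasure_density_indicator:
  assumes "A \<in> sets \<mu>" "G \<in> sets \<mu>"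
  shows "emeasure (density \<mu> (indicator G)) A = emeasure \<mu> (A \<inter> G)"
proof -
  have "emeasure (density \<mu> (indicator G)) A = (\<integral>\<^sup>+x. indicator G x * indicator A x \<partial>\<mu>)"
    using assms by (intro emeasure_density) auto
  also have "\<dots> = (\<integral>\<^sup>+x. indicator (A \<inter> G) x \<partial>\<mu>)"
    by (intro nn_integral_cong) (auto split: split_indicator)
  also have "\<dots> = emeasure \<mu> (A \<inter> G)" using assms by simp
  finally show ?thesis .
qed

lemma emeasure_density_indicator_space:
  assumes "G \<in> sets \<mu>"
  shows "emeasure (density \<mu> (indicator G)) (space (density \<mu> (indicator G))) = emeasure \<mu> G"
  using emeasure_density_indicator[OF sets.top assms] sets.sets_into_space[OF assms]
  by (simp add: Int_absorb1)

text \<open>This yields \<open>M\<^bsub>\<alpha>,G\<^esub>\<close>; the control measure is written as in the definition of the local product.\<close>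
lemma frechet_family_restrict:
  assumes N: "frechet_family P \<alpha> \<mu> N" and G: "G \<in> sets \<mu>"
  shows "frechet_family P \<alpha> (density \<mu> (indicator G)) (\<lambda>B. N (B \<inter> G))"
  unfolding frechet_family_def sets_density
proof (intro conjI ballI allI impI)
  show "prob_space P" by (rule frechet_family_prob_space[OF N])
  show "N (A \<inter> G) \<in> borel_measurable P" if "A \<in> sets \<mu>" for A
    using that G by (intro frechet_family_measurable[OF N]) auto
  show "AE \<omega> in P. N ((\<Union>j. A j) \<inter> G) \<omega> = (SUP j. N (A j \<inter> G) \<omega>)" if "\<forall>j::nat. A j \<in> sets \<mu>" for A
    using frechet_family_Union[OF N, of "\<lambda>j. A j \<inter> G"] that G by simp
  fix n :: nat and A :: "nat \<Rightarrow> 'b set" and x :: "nat \<Rightarrow> real"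
  assume A: "\<forall>i<n. A i \<in> sets \<mu>" "disjoint_family_on A {..<n}" "\<forall>i<n. 0 < x i"
  have "emeasure P {\<omega> \<in> space P. \<forall>i<n. N (A i \<inter> G) \<omega> \<le> ennreal (x i)} =
    (\<Prod>i<n. exp_neg (emeasure \<mu> (A i \<inter> G) * ennreal (x i powr (- \<alpha>))))"
    using N[unfolded frechet_family_def, THEN conjunct2, THEN conjunct2, THEN conjunct2, rule_format, of n "\<lambda>i. A i \<inter> G" x]
      A G disjoint_family_on_Int[OF A(2), of G] by blast
  also have "\<dots> = (\<Prod>i<n. exp_neg (emeasure (density \<mu> (indicator G)) (A i) * ennreal (x i powr (- \<alpha>))))"
  proof (intro prod.cong refl)
    fix i assume "i \<in> {..<n}"
    then have Ai: "A i \<in> sets \<mu>" using A by simp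
    from emeasure_density_indicator[OF this G]
    show "exp_neg (emeasure \<mu> (A i \<inter> G) * ennreal (x i powr (- \<alpha>))) =
       exp_neg (emeasure (density \<mu> (indicator G)) (A i) * ennreal (x i powr (- \<alpha>)))" by simp
  qed
  finally show "emeasure P {\<omega> \<in> space P. \<forall>i<n. N (A i \<inter> G) \<omega> \<le> ennreal (x i)} =
    (\<Prod>i<n. exp_neg (emeasure (density \<mu> (indicator G)) (A i) * ennreal (x i powr (- \<alpha>))))" .
qed

lemma frechet_family_nn_integral_eq:
  assumes N: "frechet_family P \<alpha> \<mu> N" and N': "frechet_family P' \<alpha> \<mu> N'"
    and F: "F \<in> borel_measurable (process_space \<mu>)"
  shows "(\<integral>\<^sup>+\<omega>. F (process \<mu> N \<omega>) \<partial>P) = (\<integral>\<^sup>+\<omega>. F (process \<mu> N' \<omega>) \<partial>P')"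
proof -
  have "(\<integral>\<^sup>+\<omega>. F (process \<mu> N \<omega>) \<partial>P) = (\<integral>\<^sup>+f. F f \<partial>distr P (process_space \<mu>) (process \<mu> N))"
    using F by (intro nn_integral_distr[symmetric] frechet_family_process_measurable[OF N]) simp
  also have "\<dots> = (\<integral>\<^sup>+f. F f \<partial>distr P' (process_space \<mu>) (process \<mu> N'))"
    by (simp only: frechet_family_unique[OF N N'])
  also have "\<dots> = (\<integral>\<^sup>+\<omega>. F (process \<mu> N' \<omega>) \<partial>P')"
    using F by (intro nn_integral_distr frechet_family_process_measurable[OF N']) simp
  finally show ?thesis .
qed

lemma frechet_family_AE_iff:
  assumes N: "frechet_family P \<alpha> \<mu> N" and N': "frechet_family P' \<alpha> \<mu> N'"
    and R: "{f \<in> space (process_space \<mu>). R f} \<in> sets (process_space \<mu>)"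
  shows "(AE \<omega> in P. R (process \<mu> N \<omega>)) \<longleftrightarrow> (AE \<omega> in P'. R (process \<mu> N' \<omega>))"
  unfolding AE_distr_iff[OF frechet_family_process_measurable[OF N] R, symmetric]
    AE_distr_iff[OF frechet_family_process_measurable[OF N'] R, symmetric]
    frechet_family_unique[OF N N'] ..

lemma in_L_transfer:
  assumes N: "frechet_family P \<alpha> \<mu> N" and N': "frechet_family P' \<alpha> \<mu> N'"
    and F[measurable]: "F \<in> borel_measurable (process_space \<mu>)"
    and L: "in_L P \<gamma> (\<lambda>\<omega>. F (process \<mu> N \<omega>))"
  shows "in_L P' \<gamma> (\<lambda>\<omega>. F (process \<mu> N' \<omega>))"
  unfolding in_L_def
proof (intro conjI)
  show "(\<lambda>\<omega>. F (process \<mu> N' \<omega>)) \<in> borel_measurable P'"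
    by (rule measurable_compose[OF frechet_family_process_measurable[OF N'] F])
  have "{f \<in> space (process_space \<mu>). F f < \<infinity>} \<in> sets (process_space \<mu>)" by measurable
  from frechet_family_AE_iff[OF N N' this] show "AE \<omega> in P'. F (process \<mu> N' \<omega>) < \<infinity>"
    using L by (simp add: in_L_def)
  have "(\<lambda>f. ennreal (enn2real (F f) powr \<gamma>)) \<in> borel_measurable (process_space \<mu>)" by measurable
  from frechet_family_nn_integral_eq[OF N N' this] L
  show "(\<integral>\<^sup>+\<omega>. ennreal (enn2real (F (process \<mu> N' \<omega>)) powr \<gamma>) \<partial>P') < \<infinity>"
    by (simp add: in_L_def)
qed

text \<open>
  Convergence in \<open>L\<^sup>\<gamma>\<close> of functionals of the process depends on its law only, so it can be proved on the
  canonical space.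
\<close>
lemma tendsto_in_L_transfer:
  assumes N: "frechet_family P \<alpha> \<mu> N" and N': "frechet_family P' \<alpha> \<mu> N'"
    and F[measurable]: "\<And>n. F n \<in> borel_measurable (process_space \<mu>)" "H \<in> borel_measurable (process_space \<mu>)"
    and L: "tendsto_in_L P \<gamma> (\<lambda>n \<omega>. F n (process \<mu> N \<omega>)) (\<lambda>\<omega>. H (process \<mu> N \<omega>))"
  shows "tendsto_in_L P' \<gamma> (\<lambda>n \<omega>. F n (process \<mu> N' \<omega>)) (\<lambda>\<omega>. H (process \<mu> N' \<omega>))"
  unfolding tendsto_in_L_def
proof (intro conjI allI)
  show "in_L P' \<gamma> (\<lambda>\<omega>. F n (process \<mu> N' \<omega>))" for n
    by (rule in_L_transfer[OF N N' F(1)]) (use L in \<open>simp add: tendsto_in_L_def\<close>)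
  show "in_L P' \<gamma> (\<lambda>\<omega>. H (process \<mu> N' \<omega>))"
    by (rule in_L_transfer[OF N N' F(2)]) (use L in \<open>simp add: tendsto_in_L_def\<close>)
  have "(\<lambda>f. ennreal (\<bar>enn2real (F n f) - enn2real (H f)\<bar> powr \<gamma>)) \<in> borel_measurable (process_space \<mu>)" for n
    by measurable
  from frechet_family_nn_integral_eq[OF N N' this] L
  show "(\<lambda>n. \<integral>\<^sup>+\<omega>. ennreal (\<bar>enn2real (F n (process \<mu> N' \<omega>)) - enn2real (H (process \<mu> N' \<omega>))\<bar> powr \<gamma>) \<partial>P') \<longlonglongrightarrow> 0"
    by (simp add: tendsto_in_L_def)
qed

lemma in_L_mono:
  assumes Y: "in_L P \<gamma> Y" and \<gamma>: "0 < \<gamma>" and X: "X \<in> borel_measurable P" and le: "AE \<omega> in P. X \<omega> \<le> Y \<omega>"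
  shows "in_L P \<gamma> X"
  unfolding in_L_def
proof (intro conjI X)
  have fin: "AE \<omega> in P. Y \<omega> < \<infinity>" using Y by (simp add: in_L_def)
  with le show "AE \<omega> in P. X \<omega> < \<infinity>" by eventually_elim (rule le_less_trans)
  have "(\<integral>\<^sup>+\<omega>. ennreal (enn2real (X \<omega>) powr \<gamma>) \<partial>P) \<le> (\<integral>\<^sup>+\<omega>. ennreal (enn2real (Y \<omega>) powr \<gamma>) \<partial>P)"
  proof (rule nn_integral_mono_AE)
    show "AE \<omega> in P. ennreal (enn2real (X \<omega>) powr \<gamma>) \<le> ennreal (enn2real (Y \<omega>) powr \<gamma>)"
      using le fin
    proof eventually_elim
      case (elim \<omega>)
      then have "enn2real (X \<omega>) \<le> enn2real (Y \<omega>)" by (intro enn2real_mono) auto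
      then show ?case using \<gamma> by (intro ennreal_leI powr_mono2) auto
    qed
  qed
  also have "\<dots> < \<infinity>" using Y by (simp add: in_L_def)
  finally show "(\<integral>\<^sup>+\<omega>. ennreal (enn2real (X \<omega>) powr \<gamma>) \<partial>P) < \<infinity>" .
qed

lemma tendsto_in_L_dominated:
  assumes \<gamma>: "0 < \<gamma>" and Y: "in_L P \<gamma> Y"
    and X[measurable]: "\<And>n. X n \<in> borel_measurable P" "X' \<in> borel_measurable P"
    and le: "\<And>n. AE \<omega> in P. X n \<omega> \<le> Y \<omega>"
    and lim: "AE \<omega> in P. (\<lambda>n. X n \<omega>) \<longlonglongrightarrow> X' \<omega>"
  shows "tendsto_in_L P \<gamma> X X'"
proof -
  have [measurable]: "Y \<in> borel_measurable P" and fin: "AE \<omega> in P. Y \<omega> < \<infinity>" using Y by (auto simp: in_L_def)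
  have le_all: "AE \<omega> in P. \<forall>n. X n \<omega> \<le> Y \<omega>" using le by (simp add: AE_all_countable)
  have le': "AE \<omega> in P. X' \<omega> \<le> Y \<omega>"
    using le_all lim
  proof eventually_elim
    case (elim \<omega>)
    then show ?case by (intro LIMSEQ_le_const2[OF elim(2)]) auto
  qed
  have "(\<lambda>n. \<integral>\<^sup>+\<omega>. ennreal (\<bar>enn2real (X n \<omega>) - enn2real (X' \<omega>)\<bar> powr \<gamma>) \<partial>P) \<longlonglongrightarrow> (\<integral>\<^sup>+\<omega>. 0 \<partial>P)"
  proof (rule nn_integral_dominated_convergence[where w="\<lambda>\<omega>. ennreal (enn2real (Y \<omega>) powr \<gamma>)"])
    show "(\<integral>\<^sup>+\<omega>. ennreal (enn2real (Y \<omega>) powr \<gamma>) \<partial>P) < \<infinity>" using Y by (simp add: in_L_def)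
    show "AE \<omega> in P. ennreal (\<bar>enn2real (X n \<omega>) - enn2real (X' \<omega>)\<bar> powr \<gamma>) \<le> ennreal (enn2real (Y \<omega>) powr \<gamma>)" for n
      using le[of n] le' fin
    proof eventually_elim
      case (elim \<omega>)
      then have "enn2real (X n \<omega>) \<le> enn2real (Y \<omega>)" "enn2real (X' \<omega>) \<le> enn2real (Y \<omega>)"
        by (auto intro!: enn2real_mono)
      then have "\<bar>enn2real (X n \<omega>) - enn2real (X' \<omega>)\<bar> \<le> enn2real (Y \<omega>)"
        using enn2real_nonneg[of "X n \<omega>"] enn2real_nonneg[of "X' \<omega>"] by linarith
      then show ?case using \<gamma> by (intro ennreal_leI powr_mono2) auto
    qed
    show "AE \<omega> in P. (\<lambda>n. ennreal (\<bar>enn2real (X n \<omega>) - enn2real (X' \<omega>)\<bar> powr \<gamma>)) \<longlonglongrightarrow> 0"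
      using lim le' fin
    proof eventually_elim
      case (elim \<omega>)
      have "(\<lambda>n. ennreal (enn2real (X' \<omega>))) = (\<lambda>n::nat. X' \<omega>)" using elim by (simp add: le_less_trans)
      then have "(\<lambda>n. enn2real (X n \<omega>)) \<longlonglongrightarrow> enn2real (X' \<omega>)"
        using elim by (intro tendsto_enn2real) (auto simp: le_less_trans)
      then have "(\<lambda>n. \<bar>enn2real (X n \<omega>) - enn2real (X' \<omega>)\<bar>) \<longlonglongrightarrow> 0"
        by (simp add: LIM_zero tendsto_rabs_zero)
      then have "(\<lambda>n. \<bar>enn2real (X n \<omega>) - enn2real (X' \<omega>)\<bar> powr \<gamma>) \<longlonglongrightarrow> 0"
        using \<gamma> by (intro tendsto_zero_powrI[OF _ tendsto_const]) auto
      then have "(\<lambda>n. ennreal (\<bar>enn2real (X n \<omega>) - enn2real (X' \<omega>)\<bar> powr \<gamma>)) \<longlonglongrightarrow> ennreal 0" by (rule tendsto_ennrealI)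
      then show ?case by simp
    qed
  qed measurable
  then show ?thesis
    unfolding tendsto_in_L_def using in_L_mono[OF Y \<gamma>] X le le' by simp
qed

text \<open>Along a subsequence with summable \<open>L\<^sup>\<gamma>\<close> distances, the sum of the distances is almost surely finite.\<close>
lemma tendsto_in_L_AE_subsequence:
  assumes \<gamma>: "0 < \<gamma>" and L: "tendsto_in_L P \<gamma> X X'"
    and sum: "(\<Sum>n. \<integral>\<^sup>+\<omega>. ennreal (\<bar>enn2real (X (r n) \<omega>) - enn2real (X' \<omega>)\<bar> powr \<gamma>) \<partial>P) < \<infinity>"
  shows "AE \<omega> in P. (\<lambda>n. X (r n) \<omega>) \<longlonglongrightarrow> X' \<omega>"
proof -
  have [measurable]: "X n \<in> borel_measurable P" "X' \<in> borel_measurable P" for n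
    using L by (auto simp: tendsto_in_L_def in_L_def)
  have fin: "AE \<omega> in P. \<forall>n. X n \<omega> < \<infinity>" "AE \<omega> in P. X' \<omega> < \<infinity>"
    using L unfolding AE_all_countable by (auto simp: tendsto_in_L_def in_L_def)
  define d where "d n \<omega> = \<bar>enn2real (X (r n) \<omega>) - enn2real (X' \<omega>)\<bar> powr \<gamma>" for n \<omega>
  have "(\<integral>\<^sup>+\<omega>. (\<Sum>n. ennreal (d n \<omega>)) \<partial>P) < \<infinity>"
    using sum unfolding d_def by (subst nn_integral_suminf) auto
  then have "AE \<omega> in P. (\<Sum>n. ennreal (d n \<omega>)) \<noteq> \<infinity>"
    unfolding d_def by (intro nn_integral_PInf_AE) auto
  with fin show ?thesis
  proof eventually_elim
    case (elim \<omega>)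
    have "summable (\<lambda>n. d n \<omega>)"
      using elim(3) by (intro summable_suminf_not_top) (auto simp: d_def)
    then have "(\<lambda>n. d n \<omega>) \<longlonglongrightarrow> 0" by (rule summable_LIMSEQ_zero)
    then have "(\<lambda>n. d n \<omega> powr (1 / \<gamma>)) \<longlonglongrightarrow> 0"
      using \<gamma> by (intro tendsto_zero_powrI[OF _ tendsto_const]) (auto simp: d_def)
    moreover have "d n \<omega> powr (1 / \<gamma>) = \<bar>enn2real (X (r n) \<omega>) - enn2real (X' \<omega>)\<bar>" for n
      using \<gamma> by (simp add: d_def powr_powr)
    ultimately have "(\<lambda>n. enn2real (X (r n) \<omega>)) \<longlonglongrightarrow> enn2real (X' \<omega>)"
      by (simp add: tendsto_rabs_zero_iff LIM_zero_iff)
    then have "(\<lambda>n. ennreal (enn2real (X (r n) \<omega>))) \<longlonglongrightarrow> ennreal (enn2real (X' \<omega>))" by (rule tendsto_ennrealI)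
    moreover have "ennreal (enn2real (X (r n) \<omega>)) = X (r n) \<omega>" for n using elim(1) by simp
    moreover have "ennreal (enn2real (X' \<omega>)) = X' \<omega>" using elim(2) by simp
    ultimately show ?case by (simp only:)
  qed
qed

lemma suminf_half_powers: "(\<Sum>n. ennreal ((1/2) ^ n)) < \<infinity>"
proof -
  have "(\<Sum>n. ennreal ((1/2) ^ n)) = ennreal (\<Sum>n. (1/2) ^ n)"
    by (intro suminf_ennreal2) (auto intro: summable_geometric)
  then show ?thesis by simp
qed

lemma suminf_le_half_powers:
  assumes "\<And>n. f n \<le> ennreal ((1/2) ^ n)"
  shows "(\<Sum>n. f n) < \<infinity>"
proof -
  have "(\<Sum>n. f n) \<le> (\<Sum>n. ennreal ((1/2) ^ n))"
    by (rule suminf_le[OF assms summableI summableI])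
  then show ?thesis using suminf_half_powers by (rule le_less_trans)
qed

lemma tendsto_0_fast_subsequence:
  fixes f :: "nat \<Rightarrow> ennreal"
  assumes "f \<longlonglongrightarrow> 0"
  shows "\<exists>r :: nat \<Rightarrow> nat. \<forall>n. f (r n) \<le> ennreal ((1/2) ^ n)"
proof (rule choice, rule allI)
  fix n :: nat
  have "eventually (\<lambda>i. f i < ennreal ((1/2) ^ n)) sequentially"
    using assms by (intro order_tendstoD(2)) auto
  then show "\<exists>i. f i \<le> ennreal ((1/2) ^ n)"
    by (auto simp: eventually_sequentially intro: less_imp_le)
qed

section \<open>Product limits as functionals of the process\<close>

text \<open>The restriction to \<open>G\<close> is built into the functional, so that one process serves all sets \<open>G\<close>.\<close>
definition rect_functional :: "'a set \<Rightarrow> nat \<Rightarrow> (nat \<Rightarrow> 'a set) set \<Rightarrow> ('a set \<Rightarrow> ennreal) \<Rightarrow> ennreal" where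
  "rect_functional G k \<R> f = (SUP R\<in>\<R>. \<Prod>i<k. f (R i \<inter> G))"

lemma rect_functional_measurable:
  assumes "countable \<R>" and R: "\<And>R i. R \<in> \<R> \<Longrightarrow> i < k \<Longrightarrow> R i \<inter> G \<in> sets \<mu>"
  shows "rect_functional G k \<R> \<in> borel_measurable (process_space \<mu>)"
  unfolding rect_functional_def
  by (intro borel_measurable_SUP assms borel_measurable_prod_ennreal measurable_component_singleton) (use R in auto)

lemma rect_functional_process:
  assumes "\<And>R i. R \<in> \<R> \<Longrightarrow> i < k \<Longrightarrow> R i \<inter> G \<in> sets \<mu>"
  shows "rect_functional G k \<R> (process \<mu> N \<omega>) = rect_sup (\<lambda>B. N (B \<inter> G)) k \<R> \<omega>"
  unfolding rect_functional_def rect_sup_def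
proof (rule SUP_cong[OF refl])
  fix R assume R: "R \<in> \<R>"
  show "(\<Prod>i<k. process \<mu> N \<omega> (R i \<inter> G)) = (\<Prod>i<k. N (R i \<inter> G) \<omega>)"
    by (intro prod.cong refl) (use assms[OF R] in simp)
qed

lemma nn_integral_canon_fst:
  assumes m: "prob_space m" and f[measurable]: "f \<in> borel_measurable (Pi\<^sub>M UNIV (\<lambda>_::nat. exp_law))"
  shows "(\<integral>\<^sup>+c. f (fst c) \<partial>canon m) = (\<integral>\<^sup>+x. f x \<partial>Pi\<^sub>M UNIV (\<lambda>_. exp_law))"
proof -
  interpret S: prob_space "Pi\<^sub>M UNIV (\<lambda>_::nat. m)" by (intro prob_space_PiM m)
  have "(\<integral>\<^sup>+c. f (fst c) \<partial>canon m) = (\<integral>\<^sup>+x. f x \<partial>distr (canon m) (Pi\<^sub>M UNIV (\<lambda>_. exp_law)) fst)"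
    unfolding canon_def by (subst nn_integral_distr) (use f in simp_all)
  then show ?thesis unfolding canon_def S.distr_pair_fst .
qed

lemma gaps_product_in_L:
  assumes m: "prob_space m" and \<alpha>: "0 < \<alpha>" and \<gamma>: "0 < \<gamma>" "\<gamma> < \<alpha>" and C: "0 \<le> C"
  shows "in_L (canon m) \<gamma> (\<lambda>c. \<Prod>i<k. ennreal (C * fst c i powr (- 1 / \<alpha>)))"
  unfolding in_L_def
proof (intro conjI)
  have meas: "(\<lambda>c. fst c i) \<in> borel_measurable (canon m)" for i
    unfolding canon_def by measurable
  then show "(\<lambda>c. \<Prod>i<k. ennreal (C * fst c i powr (- 1 / \<alpha>))) \<in> borel_measurable (canon m)"
    by measurable
  show "AE c in canon m. (\<Prod>i<k. ennreal (C * fst c i powr (- 1 / \<alpha>))) < \<infinity>"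
    using C by (simp add: prod_ennreal)
  define f where "f y = ennreal (C powr \<gamma>) * ennreal (y powr (- (\<gamma> / \<alpha>)))" for y :: real
  have f[measurable]: "f \<in> borel_measurable borel" unfolding f_def by measurable
  have "ennreal (enn2real (\<Prod>i<k. ennreal (C * fst c i powr (- 1 / \<alpha>))) powr \<gamma>) = (\<Prod>i<k. f (fst c i))" for c :: "(nat \<Rightarrow> real) \<times> (nat \<Rightarrow> 'a)"
  proof -
    have nn: "0 \<le> (\<Prod>i<k. C * fst c i powr (- 1 / \<alpha>))" using C by (intro prod_nonneg) auto
    have "ennreal (enn2real (\<Prod>i<k. ennreal (C * fst c i powr (- 1 / \<alpha>))) powr \<gamma>) = ennreal ((\<Prod>i<k. C * fst c i powr (- 1 / \<alpha>)) powr \<gamma>)"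
      using C nn by (subst prod_ennreal) auto
    also have "(\<Prod>i<k. C * fst c i powr (- 1 / \<alpha>)) powr \<gamma> = (\<Prod>i<k. (C * fst c i powr (- 1 / \<alpha>)) powr \<gamma>)"
      by (rule prod_powr_distrib)
    also have "\<dots> = (\<Prod>i<k. C powr \<gamma> * fst c i powr (- (\<gamma> / \<alpha>)))"
      using C by (intro prod.cong refl) (simp add: powr_mult powr_powr)
    also have "ennreal \<dots> = (\<Prod>i<k. f (fst c i))"
      by (subst prod_ennreal[symmetric]) (auto simp: f_def ennreal_mult')
    finally show ?thesis .
  qed
  then have "(\<integral>\<^sup>+c. ennreal (enn2real (\<Prod>i<k. ennreal (C * fst c i powr (- 1 / \<alpha>))) powr \<gamma>) \<partial>canon m)
      = (\<integral>\<^sup>+c. (\<Prod>i<k. f (fst c i)) \<partial>canon m)" by simp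
  also have "\<dots> = (\<integral>\<^sup>+x. (\<Prod>i<k. f (x i)) \<partial>Pi\<^sub>M UNIV (\<lambda>_::nat. exp_law))"
    by (rule nn_integral_canon_fst[OF m]) measurable
  also have "\<dots> = (\<integral>\<^sup>+y. f y \<partial>exp_law) ^ k"
    by (rule nn_integral_prod_gaps[OF f])
  also have "\<dots> < \<infinity>"
  proof -
    have "(\<integral>\<^sup>+y. f y \<partial>exp_law) = ennreal (C powr \<gamma>) * (\<integral>\<^sup>+y. ennreal (y powr (- (\<gamma> / \<alpha>))) \<partial>exp_law)"
      unfolding f_def by (rule nn_integral_cmult) measurable
    also have "\<dots> < \<infinity>"
      using exp_law_negative_moment[of "\<gamma> / \<alpha>"] \<alpha> \<gamma> by (simp add: ennreal_mult_less_top)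
    finally show ?thesis by (simp add: power_less_top_ennreal)
  qed
  finally show "(\<integral>\<^sup>+c. ennreal (enn2real (\<Prod>i<k. ennreal (C * fst c i powr (- 1 / \<alpha>))) powr \<gamma>) \<partial>canon m) < \<infinity>" .
qed

text \<open>
  For a constant density the weights decrease in \<open>j\<close>, so the first \<open>k\<close> points give the largest product,
  and the \<open>i\<close>-th arrival is at least the \<open>i\<close>-th gap.
\<close>
lemma constant_density_in_L:
  assumes L: "lepage \<alpha> \<nu> m (\<lambda>_. ennreal b)" and b: "0 < b" and \<gamma>: "0 < \<gamma>" "\<gamma> < \<alpha>"
    and A: "A \<in> sets (power_measure m k)"
  shows "in_L (canon m) \<gamma> (\<lambda>c. tuple_sup (weight \<alpha> (\<lambda>_. ennreal b) c) (snd c) k A)"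
proof -
  interpret lepage \<alpha> \<nu> m "\<lambda>_. ennreal b" by (rule L)
  define C where "C = b powr (1 / \<alpha>)"
  have C: "0 \<le> C" by (simp add: C_def)
  show ?thesis
  proof (rule in_L_mono[OF gaps_product_in_L[OF m alpha \<gamma> C] \<gamma>(1) W_measurable[OF A]])
    show "AE c in canon m. W k A c \<le> (\<Prod>i<k. ennreal (C * fst c i powr (- 1 / \<alpha>)))"
      using AE_canon_gaps_pos[OF m]
    proof eventually_elim
      case (elim c)
      have w: "weight \<alpha> (\<lambda>_. ennreal b) c j = ennreal (C * arrival (fst c) j powr (- 1 / \<alpha>))" for j
        using b by (simp add: weight_def C_def mult.commute)
      have mono: "ennreal (C * y powr (- 1 / \<alpha>)) \<le> ennreal (C * x powr (- 1 / \<alpha>))" if "0 < x" "x \<le> y" for x y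
        using that alpha C by (intro ennreal_leI mult_left_mono powr_mono2') auto
      have "antimono (weight \<alpha> (\<lambda>_. ennreal b) c)"
        unfolding w
      proof (intro antimonoI mono)
        fix i j :: nat assume "i \<le> j"
        show "0 < arrival (fst c) i" using elim by (rule arrival_pos)
        show "arrival (fst c) i \<le> arrival (fst c) j"
          unfolding arrival_def using \<open>i \<le> j\<close> elim by (intro sum_mono2) (auto intro: less_imp_le)
      qed
      then have "W k A c \<le> (\<Prod>i<k. weight \<alpha> (\<lambda>_. ennreal b) c i)"
        by (rule tuple_sup_le_prod_initial)
      also have "\<dots> \<le> (\<Prod>i<k. ennreal (C * fst c i powr (- 1 / \<alpha>)))"
      proof (intro prod_mono_ennreal)
        fix i assume "i \<in> {..<k}"
        have "fst c i \<le> arrival (fst c) i"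
          unfolding arrival_def using elim by (intro member_le_sum) (auto intro: less_imp_le)
        then show "weight \<alpha> (\<lambda>_. ennreal b) c i \<le> ennreal (C * fst c i powr (- 1 / \<alpha>))"
          unfolding w using elim by (intro mono) auto
      qed
      finally show ?case .
    qed
  qed
qed

text \<open>The property that is required of the version selected in \<open>product_sup_measure\<close>.\<close>
definition product_limit ::
  "'w measure \<Rightarrow> real \<Rightarrow> 'a measure \<Rightarrow> ('a set \<Rightarrow> 'w \<Rightarrow> ennreal) \<Rightarrow>
   nat \<Rightarrow> (nat \<Rightarrow> 'a) set \<Rightarrow> ('w \<Rightarrow> ennreal) \<Rightarrow> bool" where
  "product_limit P \<alpha> \<nu> N k A X \<longleftrightarrow>
     (\<exists>\<R>. (\<forall>n::nat. finite (\<R> n) \<and> (\<forall>R \<in> \<R> n. off_diag_rect \<nu> k R)) \<and>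
        (\<lambda>n. emeasure (power_measure \<nu> k)
               ((rect_union k (\<R> n) - A) \<union> (A - rect_union k (\<R> n)))) \<longlonglongrightarrow> 0 \<and>
        (\<forall>\<gamma>. 0 < \<gamma> \<and> \<gamma> < \<alpha> \<longrightarrow> tendsto_in_L P \<gamma> (\<lambda>n. rect_sup N k (\<R> n)) X))"

lemma product_sup_measure_limit:
  "product_limit P \<alpha> \<nu> N k A X \<Longrightarrow> product_limit P \<alpha> \<nu> N k A (product_sup_measure P \<alpha> \<nu> N k A)"
  unfolding product_sup_measure_def product_limit_def[symmetric] by (rule someI[of "product_limit P \<alpha> \<nu> N k A"])

lemma product_limit_measurable:
  assumes "product_limit P \<alpha> \<nu> N k A X" "0 < \<alpha>"
  shows "X \<in> borel_measurable P"
proof -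
  have "\<exists>\<gamma>. 0 < \<gamma> \<and> \<gamma> < \<alpha>" using assms(2) by (intro exI[of _ "\<alpha> / 2"]) simp
  then show ?thesis using assms(1) by (auto simp: product_limit_def tendsto_in_L_def in_L_def)
qed

context lepage
begin

lemma rect_sup_W1:
  assumes "\<And>R. R \<in> \<R> \<Longrightarrow> off_diag_rect \<mu> k R"
  shows "rect_sup (\<lambda>B. W1 (B \<inter> G)) k \<R> c = W k (rect_union k \<R> \<inter> cube G k) c"
  unfolding rect_sup_def using assms by (intro rect_sup_point_sup) (simp add: off_diag_rect_def)

lemma power_sets [simp]: "sets (power_measure \<mu> k) = sets (power_measure m k)"
  by (intro sets_PiM_cong) auto

text \<open>
  The off-diagonal part is a countable union of rectangles, so this variable is a functional of the
  process \<open>W1\<close> on \<open>G\<close>. Its law does not change if the marks are drawn from the normalized restriction of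
  \<open>\<mu>\<close> to \<open>G\<close> instead of \<open>m\<close>, and then the density is constant.
\<close>
lemma W_off_diag_in_L:
  assumes B: "Borel_space \<mu>" and G: "G \<in> sets \<mu>" and pos: "0 < emeasure \<mu> G" and fin: "emeasure \<mu> G < \<infinity>"
    and \<gamma>: "0 < \<gamma>" "\<gamma> < \<alpha>"
  shows "in_L (canon m) \<gamma> (W k (off_diag \<mu> k \<inter> cube G k))"
proof -
  define \<nu> where "\<nu> = density \<mu> (indicator G)"
  define b where "b = measure \<mu> G"
  have b: "emeasure \<mu> G = ennreal b" using fin by (simp add: b_def emeasure_eq_ennreal_measure)
  then have b0: "0 < b" using pos by (simp add: ennreal_less_zero_iff)
  \<comment> \<open>With the marks drawn from \<open>m'\<close>, the measure \<open>\<nu>\<close> has the constant density \<open>b\<close>.\<close>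
  define m' where "m' = density \<nu> (\<lambda>_. ennreal (1 / b))"
  have sets_\<nu>: "sets \<nu> = sets \<mu>" by (simp add: \<nu>_def)
  have "emeasure \<nu> (space \<nu>) = emeasure \<mu> G"
    unfolding \<nu>_def by (rule emeasure_density_indicator_space[OF G])
  then have "emeasure m' (space m') = 1"
    unfolding m'_def using b b0 by (simp add: emeasure_density_const ennreal_mult'[symmetric])
  then have m': "prob_space m'" by (rule prob_spaceI)
  have \<nu>_eq: "\<nu> = density m' (\<lambda>_. ennreal b)"
  proof -
    have "ennreal (1 / b) * ennreal b = 1"
      using b0 by (simp add: ennreal_mult'[symmetric])
    moreover have "density m' (\<lambda>_. ennreal b) = density \<nu> (\<lambda>_. ennreal (1 / b) * ennreal b)"
      unfolding m'_def by (rule density_density_eq) simp_all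
    ultimately show ?thesis by (simp only: density_1)
  qed
  interpret L': lepage \<alpha> \<nu> m' "\<lambda>_. ennreal b"
    by (rule lepage.intro[OF alpha m' _ \<nu>_eq]) simp_all
  obtain \<Q> where Q: "countable \<Q>" "\<And>R. R \<in> \<Q> \<Longrightarrow> off_diag_rect \<mu> k R"
    "off_diag \<mu> k = (\<Union>R\<in>\<Q>. Pi\<^sub>E {..<k} R)" using off_diag_cover[OF B, of k] by metis
  have ru: "rect_union k \<Q> = off_diag \<mu> k" by (simp add: rect_union_def Q(3))
  have QS: "R i \<inter> UNIV \<in> sets \<nu>" if "R \<in> \<Q>" "i < k" for R i
  proof -
    have "R i \<in> sets \<mu>" using Q(2)[OF that(1)] that(2) unfolding off_diag_rect_def by blast
    then show ?thesis unfolding sets_\<nu> Int_UNIV_right .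
  qed
  have rn: "off_diag_rect \<nu> k R" if "R \<in> \<Q>" for R using Q(2)[OF that] by (simp add: \<nu>_def)
  have "in_L (canon m') \<gamma> (\<lambda>c. rect_functional UNIV k \<Q> (process \<nu> L'.W1 c))"
  proof -
    have sub: "off_diag \<mu> k \<inter> cube UNIV k = off_diag \<mu> k"
      unfolding off_diag_def by (auto simp: space_PiM PiE_def)
    have eq: "(\<lambda>c. rect_functional UNIV k \<Q> (process \<nu> L'.W1 c)) = L'.W k (off_diag \<mu> k)"
    proof
      fix c
      have "rect_functional UNIV k \<Q> (process \<nu> L'.W1 c) = rect_sup (\<lambda>B. L'.W1 (B \<inter> UNIV)) k \<Q> c"
        using QS by (rule rect_functional_process)
      also have "\<dots> = L'.W k (rect_union k \<Q> \<inter> cube UNIV k) c" using rn by (rule L'.rect_sup_W1)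
      finally show "rect_functional UNIV k \<Q> (process \<nu> L'.W1 c) = L'.W k (off_diag \<mu> k) c" by (simp add: ru sub)
    qed
    have "sets (power_measure m' k) = sets (power_measure \<mu> k)"
      by (rule sets_PiM_cong[OF refl]) (simp only: m'_def \<nu>_def sets_density)
    then have "off_diag \<mu> k \<in> sets (power_measure m' k)" using off_diag_in_sets[OF B] by (simp only:)
    then show ?thesis
      unfolding eq using constant_density_in_L[OF L'.lepage_axioms b0 \<gamma>] by blast
  qed
  then have "in_L (canon m) \<gamma> (\<lambda>c. rect_functional UNIV k \<Q> (process \<nu> (\<lambda>B. W1 (B \<inter> G)) c))"
  proof (rule in_L_transfer[rotated 3])
    show "frechet_family (canon m') \<alpha> \<nu> L'.W1" by (rule L'.W1_frechet_family)
    show "frechet_family (canon m) \<alpha> \<nu> (\<lambda>B. W1 (B \<inter> G))"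
      unfolding \<nu>_def using W1_frechet_family G by (rule frechet_family_restrict)
    show "rect_functional UNIV k \<Q> \<in> borel_measurable (process_space \<nu>)"
      using Q(1) QS by (rule rect_functional_measurable)
  qed
  moreover have "rect_functional UNIV k \<Q> (process \<nu> (\<lambda>B. W1 (B \<inter> G)) c) = W k (off_diag \<mu> k \<inter> cube G k) c" for c
  proof -
    have "rect_functional UNIV k \<Q> (process \<nu> (\<lambda>B. W1 (B \<inter> G)) c) = rect_sup (\<lambda>B. W1 (B \<inter> UNIV \<inter> G)) k \<Q> c"
      using QS by (rule rect_functional_process)
    also have "\<dots> = rect_sup (\<lambda>B. W1 (B \<inter> G)) k \<Q> c" by simp
    also have "\<dots> = W k (rect_union k \<Q> \<inter> cube G k) c" using Q(2) by (rule rect_sup_W1)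
    finally show ?thesis by (simp only: ru)
  qed
  ultimately show ?thesis by simp
qed

context
  fixes P :: "'w measure" and M :: "'a set \<Rightarrow> 'w \<Rightarrow> ennreal" and G :: "'a set" and k :: nat and A :: "(nat \<Rightarrow> 'a) set"
  assumes B: "Borel_space \<mu>" and M: "frechet_family P \<alpha> \<mu> M"
    and G: "G \<in> sets \<mu>" and pos: "0 < emeasure \<mu> G" and fin: "emeasure \<mu> G < \<infinity>"
    and A: "A \<in> off_diag_sets \<mu> k"
begin

text \<open>
  The upper limit is used in place of the limit because it is defined, and measurable, for all paths.
\<close>
lemma fast_approximation_functional:
  assumes fin_R: "\<And>n::nat. finite (\<R> n)" and rect_R: "\<And>n. \<forall>R\<in>\<R> n. off_diag_rect \<mu> k R"
    and sum: "(\<Sum>n. emeasure (power_measure (density \<mu> (indicator G)) k)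
       ((rect_union k (\<R> n) - A) \<union> (A - rect_union k (\<R> n)))) < \<infinity>"
  defines "\<Phi> \<equiv> \<lambda>f. limsup (\<lambda>n. rect_functional G k (\<R> n) f)"
  shows "\<Phi> \<in> borel_measurable (process_space \<mu>)"
    and "\<And>n. rect_functional G k (\<R> n) \<in> borel_measurable (process_space \<mu>)"
    and "\<And>n N \<omega>. rect_functional G k (\<R> n) (process \<mu> N \<omega>) = rect_sup (\<lambda>B. N (B \<inter> G)) k (\<R> n) \<omega>"
    and "AE c in canon m. (\<lambda>n. rect_functional G k (\<R> n) (process \<mu> W1 c)) \<longlonglongrightarrow> W k (A \<inter> cube G k) c"
    and "AE c in canon m. \<Phi> (process \<mu> W1 c) = W k (A \<inter> cube G k) c"
proof -
  have R: "finite (\<R> n)" "R \<in> \<R> n \<Longrightarrow> off_diag_rect \<mu> k R" for n R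
    using fin_R rect_R by auto
  have RS: "R i \<inter> G \<in> sets \<mu>" if "R \<in> \<R> n" "i < k" for n R i
    using R(2)[OF that(1)] that(2) G by (simp add: off_diag_rect_def sets.Int)
  show meas: "rect_functional G k (\<R> n) \<in> borel_measurable (process_space \<mu>)" for n
    using R(1) RS by (intro rect_functional_measurable countable_finite)
  then show "\<Phi> \<in> borel_measurable (process_space \<mu>)"
    unfolding \<Phi>_def by (rule borel_measurable_limsup)
  show pr: "rect_functional G k (\<R> n) (process \<mu> N \<omega>) = rect_sup (\<lambda>B. N (B \<inter> G)) k (\<R> n) \<omega>"
    for n and N :: "'a set \<Rightarrow> 'z \<Rightarrow> ennreal" and \<omega>
    using RS by (rule rect_functional_process)
  have "rect_functional G k (\<R> n) (process \<mu> W1 c) = W k (rect_union k (\<R> n) \<inter> cube G k) c" for n c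
  proof -
    have "rect_functional G k (\<R> n) (process \<mu> W1 c) = rect_sup (\<lambda>B. W1 (B \<inter> G)) k (\<R> n) c"
      using RS by (rule rect_functional_process)
    also have "\<dots> = W k (rect_union k (\<R> n) \<inter> cube G k) c" using R(2) by (rule rect_sup_W1)
    finally show ?thesis .
  qed
  moreover have "AE c in canon m. (\<lambda>n. W k (rect_union k (\<R> n) \<inter> cube G k) c) \<longlonglongrightarrow> W k (A \<inter> cube G k) c"
  proof (rule AE_W_tendsto[OF _ fin _ _ sum])
    show "G \<in> sets m" using G by simp
    show "rect_union k (\<R> n) \<in> sets (power_measure m k)" for n
      using R by (intro rect_union_sets) (auto simp: off_diag_rect_def)
    show "A \<in> sets (power_measure m k)" using off_diag_setsD(1)[OF B A] by simp
  qed
  ultimately show lim: "AE c in canon m. (\<lambda>n. rect_functional G k (\<R> n) (process \<mu> W1 c)) \<longlonglongrightarrow> W k (A \<inter> cube G k) c"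
    by simp
  then show "AE c in canon m. \<Phi> (process \<mu> W1 c) = W k (A \<inter> cube G k) c"
    unfolding \<Phi>_def by eventually_elim (rule lim_imp_Limsup[OF sequentially_bot])
qed

text \<open>
  On the canonical space the rectangles give an almost surely convergent and dominated sequence; the
  convergence in \<open>L\<^sup>\<gamma>\<close> that follows is then transferred to \<open>P\<close>.
\<close>
theorem product_limit_exists:
  "\<exists>X. product_limit P \<alpha> (density \<mu> (indicator G)) (\<lambda>B. M (B \<inter> G)) k A X"
proof -
  let ?\<nu> = "density \<mu> (indicator G)"
  have "emeasure ?\<nu> (space ?\<nu>) = emeasure \<mu> G"
    by (rule emeasure_density_indicator_space[OF G])
  then have "finite_measure ?\<nu>" using fin by (intro finite_measureI) simp
  moreover have "A \<in> off_diag_sets ?\<nu> k" using A by simp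
  ultimately obtain \<R> where R: "\<And>n::nat. finite (\<R> n)" "\<And>n R. R \<in> \<R> n \<Longrightarrow> off_diag_rect ?\<nu> k R"
    and le: "\<And>n. emeasure (power_measure ?\<nu> k) ((rect_union k (\<R> n) - A) \<union> (A - rect_union k (\<R> n))) \<le> ennreal ((1/2) ^ n)"
    using off_diag_approximation[OF _ Borel_space_density[OF B]] by metis
  have R': "off_diag_rect \<mu> k R" if "R \<in> \<R> n" for n R using R(2)[OF that] by simp
  have rect_R: "\<forall>R\<in>\<R> n. off_diag_rect \<mu> k R" for n using R' by blast
  define \<Phi> where "\<Phi> f = limsup (\<lambda>n. rect_functional G k (\<R> n) f)" for f :: "'a set \<Rightarrow> ennreal"
  note * = fast_approximation_functional[OF R(1) rect_R suminf_le_half_powers[OF le]]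
  have \<Phi>: "\<Phi> \<in> borel_measurable (process_space \<mu>)" unfolding \<Phi>_def by (rule *(1))
  have \<Phi>_W: "AE c in canon m. \<Phi> (process \<mu> W1 c) = W k (A \<inter> cube G k) c" unfolding \<Phi>_def by (rule *(5))
  have "product_limit P \<alpha> ?\<nu> (\<lambda>B. M (B \<inter> G)) k A (\<lambda>\<omega>. \<Phi> (process \<mu> M \<omega>))"
    unfolding product_limit_def
  proof (intro exI[of _ \<R>] conjI allI impI ballI)
    show "(\<lambda>n. emeasure (power_measure ?\<nu> k) ((rect_union k (\<R> n) - A) \<union> (A - rect_union k (\<R> n)))) \<longlonglongrightarrow> 0"
    proof (rule tendsto_sandwich[OF _ _ tendsto_const])
      have "(\<lambda>n. (1/2::real) ^ n) \<longlonglongrightarrow> 0" by (rule LIMSEQ_power_zero) simp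
      then have "(\<lambda>n. ennreal ((1/2) ^ n)) \<longlonglongrightarrow> ennreal 0" by (rule tendsto_ennrealI)
      then show "(\<lambda>n. ennreal ((1/2) ^ n)) \<longlonglongrightarrow> 0" by simp
    qed (use le in auto)
    fix \<gamma> assume \<gamma>: "0 < \<gamma> \<and> \<gamma> < \<alpha>"
    have "tendsto_in_L (canon m) \<gamma> (\<lambda>n c. rect_functional G k (\<R> n) (process \<mu> W1 c)) (\<lambda>c. \<Phi> (process \<mu> W1 c))"
    proof (rule tendsto_in_L_dominated)
      show "0 < \<gamma>" using \<gamma> by simp
      show "in_L (canon m) \<gamma> (W k (off_diag \<mu> k \<inter> cube G k))"
        using \<gamma> by (intro W_off_diag_in_L[OF B G pos fin]) auto
      show "(\<lambda>c. rect_functional G k (\<R> n) (process \<mu> W1 c)) \<in> borel_measurable (canon m)" for n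
        by (rule measurable_compose[OF frechet_family_process_measurable[OF W1_frechet_family] *(2)])
      show "(\<lambda>c. \<Phi> (process \<mu> W1 c)) \<in> borel_measurable (canon m)"
        by (rule measurable_compose[OF frechet_family_process_measurable[OF W1_frechet_family] \<Phi>])
      show "AE c in canon m. rect_functional G k (\<R> n) (process \<mu> W1 c) \<le> W k (off_diag \<mu> k \<inter> cube G k) c" for n
      proof (rule AE_I2)
        fix c
        have "rect_union k (\<R> n) \<subseteq> off_diag \<mu> k"
          unfolding rect_union_def using R' by (intro UN_least off_diag_rect_subset)
        then have "W k (rect_union k (\<R> n) \<inter> cube G k) c \<le> W k (off_diag \<mu> k \<inter> cube G k) c"
          by (intro tuple_sup_mono) blast
        moreover have "rect_sup (\<lambda>B. W1 (B \<inter> G)) k (\<R> n) c = W k (rect_union k (\<R> n) \<inter> cube G k) c"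
          using R' by (rule rect_sup_W1)
        ultimately show "rect_functional G k (\<R> n) (process \<mu> W1 c) \<le> W k (off_diag \<mu> k \<inter> cube G k) c"
          by (simp only: *(3)[where N=W1])
      qed
      show "AE c in canon m. (\<lambda>n. rect_functional G k (\<R> n) (process \<mu> W1 c)) \<longlonglongrightarrow> \<Phi> (process \<mu> W1 c)"
        using *(4) \<Phi>_W by eventually_elim simp
    qed
    from tendsto_in_L_transfer[OF W1_frechet_family M *(2) \<Phi> this]
    show "tendsto_in_L P \<gamma> (\<lambda>n. rect_sup (\<lambda>B. M (B \<inter> G)) k (\<R> n)) (\<lambda>\<omega>. \<Phi> (process \<mu> M \<omega>))"
      by (simp only: *(3)[where N=M])
  qed (use R in auto)
  then show ?thesis by blast
qed

text \<open>
  Whatever sequence of rectangles produced the limit \<open>X\<close>, along a subsequence both the convergence to \<open>X\<close>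
  and the approximation of \<open>A\<close> are fast. Along it \<open>X\<close> is an almost sure limit for the process \<open>M\<close>, and the
  same functional of \<open>W1\<close> is \<open>W k (A \<inter> G\<^sup>k)\<close>. In particular \<open>X\<close> is unique up to null sets.
\<close>
theorem product_limit_functional:
  assumes X: "product_limit P \<alpha> (density \<mu> (indicator G)) (\<lambda>B. M (B \<inter> G)) k A X"
  shows "\<exists>\<Phi>\<in>borel_measurable (process_space \<mu>).
    (AE \<omega> in P. X \<omega> = \<Phi> (process \<mu> M \<omega>)) \<and> (AE c in canon m. W k (A \<inter> cube G k) c = \<Phi> (process \<mu> W1 c))"
proof -
  let ?\<nu> = "density \<mu> (indicator G)"
  obtain \<R> where R: "\<And>n::nat. finite (\<R> n)" "\<And>n R. R \<in> \<R> n \<Longrightarrow> off_diag_rect \<mu> k R"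
    and lim: "(\<lambda>n. emeasure (power_measure ?\<nu> k) ((rect_union k (\<R> n) - A) \<union> (A - rect_union k (\<R> n)))) \<longlonglongrightarrow> 0"
    and L: "\<And>\<gamma>. 0 < \<gamma> \<Longrightarrow> \<gamma> < \<alpha> \<Longrightarrow> tendsto_in_L P \<gamma> (\<lambda>n. rect_sup (\<lambda>B. M (B \<inter> G)) k (\<R> n)) X"
    using X unfolding product_limit_def off_diag_rect_density by blast
  \<comment> \<open>One admissible exponent is enough to extract an almost surely convergent subsequence.\<close>
  define \<gamma> where "\<gamma> = \<alpha> / 2"
  have \<gamma>: "0 < \<gamma>" "\<gamma> < \<alpha>" using alpha by (auto simp: \<gamma>_def)
  define S where "S n = (rect_union k (\<R> n) - A) \<union> (A - rect_union k (\<R> n))" for n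
  define d where "d n = (\<integral>\<^sup>+\<omega>. ennreal (\<bar>enn2real (rect_sup (\<lambda>B. M (B \<inter> G)) k (\<R> n) \<omega>) - enn2real (X \<omega>)\<bar> powr \<gamma>) \<partial>P)" for n
  have "d \<longlonglongrightarrow> 0" using L[OF \<gamma>] unfolding tendsto_in_L_def d_def by blast
  then have "(\<lambda>n. emeasure (power_measure ?\<nu> k) (S n) + d n) \<longlonglongrightarrow> 0"
    using tendsto_add[OF lim, of d 0] by (simp add: S_def)
  then obtain r where r: "\<And>n. emeasure (power_measure ?\<nu> k) (S (r n)) + d (r n) \<le> ennreal ((1/2) ^ n)"
    using tendsto_0_fast_subsequence by blast
  have r1: "emeasure (power_measure ?\<nu> k) (S (r n)) \<le> ennreal ((1/2) ^ n)" for n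
    using r[of n] by (rule order_trans[rotated]) simp
  have r2: "d (r n) \<le> ennreal ((1/2) ^ n)" for n
    using r[of n] by (rule order_trans[rotated]) simp
  have ae_X: "AE \<omega> in P. (\<lambda>n. rect_sup (\<lambda>B. M (B \<inter> G)) k (\<R> (r n)) \<omega>) \<longlonglongrightarrow> X \<omega>"
    using tendsto_in_L_AE_subsequence[OF \<gamma>(1) L[OF \<gamma>]] suminf_le_half_powers[OF r2] unfolding d_def by blast
  define \<Phi> where "\<Phi> f = limsup (\<lambda>n. rect_functional G k (\<R> (r n)) f)" for f :: "'a set \<Rightarrow> ennreal"
  have rect_R: "\<forall>R\<in>\<R> n. off_diag_rect \<mu> k R" for n using R(2) by blast
  note * = fast_approximation_functional[of "\<lambda>n. \<R> (r n)", OF R(1) rect_R suminf_le_half_powers[OF r1[unfolded S_def]]]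
  have "AE \<omega> in P. X \<omega> = \<Phi> (process \<mu> M \<omega>)"
    using ae_X
  proof eventually_elim
    case (elim \<omega>)
    have "limsup (\<lambda>n. rect_sup (\<lambda>B. M (B \<inter> G)) k (\<R> (r n)) \<omega>) = X \<omega>"
      by (rule lim_imp_Limsup[OF sequentially_bot elim])
    then show ?case unfolding \<Phi>_def *(3)[where N=M] by simp
  qed
  moreover have "\<Phi> \<in> borel_measurable (process_space \<mu>)" unfolding \<Phi>_def by (rule *(1))
  moreover have "AE c in canon m. W k (A \<inter> cube G k) c = \<Phi> (process \<mu> W1 c)"
    unfolding \<Phi>_def using *(5) by eventually_elim simp
  ultimately show ?thesis by blast
qed

end

end

section \<open>The joint law of the product limits\<close>

context lepage
begin

context
  fixes P :: "'w measure" and M :: "'a set \<Rightarrow> 'w \<Rightarrow> ennreal" and I :: "'i set"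
    and G :: "'i \<Rightarrow> 'a set" and k :: "'i \<Rightarrow> nat" and A :: "'i \<Rightarrow> (nat \<Rightarrow> 'a) set" and X :: "'i \<Rightarrow> 'w \<Rightarrow> ennreal"
  assumes B: "Borel_space \<mu>" and M: "frechet_family P \<alpha> \<mu> M" and I: "countable I"
    and G: "\<And>i. i \<in> I \<Longrightarrow> G i \<in> sets \<mu>" "\<And>i. i \<in> I \<Longrightarrow> 0 < emeasure \<mu> (G i)" "\<And>i. i \<in> I \<Longrightarrow> emeasure \<mu> (G i) < \<infinity>"
    and A: "\<And>i. i \<in> I \<Longrightarrow> A i \<in> off_diag_sets \<mu> (k i)"
    and X: "\<And>i. i \<in> I \<Longrightarrow> product_limit P \<alpha> (density \<mu> (indicator (G i))) (\<lambda>B. M (B \<inter> G i)) (k i) (A i) (X i)"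
begin

lemma product_limits_measurable: "(\<lambda>\<omega>. \<lambda>i\<in>I. X i \<omega>) \<in> P \<rightarrow>\<^sub>M Pi\<^sub>M I (\<lambda>_. borel)"
  using product_limit_measurable[OF X alpha] by (intro measurable_restrict)

lemma canonical_products_measurable:
  "(\<lambda>c. \<lambda>i\<in>I. W (k i) (A i \<inter> cube (G i) (k i)) c) \<in> canon m \<rightarrow>\<^sub>M Pi\<^sub>M I (\<lambda>_. borel)"
proof (intro measurable_restrict W_measurable)
  fix i assume i: "i \<in> I"
  have "cube (G i) (k i) \<in> sets (power_measure m (k i))"
    using G(1)[OF i] by (intro sets_PiM_I_finite) auto
  then show "A i \<inter> cube (G i) (k i) \<in> sets (power_measure m (k i))"
    using off_diag_setsD(1)[OF B A[OF i]] by auto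
qed

text \<open>
  Countability of the index set allows the almost sure identities for the single variables to be
  used simultaneously; their law is then that of measurable functionals of one process.
\<close>
theorem product_limits_joint_law:
  "distr P (Pi\<^sub>M I (\<lambda>_. borel)) (\<lambda>\<omega>. \<lambda>i\<in>I. X i \<omega>) =
    distr (canon m) (Pi\<^sub>M I (\<lambda>_. borel)) (\<lambda>c. \<lambda>i\<in>I. W (k i) (A i \<inter> cube (G i) (k i)) c)"
proof -
  have "\<forall>i\<in>I. \<exists>\<Phi>. \<Phi> \<in> borel_measurable (process_space \<mu>) \<and>
    (AE \<omega> in P. X i \<omega> = \<Phi> (process \<mu> M \<omega>)) \<and> (AE c in canon m. W (k i) (A i \<inter> cube (G i) (k i)) c = \<Phi> (process \<mu> W1 c))"
    using product_limit_functional[OF B M G A X] by blast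
  from bchoice[OF this] obtain \<Phi> where \<Phi>: "\<And>i. i \<in> I \<Longrightarrow> \<Phi> i \<in> borel_measurable (process_space \<mu>)"
    and ae_P: "\<And>i. i \<in> I \<Longrightarrow> AE \<omega> in P. X i \<omega> = \<Phi> i (process \<mu> M \<omega>)"
    and ae_C: "\<And>i. i \<in> I \<Longrightarrow> AE c in canon m. W (k i) (A i \<inter> cube (G i) (k i)) c = \<Phi> i (process \<mu> W1 c)"
    by blast
  define F where "F f = (\<lambda>i\<in>I. \<Phi> i f)" for f
  have F: "F \<in> process_space \<mu> \<rightarrow>\<^sub>M Pi\<^sub>M I (\<lambda>_. borel)"
    unfolding F_def by (intro measurable_restrict \<Phi>)
  note pM = frechet_family_process_measurable[OF M] and pW = frechet_family_process_measurable[OF W1_frechet_family]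
  have "distr P (Pi\<^sub>M I (\<lambda>_. borel)) (\<lambda>\<omega>. \<lambda>i\<in>I. X i \<omega>) = distr P (Pi\<^sub>M I (\<lambda>_. borel)) (\<lambda>\<omega>. F (process \<mu> M \<omega>))"
  proof (rule distr_cong_AE)
    have "AE \<omega> in P. \<forall>i\<in>I. X i \<omega> = \<Phi> i (process \<mu> M \<omega>)"
      using ae_P by (simp add: AE_ball_countable[OF I])
    then show "AE \<omega> in P. (\<lambda>i\<in>I. X i \<omega>) = F (process \<mu> M \<omega>)"
      by eventually_elim (auto simp: F_def restrict_def)
    show "(\<lambda>\<omega>. \<lambda>i\<in>I. X i \<omega>) \<in> P \<rightarrow>\<^sub>M Pi\<^sub>M I (\<lambda>_. borel)" by (rule product_limits_measurable)
    show "(\<lambda>\<omega>. F (process \<mu> M \<omega>)) \<in> P \<rightarrow>\<^sub>M Pi\<^sub>M I (\<lambda>_. borel)"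
      by (rule measurable_compose[OF pM F])
  qed simp_all
  also have "\<dots> = distr (distr P (process_space \<mu>) (process \<mu> M)) (Pi\<^sub>M I (\<lambda>_. borel)) F"
    by (subst distr_distr[OF F pM]) (simp add: comp_def)
  also have "\<dots> = distr (distr (canon m) (process_space \<mu>) (process \<mu> W1)) (Pi\<^sub>M I (\<lambda>_. borel)) F"
    by (simp only: frechet_family_unique[OF M W1_frechet_family])
  also have "\<dots> = distr (canon m) (Pi\<^sub>M I (\<lambda>_. borel)) (\<lambda>c. F (process \<mu> W1 c))"
    by (subst distr_distr[OF F pW]) (simp add: comp_def)
  also have "\<dots> = distr (canon m) (Pi\<^sub>M I (\<lambda>_. borel)) (\<lambda>c. \<lambda>i\<in>I. W (k i) (A i \<inter> cube (G i) (k i)) c)"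
  proof (rule distr_cong_AE)
    have "AE c in canon m. \<forall>i\<in>I. W (k i) (A i \<inter> cube (G i) (k i)) c = \<Phi> i (process \<mu> W1 c)"
      using ae_C by (simp add: AE_ball_countable[OF I])
    then show "AE c in canon m. F (process \<mu> W1 c) = (\<lambda>i\<in>I. W (k i) (A i \<inter> cube (G i) (k i)) c)"
      by eventually_elim (auto simp: F_def restrict_def)
    show "(\<lambda>c. F (process \<mu> W1 c)) \<in> canon m \<rightarrow>\<^sub>M Pi\<^sub>M I (\<lambda>_. borel)"
      by (rule measurable_compose[OF pW F])
    show "(\<lambda>c. \<lambda>i\<in>I. W (k i) (A i \<inter> cube (G i) (k i)) c) \<in> canon m \<rightarrow>\<^sub>M Pi\<^sub>M I (\<lambda>_. borel)"
      by (rule canonical_products_measurable)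
  qed simp_all
  finally show ?thesis .
qed

corollary product_limits_AE:
  assumes R: "{f \<in> space (Pi\<^sub>M I (\<lambda>_. borel)). R f} \<in> sets (Pi\<^sub>M I (\<lambda>_. borel))"
    and W: "\<And>c. R (\<lambda>i\<in>I. W (k i) (A i \<inter> cube (G i) (k i)) c)"
  shows "AE \<omega> in P. R (\<lambda>i\<in>I. X i \<omega>)"
  unfolding AE_distr_iff[OF product_limits_measurable R, symmetric] product_limits_joint_law
    AE_distr_iff[OF canonical_products_measurable R]
  using W by simp

end

end

text \<open>
  Maxitivity and independence of the exhausting sequence do not mention LePage data; a probability
  measure equivalent to \<open>\<mu>\<close> provides a canonical model for their proof.
\<close>
lemma lepage_exists:
  assumes "0 < \<alpha>" "sigma_finite_measure \<mu>" "emeasure \<mu> (space \<mu>) \<noteq> 0"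
  shows "\<exists>m \<psi>. lepage \<alpha> \<mu> m \<psi>"
proof -
  interpret sigma_finite_measure \<mu> by fact
  obtain h where h[measurable]: "h \<in> borel_measurable \<mu>" and fin: "integral\<^sup>N \<mu> h \<noteq> \<infinity>"
    and pos: "\<forall>x\<in>space \<mu>. 0 < h x \<and> h x < \<infinity>" using Ex_finite_integrable_function by blast
  define a where "a = integral\<^sup>N \<mu> h"
  have a0: "a \<noteq> 0"
  proof
    assume "a = 0"
    then have "AE x in \<mu>. h x = 0" unfolding a_def by (subst (asm) nn_integral_0_iff_AE) auto
    then have "AE x in \<mu>. False" using AE_space by eventually_elim (use pos in auto)
    then show False using assms(3) by (simp add: AE_iff_measurable[OF _ refl])
  qed
  have a1: "a < \<infinity>" using fin by (simp add: a_def less_top)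
  define m where "m = density \<mu> (\<lambda>x. h x / a)"
  define \<psi> where "\<psi> x = a / h x" for x
  have [measurable]: "\<psi> \<in> borel_measurable \<mu>" unfolding \<psi>_def by measurable
  have "emeasure m (space m) = (\<integral>\<^sup>+x. h x / a \<partial>\<mu>)"
    unfolding m_def by (subst emeasure_density) (auto intro!: nn_integral_cong)
  also have "\<dots> = 1" using a0 a1 by (subst nn_integral_divide) (auto simp: a_def[symmetric] ennreal_divide_self)
  finally have m: "prob_space m" by (rule prob_spaceI)
  have "density m \<psi> = density \<mu> (\<lambda>x. h x / a * \<psi> x)"
    unfolding m_def by (rule density_density_eq) measurable
  also have "\<dots> = density \<mu> (\<lambda>_. 1)"
  proof (rule density_cong)
    show "AE x in \<mu>. h x / a * \<psi> x = 1"
    proof (rule AE_I2)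
      fix x assume x: "x \<in> space \<mu>"
      have hx: "h x \<noteq> 0" "h x \<noteq> top" using pos x by (auto simp: less_top[symmetric])
      have "h x / a * \<psi> x = (h x / h x) * (a / a)"
        unfolding \<psi>_def divide_ennreal_def by (simp add: ac_simps)
      also have "\<dots> = 1" using hx a0 a1 by (simp add: ennreal_divide_self less_top)
      finally show "h x / a * \<psi> x = 1" .
    qed
  qed measurable
  also have "\<dots> = \<mu>" by (rule density_1)
  finally have mu: "\<mu> = density m \<psi>" by simp
  have "AE x in m. \<psi> x < \<infinity>"
  proof (rule AE_I2)
    fix x assume "x \<in> space m"
    then have "h x \<noteq> 0" using pos by (auto simp: m_def)
    then show "\<psi> x < \<infinity>" using a1 by (simp add: \<psi>_def ennreal_divide_eq_top_iff less_top[symmetric])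
  qed
  then have "lepage \<alpha> \<mu> m \<psi>" by (intro lepage.intro assms m mu) (simp_all add: m_def)
  then show ?thesis by blast
qed

lemma LePage_data_lepage:
  assumes "0 < \<alpha>" "LePage_data Q \<mu> m \<psi> \<Gamma> T"
  shows "lepage \<alpha> \<mu> m \<psi>"
proof (rule lepage.intro)
  show "AE x in m. \<psi> x < \<infinity>"
    using assms(2) unfolding LePage_data_def by (auto elim: eventually_mono)
qed (use assms in \<open>simp_all add: LePage_data_def\<close>)

lemma exhausts_cube:
  assumes E: "exhausts \<mu> E" and A: "A \<subseteq> space (power_measure \<mu> k)"
  shows "(\<Union>n. A \<inter> cube (E n) k) = A"
proof
  show "A \<subseteq> (\<Union>n. A \<inter> cube (E n) k)"
  proof
    fix x assume x: "x \<in> A"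
    then have xE: "x \<in> {..<k} \<rightarrow>\<^sub>E space \<mu>" using A by (auto simp: space_PiM)
    have mono: "E n \<subseteq> E n'" if "n \<le> n'" for n n'
      by (rule lift_Suc_mono_le[OF _ that]) (use E in \<open>simp add: exhausts_def\<close>)
    have UN: "(\<Union>n. E n) = space \<mu>" using E by (simp add: exhausts_def)
    have "eventually (\<lambda>n. \<forall>i\<in>{..<k}. x i \<in> E n) sequentially"
    proof (intro eventually_ball_finite ballI)
      fix i assume "i \<in> {..<k}"
      then have "x i \<in> (\<Union>n. E n)" unfolding UN using xE by (rule PiE_mem[rotated])
      then obtain n where "x i \<in> E n" by blast
      then show "eventually (\<lambda>n. x i \<in> E n) sequentially"
        using mono unfolding eventually_sequentially by blast
    qed simp
    then obtain n where "\<forall>i\<in>{..<k}. x i \<in> E n" by (auto simp: eventually_sequentially)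
    then have "x \<in> cube (E n) k" using xE by (auto simp: PiE_def)
    then show "x \<in> (\<Union>n. A \<inter> cube (E n) k)" using x by blast
  qed
qed auto

lemma off_diag_sets_UN:
  assumes "Borel_space \<mu>" "\<And>i::nat. B i \<in> off_diag_sets \<mu> k"
  shows "(\<Union>i. B i) \<in> off_diag_sets \<mu> k"
proof -
  have "(\<Union>i. B i) \<in> sets (power_measure \<mu> k)" using off_diag_setsD(1)[OF assms] by auto
  moreover have "(\<Union>i. B i) = (\<Union>i. B i) \<inter> off_diag \<mu> k" using off_diag_setsD(2)[OF assms] by blast
  ultimately show ?thesis unfolding off_diag_sets_def by blast
qed

lemma local_product_limit:
  assumes "0 < \<alpha>" "Borel_space \<mu>" "sigma_finite_measure \<mu>" "emeasure \<mu> (space \<mu>) \<noteq> 0"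
    and "frechet_family P \<alpha> \<mu> M" "exhausts \<mu> E" "A \<in> off_diag_sets \<mu> k"
  shows "product_limit P \<alpha> (density \<mu> (indicator (E n))) (\<lambda>B. M (B \<inter> E n)) k A (local_product P \<alpha> \<mu> M (E n) k A)"
proof -
  obtain m \<psi> where "lepage \<alpha> \<mu> m \<psi>" using lepage_exists assms by blast
  then interpret lepage \<alpha> \<mu> m \<psi> .
  have "\<exists>X. product_limit P \<alpha> (density \<mu> (indicator (E n))) (\<lambda>B. M (B \<inter> E n)) k A X"
    using assms by (intro product_limit_exists) (auto simp: exhausts_def)
  then show ?thesis unfolding local_product_def using product_sup_measure_limit by blast
qed

text \<open>
  In each of the three parts, the variables \<open>M\<^bsub>\<alpha>,E\<^sub>n\<^esub>\<^bsup>(k)\<^esup>(A)\<close> that occur are countable in number and are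
  replaced, by equality of joint laws, with the variables \<open>W k (A \<inter> E\<^sub>n\<^sup>k)\<close>, for which the identity holds at
  every outcome.
\<close>
theorem theorem2p6:
  fixes P :: "'w measure" and \<alpha> :: real and \<mu> :: "'a measure"
    and M :: "'a set \<Rightarrow> 'w \<Rightarrow> ennreal" and E :: "nat \<Rightarrow> 'a set"
  assumes "0 < \<alpha>"
    and "Borel_space \<mu>"
    and "sigma_finite_measure \<mu>"
    and "emeasure \<mu> (space \<mu>) \<noteq> 0"
    and "Frechet_sup_measure P \<alpha> \<mu> M"
    and "exhausts \<mu> E"
  shows
    "(\<forall>(Q :: 'v measure) m \<psi> \<Gamma> T. LePage_data Q \<mu> m \<psi> \<Gamma> T \<longrightarrow>
        same_fdd P Q {(k, A). 1 \<le> k \<and> A \<in> off_diag_sets \<mu> k}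
          (\<lambda>(k, A). sigma_product P \<alpha> \<mu> M E k A)
          (\<lambda>(k, A). LePage_series \<alpha> \<psi> \<Gamma> T k A)) \<and>
     (\<forall>k\<ge>1. \<forall>B :: nat \<Rightarrow> (nat \<Rightarrow> 'a) set. (\<forall>i. B i \<in> off_diag_sets \<mu> k) \<longrightarrow>
        (AE \<omega> in P. sigma_product P \<alpha> \<mu> M E k (\<Union>i. B i) \<omega> =
                     (SUP i. sigma_product P \<alpha> \<mu> M E k (B i) \<omega>))) \<and>
     (\<forall>F. exhausts \<mu> F \<longrightarrow> (\<forall>k\<ge>1. \<forall>A \<in> off_diag_sets \<mu> k.
        AE \<omega> in P. (SUP n. local_product P \<alpha> \<mu> M (E n) k A \<omega>) =
                    (SUP n. local_product P \<alpha> \<mu> M (F n) k A \<omega>)))"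
proof (intro conjI allI impI ballI)
  note \<alpha> = assms(1) and Borel = assms(2)
  have fam: "frechet_family P \<alpha> \<mu> M" using assms(5) by (rule Frechet_sup_measure_family)
  have lim: "product_limit P \<alpha> (density \<mu> (indicator (F n))) (\<lambda>B. M (B \<inter> F n)) k A (local_product P \<alpha> \<mu> M (F n) k A)"
    if "exhausts \<mu> F" "A \<in> off_diag_sets \<mu> k" for F n k A
    using assms fam that by (intro local_product_limit)
  have meas: "local_product P \<alpha> \<mu> M (F n) k A \<in> borel_measurable P"
    if "exhausts \<mu> F" "A \<in> off_diag_sets \<mu> k" for F n k A
    using product_limit_measurable[OF lim[OF that] \<alpha>] .
  have ex: "F n \<in> sets \<mu>" "0 < emeasure \<mu> (F n)" "emeasure \<mu> (F n) < \<infinity>" if "exhausts \<mu> F" for F and n :: nat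
    using that by (auto simp: exhausts_def)
  have in_space: "A \<subseteq> space (power_measure \<mu> k)" if "A \<in> off_diag_sets \<mu> k" for A k
    using off_diag_setsD(1)[OF Borel that] by (rule sets.sets_into_space)
  {
    fix Q :: "'v measure" and m \<psi> \<Gamma> T
    assume data: "LePage_data Q \<mu> m \<psi> \<Gamma> T"
    interpret lepage \<alpha> \<mu> m \<psi> using \<alpha> data by (rule LePage_data_lepage)
    define f where "f = (\<lambda>\<omega>. (\<lambda>i. gap \<Gamma> i \<omega>, \<lambda>i. T i \<omega>))"
    have f: "f \<in> Q \<rightarrow>\<^sub>M canon m" and fd: "distr Q (canon m) f = canon m"
      unfolding f_def using LePage_data_canonical[OF data] .
    let ?K = "{(k, A). 1 \<le> k \<and> A \<in> off_diag_sets \<mu> k}"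
    have series: "LePage_series \<alpha> \<psi> \<Gamma> T k A = (\<lambda>\<omega>. W k A (f \<omega>))" for k A
      by (simp add: fun_eq_iff LePage_series_eq_tuple_sup f_def)
    have Wm: "W k A \<in> borel_measurable (canon m)" if "A \<in> off_diag_sets \<mu> k" for k A
      using off_diag_setsD(1)[OF Borel that] by (intro W_measurable) simp
    show "same_fdd P Q ?K (\<lambda>(k, A). sigma_product P \<alpha> \<mu> M E k A) (\<lambda>(k, A). LePage_series \<alpha> \<psi> \<Gamma> T k A)"
      unfolding same_fdd_def
    proof (intro conjI ballI allI impI)
      fix i assume i: "i \<in> ?K"
      then obtain k A where i_eq: "i = (k, A)" "A \<in> off_diag_sets \<mu> k" by auto
      show "(case i of (k, A) \<Rightarrow> sigma_product P \<alpha> \<mu> M E k A) \<in> borel_measurable P"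
        unfolding i_eq prod.case sigma_product_def using meas[OF assms(6) i_eq(2)] by (intro borel_measurable_SUP) auto
      show "(case i of (k, A) \<Rightarrow> LePage_series \<alpha> \<psi> \<Gamma> T k A) \<in> borel_measurable Q"
        unfolding i_eq prod.case series by (rule measurable_compose[OF f Wm[OF i_eq(2)]])
    next
      fix J assume J: "finite J \<and> J \<subseteq> ?K"
      \<comment> \<open>The suprema over \<open>n\<close> are taken after the laws of the single terms have been compared.\<close>
      let ?I = "J \<times> (UNIV :: nat set)"
      define S where "S g = (\<lambda>p\<in>J. SUP n. g (p, n))" for g :: "(nat \<times> (nat \<Rightarrow> 'a) set) \<times> nat \<Rightarrow> ennreal"
      have S: "S \<in> Pi\<^sub>M ?I (\<lambda>_. borel) \<rightarrow>\<^sub>M Pi\<^sub>M J (\<lambda>_. borel)"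
        unfolding S_def by (intro measurable_restrict borel_measurable_SUP measurable_component_singleton) auto
      define X where "X = (\<lambda>\<omega>. \<lambda>i\<in>?I. local_product P \<alpha> \<mu> M (E (snd i)) (fst (fst i)) (snd (fst i)) \<omega>)"
      define Y where "Y = (\<lambda>c. \<lambda>i\<in>?I. W (fst (fst i)) (snd (fst i) \<inter> cube (E (snd i)) (fst (fst i))) c)"
      have Jm: "A \<in> off_diag_sets \<mu> k" if "(k, A) \<in> J" for k A using J that by auto
      have I: "countable ?I" using J by (intro countable_SIGMA) (auto intro: countable_finite)
      note conds = Borel fam I ex(1)[OF assms(6)] ex(2)[OF assms(6)] ex(3)[OF assms(6)]
      have lim_I: "product_limit P \<alpha> (density \<mu> (indicator (E (snd i)))) (\<lambda>B. M (B \<inter> E (snd i)))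
            (fst (fst i)) (snd (fst i)) (local_product P \<alpha> \<mu> M (E (snd i)) (fst (fst i)) (snd (fst i)))"
        and A_I: "snd (fst i) \<in> off_diag_sets \<mu> (fst (fst i))" if "i \<in> ?I" for i
        using that Jm lim[OF assms(6)] by auto
      have law: "distr P (Pi\<^sub>M ?I (\<lambda>_. borel)) X = distr (canon m) (Pi\<^sub>M ?I (\<lambda>_. borel)) Y"
        unfolding X_def Y_def by (rule product_limits_joint_law[OF conds A_I lim_I])
      have Xm: "X \<in> P \<rightarrow>\<^sub>M Pi\<^sub>M ?I (\<lambda>_. borel)"
        unfolding X_def by (rule product_limits_measurable[OF conds A_I lim_I])
      have Ym: "Y \<in> canon m \<rightarrow>\<^sub>M Pi\<^sub>M ?I (\<lambda>_. borel)"
        unfolding Y_def by (rule canonical_products_measurable[OF conds A_I lim_I])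
      have SX: "(\<lambda>\<omega>. \<lambda>i\<in>J. (case i of (k, A) \<Rightarrow> sigma_product P \<alpha> \<mu> M E k A) \<omega>) = S \<circ> X"
        by (auto simp: fun_eq_iff S_def X_def sigma_product_def restrict_def)
      have WS: "W k A c = (SUP n. W k (A \<inter> cube (E n) k) c)" if "(k, A) \<in> J" for k A c
        using tuple_sup_UN[of _ _ k "\<lambda>n. A \<inter> cube (E n) k" UNIV] exhausts_cube[OF assms(6) in_space[OF Jm[OF that]]] by simp
      have SY: "(\<lambda>\<omega>. \<lambda>i\<in>J. (case i of (k, A) \<Rightarrow> LePage_series \<alpha> \<psi> \<Gamma> T k A) \<omega>) = (S \<circ> Y) \<circ> f"
        by (auto simp: fun_eq_iff S_def Y_def series WS restrict_def)
      have "distr P (Pi\<^sub>M J (\<lambda>_. borel)) (S \<circ> X) = distr (distr P (Pi\<^sub>M ?I (\<lambda>_. borel)) X) (Pi\<^sub>M J (\<lambda>_. borel)) S"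
        by (rule distr_distr[OF S Xm, symmetric])
      also have "\<dots> = distr (canon m) (Pi\<^sub>M J (\<lambda>_. borel)) (S \<circ> Y)"
        unfolding law by (rule distr_distr[OF S Ym])
      also have "\<dots> = distr (distr Q (canon m) f) (Pi\<^sub>M J (\<lambda>_. borel)) (S \<circ> Y)"
        by (simp only: fd)
      also have "\<dots> = distr Q (Pi\<^sub>M J (\<lambda>_. borel)) ((S \<circ> Y) \<circ> f)"
        by (rule distr_distr[OF measurable_comp[OF Ym S] f])
      finally show "distr P (Pi\<^sub>M J (\<lambda>_. borel)) (\<lambda>\<omega>. \<lambda>i\<in>J. (case i of (k, A) \<Rightarrow> sigma_product P \<alpha> \<mu> M E k A) \<omega>) =
        distr Q (Pi\<^sub>M J (\<lambda>_. borel)) (\<lambda>\<omega>. \<lambda>i\<in>J. (case i of (k, A) \<Rightarrow> LePage_series \<alpha> \<psi> \<Gamma> T k A) \<omega>)"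
        unfolding SX SY .
    qed
  next
    fix k :: nat and B :: "nat \<Rightarrow> (nat \<Rightarrow> 'a) set"
    assume "1 \<le> k" and B: "\<forall>i. B i \<in> off_diag_sets \<mu> k"
    obtain m0 \<psi>0 where "lepage \<alpha> \<mu> m0 \<psi>0" using lepage_exists assms by blast
    then interpret L: lepage \<alpha> \<mu> m0 \<psi>0 .
    \<comment> \<open>Index 0 stands for the union and index \<open>Suc i\<close> for \<open>B i\<close>, so that one countable family covers both sides.\<close>
    define C where "C j = (case j of 0 \<Rightarrow> (\<Union>i. B i) | Suc i \<Rightarrow> B i)" for j :: nat
    have C: "C j \<in> off_diag_sets \<mu> k" for j
      using B off_diag_sets_UN[OF Borel, of B k] by (auto simp: C_def split: nat.split)
    let ?I = "UNIV :: (nat \<times> nat) set"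
    let ?Y = "\<lambda>c. \<lambda>i\<in>?I. L.W k (C (snd i) \<inter> cube (E (fst i)) k) c"
    define R where "R f \<longleftrightarrow> (SUP n. f (n, 0)) = (SUP i. SUP n. f (n, Suc i))" for f :: "nat \<times> nat \<Rightarrow> ennreal"
    have RY: "R (?Y c)" for c
    proof -
      have "(SUP n. L.W k (C 0 \<inter> cube (E n) k) c) = (SUP n. SUP i. L.W k (C (Suc i) \<inter> cube (E n) k) c)"
      proof (rule SUP_cong[OF refl])
        fix n
        have "C 0 \<inter> cube (E n) k = (\<Union>i. C (Suc i) \<inter> cube (E n) k)" by (auto simp: C_def)
        then show "L.W k (C 0 \<inter> cube (E n) k) c = (SUP i. L.W k (C (Suc i) \<inter> cube (E n) k) c)"
          by (simp only: tuple_sup_UN)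
      qed
      also have "\<dots> = (SUP i. SUP n. L.W k (C (Suc i) \<inter> cube (E n) k) c)" by (rule SUP_commute)
      finally show ?thesis by (simp add: R_def)
    qed
    have "AE \<omega> in P. R (\<lambda>i\<in>?I. local_product P \<alpha> \<mu> M (E (fst i)) k (C (snd i)) \<omega>)"
    proof (rule L.product_limits_AE[OF Borel fam])
      show "{f \<in> space (Pi\<^sub>M ?I (\<lambda>_. borel)). R f} \<in> sets (Pi\<^sub>M ?I (\<lambda>_. borel))"
        unfolding R_def by measurable
      show "R (?Y c)" for c by (rule RY)
    qed (use ex[OF assms(6)] lim[OF assms(6)] C in auto)
    then show "AE \<omega> in P. sigma_product P \<alpha> \<mu> M E k (\<Union>i. B i) \<omega> = (SUP i. sigma_product P \<alpha> \<mu> M E k (B i) \<omega>)"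
      by eventually_elim (simp add: R_def C_def sigma_product_def)
  next
    fix F :: "nat \<Rightarrow> 'a set" and k :: nat and A
    assume F: "exhausts \<mu> F" and "1 \<le> k" and A: "A \<in> off_diag_sets \<mu> k"
    obtain m0 \<psi>0 where "lepage \<alpha> \<mu> m0 \<psi>0" using lepage_exists assms by blast
    then interpret L: lepage \<alpha> \<mu> m0 \<psi>0 .
    define D where "D b = (if b then E else F)" for b :: bool
    have D: "exhausts \<mu> (D b)" for b using F assms(6) by (simp add: D_def)
    let ?I = "UNIV :: (nat \<times> bool) set"
    let ?Y = "\<lambda>c. \<lambda>i\<in>?I. L.W k (A \<inter> cube (D (snd i) (fst i)) k) c"
    define R where "R f \<longleftrightarrow> (SUP n. f (n, True)) = (SUP n. f (n, False))" for f :: "nat \<times> bool \<Rightarrow> ennreal"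
    have RY: "R (?Y c)" for c
    proof -
      have "(SUP n. L.W k (A \<inter> cube (D b n) k) c) = L.W k A c" for b
        using tuple_sup_UN[of _ _ k "\<lambda>n. A \<inter> cube (D b n) k" UNIV] exhausts_cube[OF D in_space[OF A]] by simp
      then show ?thesis by (simp add: R_def)
    qed
    have "AE \<omega> in P. R (\<lambda>i\<in>?I. local_product P \<alpha> \<mu> M (D (snd i) (fst i)) k A \<omega>)"
    proof (rule L.product_limits_AE[OF Borel fam])
      show "{f \<in> space (Pi\<^sub>M ?I (\<lambda>_. borel)). R f} \<in> sets (Pi\<^sub>M ?I (\<lambda>_. borel))"
        unfolding R_def by measurable
      show "R (?Y c)" for c by (rule RY)
    qed (use ex[OF D] lim[OF D] A in auto)
    then show "AE \<omega> in P. (SUP n. local_product P \<alpha> \<mu> M (E n) k A \<omega>) = (SUP n. local_product P \<alpha> \<mu> M (F n) k A \<omega>)"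
      by eventually_elim (simp add: R_def D_def)
  }
qed

end
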